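(* Let $M$ be a real $d\times d$ dilation matrix, $N\in\mathbb{Z}_+$, and let $L$ be the differential operator $Lf=\sum_{[\beta]\le N}a_\beta D^\beta f$, where $a_\beta\in\mathbb{C}$ and $a_{\mathbf 0}\neq0$. Suppose that (a) $\widetilde\varphi$ is the distribution associated with $L$; (b) $\varphi\in\mathcal{B}$; (c) $\widetilde\varphi$ and $\varphi$ are strictly compatible, with parameter $\delta\in(0,1/2)$; (d) $f\in C(\mathbb{R}^d)$, $\widehat f\in L_1(\mathbb{R}^d)$, and $\widehat f(\xi)=O(|\xi|^{-N-d-\varepsilon})$ as $|\xi|\to\infty$, where $\varepsilon>0$. Then for every $x\in\mathbb{R}^d$ and $j\in\mathbb{Z}$ the series $$\sum_{k\in\mathbb{Z}^d}Lf(M^{-j}\cdot)(-k)\,\varphi_{jk}(x),$$ considered as the limit of cubic partial sums (over $\|k\|_\infty\le R$, $R\to\infty$), converges, and $$\left|f(x)-m^{-j/2}\sum_{k\in\mathbb{Z}^d}Lf(M^{-j}\cdot)(-k)\,\varphi_{jk}(x)\right|\le C\,\|M^{*-j}\|^N\int_{|M^{*-j}\xi|\ge\delta}|\xi|^N|\widehat f(\xi)|\,d\xi\le C'\,\vartheta^{-j(N+\varepsilon)},$$ where $C$ does not depend on $f$, $j$ and $x$; $C'$ does not depend on $j$ and $x$; and $\vartheta$ is a positive number which is smaller than the modulus of every eigenvalue of $M$.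
   Context: A dilation matrix is a real $d\times d$ matrix all of whose eigenvalues are bigger than $1$ in modulus; $m=|\det M|$, $M^*$ is the conjugate (transpose) matrix, $M^{*-j}=(M^* )^{-j}$, and $\|\cdot\|$ is the operator norm. $[\beta]=\beta_1+\dots+\beta_d$ for $\beta\in\mathbb{Z}_+^d$, $\widehat f(\xi)=\int_{\mathbb{R}^d}f(x)e^{-2\pi i(x,\xi)}\,dx$ (in the sense of tempered distributions in general), and $\varphi_{jk}(x)=m^{j/2}\varphi(M^jx+k)$. $Lf(M^{-j}\cdot)(-k)$ denotes the value at $-k$ of $L$ applied to the function $x\mapsto f(M^{-j}x)$. The distribution associated with $L$ is $\widetilde\varphi=\sum_{[\beta]\le N}\overline{a_\beta}(-1)^{[\beta]}D^\beta\delta$, where $\delta$ here is the Dirac delta; thus $\widehat{\widetilde\varphi}(\xi)=\sum_{[\beta]\le N}\overline{a_\beta}(-2\pi i\xi)^\beta$. $\mathcal{B}=\mathcal{B}(\mathbb{R}^d)$ is the class of functions $\varphi(x)=\int_{\mathbb{R}^d}\theta(\xi)e^{2\pi i(x,\xi)}\,d\xi$, where $\theta$ is supported on a parallelepiped $S=[a_1,b_1]\times\dots\times[a_d,b_d]$ and $\theta|_S\in C^d(S)$ (so $\widehat\varphi=\theta$). A tempered distribution $\widetilde\varphi$ and a function $\varphi$ are strictly compatible (with parameter $\delta$) if there is $\delta\in(0,1/2)$ such that $\overline{\widehat\varphi(\xi)}\,\widehat{\widetilde\varphi}(\xi)=1$ for a.e. $\xi$ with $|\xi|<\delta$, and $\widehat\varphi(\xi)=0$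 for a.e. $\xi$ with $|l-\xi|<\delta$, for all $l\in\mathbb{Z}^d\setminus\{0\}$.
   Formalization: The last inequality is stated with C' uniform over all j ≥ J, for each integer J (C' may depend on J); with one C' for all j in Z it fails as j → -∞, e.g. d=1, M=2, N=0, φ=sinc, f Gaussian, ϑ=1/2. *)

theory Defs
  imports "HOL-Analysis.Analysis" "HOL-Library.Landau_Symbols"
begin

section \<open>Multi-indices and partial derivatives\<close>

definition mi_order :: "nat ^ 'n::finite \<Rightarrow> nat" where
  "mi_order \<beta> = (\<Sum>i\<in>UNIV. \<beta> $ i)"

definition partial_deriv ::
  "'n::finite \<Rightarrow> (real ^ 'n \<Rightarrow> complex) \<Rightarrow> real ^ 'n \<Rightarrow> complex" where
  "partial_deriv i f x = vector_derivative (\<lambda>t. f (x + t *\<^sub>R axis i 1)) (at 0)"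

text \<open>
  The index type carries no order, so one enumeration of the coordinates is fixed. On functions
  with continuous partial derivatives up to the order of \<open>\<beta>\<close>, the operator \<open>mi_deriv \<beta>\<close> does not
  depend on this choice.
\<close>

definition coords :: "'n::finite list" where
  "coords = (SOME is. set is = UNIV \<and> distinct is)"

definition mi_deriv ::
  "nat ^ 'n::finite \<Rightarrow> (real ^ 'n \<Rightarrow> complex) \<Rightarrow> real ^ 'n \<Rightarrow> complex" where
  "mi_deriv \<beta> f = foldr (\<lambda>i. partial_deriv i ^^ (\<beta> $ i)) coords f"

text \<open>
  All partial derivatives up to order \<open>k\<close> exist and are continuous on \<open>S\<close>. They are taken within
  \<open>S\<close>: for open \<open>S\<close> this is the usual notion, and on a closed nondegenerate box the derivatives
  at boundary points are one-sided.
\<close>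

fun Ck_on :: "nat \<Rightarrow> (real ^ 'n::finite) set \<Rightarrow> (real ^ 'n \<Rightarrow> complex) \<Rightarrow> bool" where
  "Ck_on 0 S f \<longleftrightarrow> continuous_on S f"
| "Ck_on (Suc k) S f \<longleftrightarrow> continuous_on S f \<and>
     (\<forall>i. \<exists>g. Ck_on k S g \<and>
        (\<forall>x\<in>S. ((\<lambda>t. f (x + t *\<^sub>R axis i 1)) has_vector_derivative g x)
                 (at 0 within {t. x + t *\<^sub>R axis i 1 \<in> S})))"


section \<open>Schwartz functions, tempered distributions, Fourier transform\<close>

definition schwartz_weighted ::
  "nat ^ 'n::finite \<Rightarrow> nat ^ 'n \<Rightarrow> (real ^ 'n \<Rightarrow> complex) \<Rightarrow> real ^ 'n \<Rightarrow> real" where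
  "schwartz_weighted \<alpha> \<beta> \<psi> x = \<bar>\<Prod>i\<in>UNIV. (x $ i) ^ (\<alpha> $ i)\<bar> * cmod (mi_deriv \<beta> \<psi> x)"

definition schwartz :: "(real ^ 'n::finite \<Rightarrow> complex) \<Rightarrow> bool" where
  "schwartz \<psi> \<longleftrightarrow> (\<forall>k. Ck_on k UNIV \<psi>) \<and>
     (\<forall>\<alpha> \<beta>. bdd_above (range (schwartz_weighted \<alpha> \<beta> \<psi>)))"

definition schwartz_seminorm ::
  "nat ^ 'n::finite \<Rightarrow> nat ^ 'n \<Rightarrow> (real ^ 'n \<Rightarrow> complex) \<Rightarrow> real" where
  "schwartz_seminorm \<alpha> \<beta> \<psi> = (SUP x. schwartz_weighted \<alpha> \<beta> \<psi> x)"

text \<open>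
  A distribution is a functional on all functions, of which only the values on Schwartz functions
  matter.
\<close>

type_synonym 'n functional = "(real ^ 'n \<Rightarrow> complex) \<Rightarrow> complex"

definition tempered_distribution :: "'n::finite functional \<Rightarrow> bool" where
  "tempered_distribution T \<longleftrightarrow>
     (\<forall>\<psi> \<omega>. schwartz \<psi> \<longrightarrow> schwartz \<omega> \<longrightarrow> T (\<lambda>x. \<psi> x + \<omega> x) = T \<psi> + T \<omega>) \<and>
     (\<forall>c \<psi>. schwartz \<psi> \<longrightarrow> T (\<lambda>x. c * \<psi> x) = c * T \<psi>) \<and>
     (\<exists>C n. \<forall>\<psi>. schwartz \<psi> \<longrightarrow>
        cmod (T \<psi>) \<le> C * (\<Sum>\<alpha> | mi_order \<alpha> \<le> n. \<Sum>\<beta> | mi_order \<beta> \<le> n. schwartz_seminorm \<alpha> \<beta> \<psi>))"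

definition function_distribution :: "(real ^ 'n::finite \<Rightarrow> complex) \<Rightarrow> 'n functional" where
  "function_distribution g \<psi> = (LINT x|lborel. g x * \<psi> x)"

definition tempered_function :: "(real ^ 'n::finite \<Rightarrow> complex) \<Rightarrow> bool" where
  "tempered_function g \<longleftrightarrow> g \<in> borel_measurable lborel \<and>
     (\<forall>\<psi>. schwartz \<psi> \<longrightarrow> integrable lborel (\<lambda>x. g x * \<psi> x)) \<and>
     tempered_distribution (function_distribution g)"

definition fourier :: "(real ^ 'n::finite \<Rightarrow> complex) \<Rightarrow> real ^ 'n \<Rightarrow> complex" where
  "fourier \<psi> \<xi> = (LINT x|lborel. \<psi> x * exp (- 2 * pi * \<i> * of_real (x \<bullet> \<xi>)))"

definition dist_fourier :: "'n::finite functional \<Rightarrow> 'n functional" where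
  "dist_fourier T \<psi> = T (fourier \<psi>)"

definition dist_deriv :: "nat ^ 'n::finite \<Rightarrow> 'n functional \<Rightarrow> 'n functional" where
  "dist_deriv \<beta> T \<psi> = (- 1) ^ mi_order \<beta> * T (mi_deriv \<beta> \<psi>)"

definition dirac :: "'n::finite functional" where
  "dirac \<psi> = \<psi> 0"

definition dist_fourier_is :: "'n::finite functional \<Rightarrow> (real ^ 'n \<Rightarrow> complex) \<Rightarrow> bool" where
  "dist_fourier_is T G \<longleftrightarrow> tempered_distribution T \<and> tempered_function G \<and>
     (\<forall>\<psi>. schwartz \<psi> \<longrightarrow> dist_fourier T \<psi> = function_distribution G \<psi>)"

definition fourier_is ::
  "(real ^ 'n::finite \<Rightarrow> complex) \<Rightarrow> (real ^ 'n \<Rightarrow> complex) \<Rightarrow> bool" where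
  "fourier_is g G \<longleftrightarrow> tempered_function g \<and> dist_fourier_is (function_distribution g) G"


section \<open>Dilation matrices\<close>

definition eigenvalue_of :: "real ^ 'n ^ 'n::finite \<Rightarrow> complex \<Rightarrow> bool" where
  "eigenvalue_of M \<mu> \<longleftrightarrow>
     (\<exists>v :: complex ^ 'n. v \<noteq> 0 \<and> map_matrix complex_of_real M *v v = \<mu> *s v)"

definition dilation_matrix :: "real ^ 'n ^ 'n::finite \<Rightarrow> bool" where
  "dilation_matrix M \<longleftrightarrow> (\<forall>\<mu>. eigenvalue_of M \<mu> \<longrightarrow> 1 < cmod \<mu>)"

definition mat_powi :: "real ^ 'n ^ 'n::finite \<Rightarrow> int \<Rightarrow> real ^ 'n ^ 'n" where
  "mat_powi A j = (if 0 \<le> j then (((**) A) ^^ nat j) (mat 1)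
                   else (((**) (matrix_inv A)) ^^ nat (- j)) (mat 1))"

definition op_norm :: "real ^ 'n ^ 'n::finite \<Rightarrow> real" where
  "op_norm A = onorm (\<lambda>x. A *v x)"


section \<open>The sampling operator\<close>

definition diff_op ::
  "nat \<Rightarrow> (nat ^ 'n::finite \<Rightarrow> complex) \<Rightarrow> (real ^ 'n \<Rightarrow> complex) \<Rightarrow> real ^ 'n \<Rightarrow> complex" where
  "diff_op N a f x = (\<Sum>\<beta> | mi_order \<beta> \<le> N. a \<beta> * mi_deriv \<beta> f x)"

definition assoc_distribution ::
  "nat \<Rightarrow> (nat ^ 'n::finite \<Rightarrow> complex) \<Rightarrow> 'n functional" where
  "assoc_distribution N a \<psi> =
     (\<Sum>\<beta> | mi_order \<beta> \<le> N. cnj (a \<beta>) * (- 1) ^ mi_order \<beta> * dist_deriv \<beta> dirac \<psi>)"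

definition class_B :: "(real ^ 'n::finite \<Rightarrow> complex) \<Rightarrow> bool" where
  "class_B \<phi> \<longleftrightarrow> (\<exists>\<theta> a b. (\<forall>i. a $ i < b $ i) \<and>
     (\<forall>\<xi>. \<xi> \<notin> cbox a b \<longrightarrow> \<theta> \<xi> = 0) \<and> Ck_on CARD('n) (cbox a b) \<theta> \<and>
     (\<forall>x. \<phi> x = (LINT \<xi>|lborel. \<theta> \<xi> * exp (2 * pi * \<i> * of_real (x \<bullet> \<xi>)))))"

definition int_vec :: "int ^ 'n::finite \<Rightarrow> real ^ 'n" where
  "int_vec k = (\<chi> i. of_int (k $ i))"

definition strictly_compatible ::
  "'n::finite functional \<Rightarrow> (real ^ 'n \<Rightarrow> complex) \<Rightarrow> real \<Rightarrow> bool" where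
  "strictly_compatible T \<phi> \<delta> \<longleftrightarrow> 0 < \<delta> \<and> \<delta> < 1/2 \<and>
     (\<exists>G H. dist_fourier_is T G \<and> fourier_is \<phi> H \<and>
        (AE \<xi> in lborel. norm \<xi> < \<delta> \<longrightarrow> cnj (H \<xi>) * G \<xi> = 1) \<and>
        (\<forall>l. l \<noteq> 0 \<longrightarrow> (AE \<xi> in lborel. norm (int_vec l - \<xi>) < \<delta> \<longrightarrow> H \<xi> = 0)))"

definition dilate_shift ::
  "real ^ 'n ^ 'n::finite \<Rightarrow> (real ^ 'n \<Rightarrow> complex) \<Rightarrow> int \<Rightarrow> int ^ 'n \<Rightarrow> real ^ 'n \<Rightarrow> complex" where
  "dilate_shift M \<phi> j k x =
     of_real (\<bar>det M\<bar> powr (of_int j / 2)) * \<phi> (mat_powi M j *v x + int_vec k)"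

definition cubic_partial_sum ::
  "nat \<Rightarrow> (nat ^ 'n::finite \<Rightarrow> complex) \<Rightarrow> real ^ 'n ^ 'n \<Rightarrow> (real ^ 'n \<Rightarrow> complex) \<Rightarrow>
   (real ^ 'n \<Rightarrow> complex) \<Rightarrow> int \<Rightarrow> real ^ 'n \<Rightarrow> nat \<Rightarrow> complex" where
  "cubic_partial_sum N a M \<phi> f j x R =
     (\<Sum>k :: int ^ 'n | \<forall>i. \<bar>k $ i\<bar> \<le> int R.
        diff_op N a (\<lambda>y. f (mat_powi M (- j) *v y)) (- int_vec k) * dilate_shift M \<phi> j k x)"

end

theory Submission
  imports Defs "HOL-Probability.Characteristic_Functions" "HOL-Real_Asymp.Real_Asymp"
    "HOL-Computational_Algebra.Fundamental_Theorem_Algebra"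
begin

text \<open>
  Write \<open>A = (M\<^sup>T)^(-j)\<close>, \<open>y = M^j x\<close>, let \<open>\<theta>\<close> be the Fourier transform of \<open>\<phi>\<close> and \<open>P\<close> the symbol
  of \<open>L\<close>. Testing against Gaussians shows that \<open>f\<close> is the inverse Fourier integral of its transform
  \<open>F\<close>, so \<open>L f(M^(-j) \<cdot>)(-k)\<close> is the integral of \<open>F(\<xi>) P(A\<xi>) exp(-2\<pi>i (k, A\<xi>))\<close>, and the cubic partial
  sums become integrals of \<open>F(\<xi>) P(A\<xi>)\<close> against the cubic Fourier partial sums, at \<open>A\<xi>\<close>, of the
  periodization \<open>\<Theta>\<close> of \<open>u(\<zeta>) = \<theta>(\<zeta>) exp(2\<pi>i (y, \<zeta>))\<close>. Since \<open>\<theta>\<close> is \<open>d\<close> times differentiable on its box,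
  \<open>u\<close> is a superposition of indicators of boxes; hence these partial sums are superpositions of
  products of integrated Dirichlet kernels, which are uniformly bounded and converge off a null set,
  and dominated convergence yields the limit. By strict compatibility
  \<open>P(\<eta>) \<Theta>(\<eta>) = exp(2\<pi>i (y, \<eta>))\<close> for almost all \<open>|\<eta>| < \<delta>\<close>, so only \<open>|A\<xi>| \<ge> \<delta>\<close> contributes to the
  error, and there \<open>1 + |P\<Theta>|\<close> is bounded by a multiple of \<open>|A\<xi>|^N\<close>.
\<close>

subsection \<open>Product measures and Gaussian integrals\<close>

text \<open>The obstacle is that \<open>\<theta>\<close> may jump to 0 at the faces of its box. In
  general \<open>\<phi>\<close> then decays too slowly for absolute convergence, and since the L1
  norms of the Dirichlet kernels grow like log R, no bound uniform in R follows from sup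
  |\<open>\<theta>\<close>| alone. The kernels have to be integrated over intervals before absolute
  values are taken; the price is one derivative per coordinate. The uniform bound obtained in this
  way depends on \<open>y\<close>, because the density that represents \<open>u\<close> does. It
  therefore serves only as a majorant for passing to the limit. The constant \<open>C\<close> is
  read off the limit itself: the number of lattice translates of a point that fall into the box is
  bounded in terms of its side lengths, and each contributes at most sup |\<open>\<theta>\<close>|.
  Hence \<open>C\<close> is the same for all \<open>f\<close>, \<open>j\<close> and
  \<open>x\<close>. For the last estimate, |A\<xi>| \<ge> \<delta> forces |\<xi>| \<ge> \<delta> /
  ||A||, and the decay of the transform turns the tail into a factor ||A||^\<epsilon> besides
  ||A||^N. The eigenvalues then control ||A|| by a power of the chosen lower bound, for
  \<open>j\<close> bounded below.\<close>

lemma vec_nth_measurable [measurable (raw)]: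
  fixes w :: "'a \<Rightarrow> real ^ 'n::finite"
  assumes "w \<in> borel_measurable M"
  shows "(\<lambda>x. w x $ i) \<in> borel_measurable M"
  by (rule measurable_compose[OF assms]) (intro borel_measurable_continuous_onI continuous_intros)

lemma borel_measurable_vec_lambda:
  fixes f :: "'a \<Rightarrow> 'n::finite \<Rightarrow> real"
  assumes "\<And>j. (\<lambda>x. f x j) \<in> borel_measurable M"
  shows "(\<lambda>x. \<chi> j. f x j) \<in> borel_measurable M"
proof -
  note [measurable] = assms
  have "(\<lambda>x. \<Sum>j\<in>UNIV. f x j *\<^sub>R axis j (1::real)) \<in> borel_measurable M"
    by measurable
  also have "(\<lambda>x. \<Sum>j\<in>UNIV. f x j *\<^sub>R axis j (1::real)) = (\<lambda>x. \<chi> j. f x j)"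
    by (simp add: fun_eq_iff vec_eq_iff axis_def sum.delta if_distrib cong: if_cong)
  finally show ?thesis .
qed

lemma vec_lambda_measurable [measurable]:
  "vec_lambda \<in> measurable (PiM (UNIV::'n::finite set) (\<lambda>_. lborel :: real measure)) borel"
  by (rule borel_measurable_vec_lambda) simp

text \<open>Lebesgue measure is determined by its values on boxes. The identity makes Fubini for
  products of one-variable functions, which is available for \<open>PiM\<close>, applicable to
  integrals over \<open>real ^ 'n\<close>.\<close>

lemma lborel_vec_eq_distr:
  "(lborel :: (real ^ 'n::finite) measure) = distr (PiM UNIV (\<lambda>_. lborel)) borel vec_lambda"
proof (rule lborel_eqI)
  interpret product_sigma_finite "\<lambda>_::'n. lborel :: real measure" by standard
  fix l u :: "real^'n" assume le: "\<And>b. b \<in> Basis \<Longrightarrow> l \<bullet> b \<le> u \<bullet> b"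
  have le': "l $ i \<le> u $ i" for i
    using le[of "axis i 1"] by (simp add: inner_axis axis_in_Basis_iff)
  have "emeasure (distr (PiM UNIV (\<lambda>_. lborel)) borel vec_lambda) (box l u)
     = emeasure (PiM UNIV (\<lambda>_. lborel)) (vec_lambda -` box l u \<inter> space (PiM UNIV (\<lambda>_::'n. lborel::real measure)))"
    by (rule emeasure_distr) auto
  also have "vec_lambda -` box l u \<inter> space (PiM UNIV (\<lambda>_::'n. lborel::real measure)) = PiE UNIV (\<lambda>i. {l $ i<..<u $ i})"
    by (auto simp: space_PiM mem_box_cart PiE_def Pi_iff)
  also have "emeasure (PiM UNIV (\<lambda>_. lborel)) \<dots> = (\<Prod>i\<in>UNIV. ennreal (u $ i - l $ i))"
    by (subst emeasure_PiM) (auto simp: le')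
  also have "\<dots> = ennreal (\<Prod>i\<in>UNIV. u $ i - l $ i)"
    by (rule prod_ennreal) (simp add: le')
  also have "(\<Prod>i\<in>UNIV. u $ i - l $ i) = (\<Prod>b\<in>Basis. (u - l) \<bullet> b)"
  proof -
    have "(\<Prod>b\<in>(\<lambda>i. axis i 1) ` (UNIV::'n set). (u - l) \<bullet> b) = (\<Prod>i\<in>UNIV. (u - l) \<bullet> axis i 1)"
      by (rule prod.reindex_cong[where l="\<lambda>i. axis i 1"]) (auto simp: inj_on_def axis_eq_axis)
    moreover have "(Basis :: (real^'n) set) = (\<lambda>i. axis i 1) ` UNIV" by (auto simp: Basis_vec_def)
    ultimately show ?thesis by (simp add: inner_axis)
  qed
  finally show "emeasure (distr (PiM UNIV (\<lambda>_. lborel)) borel vec_lambda) (box l u) = ennreal (\<Prod>b\<in>Basis. (u - l) \<bullet> b)" .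
qed simp

lemma integral_lborel_vec:
  fixes f :: "real^'n::finite \<Rightarrow> 'b::{banach, second_countable_topology}"
  assumes "f \<in> borel_measurable borel"
  shows "(LINT x|lborel. f x) = (LINT x|PiM UNIV (\<lambda>_. lborel). f (vec_lambda x))"
  by (subst lborel_vec_eq_distr, rule integral_distr) (use assms in auto)

lemma integrable_lborel_vec:
  fixes f :: "real^'n::finite \<Rightarrow> 'b::{banach, second_countable_topology}"
  assumes "f \<in> borel_measurable borel"
  shows "integrable lborel f \<longleftrightarrow> integrable (PiM UNIV (\<lambda>_. lborel)) (\<lambda>x. f (vec_lambda x))"
  by (subst lborel_vec_eq_distr, rule integrable_distr_eq) (use assms in auto)

lemma 
  fixes f :: "'n::finite \<Rightarrow> real \<Rightarrow> complex"
  assumes f: "\<And>i. integrable lborel (f i)"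
  shows integrable_prod_vec: "integrable lborel (\<lambda>x::real^'n. \<Prod>i\<in>UNIV. f i (x $ i))"
    and integral_prod_vec: "(LINT x|lborel. (\<Prod>i\<in>UNIV. f i ((x::real^'n) $ i))) = (\<Prod>i\<in>UNIV. LINT t|lborel. f i t)"
proof -
  interpret product_sigma_finite "\<lambda>_::'n. lborel :: real measure" by standard
  have [measurable]: "f i \<in> borel_measurable borel" for i using f[of i] by auto
  have m: "(\<lambda>x::real^'n. \<Prod>i\<in>UNIV. f i (x $ i)) \<in> borel_measurable borel" by measurable
  show "integrable lborel (\<lambda>x::real^'n. \<Prod>i\<in>UNIV. f i (x $ i))"
    using product_integrable_prod[of UNIV f] f by (simp add: integrable_lborel_vec[OF m])
  show "(LINT x|lborel. (\<Prod>i\<in>UNIV. f i ((x::real^'n) $ i))) = (\<Prod>i\<in>UNIV. LINT t|lborel. f i t)"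
    using product_integral_prod[of UNIV f] f by (simp add: integral_lborel_vec[OF m])
qed

section \<open>Gaussians with a complex linear term and their Fourier transforms\<close>

lemma std_gauss_fourier:
  "integrable lborel (\<lambda>t. complex_of_real (exp (- t\<^sup>2 / 2)) * exp (\<i> * of_real (q * t)))"
  "(LINT t|lborel. complex_of_real (exp (- t\<^sup>2 / 2)) * exp (\<i> * of_real (q * t))) = of_real (sqrt (2 * pi) * exp (- q\<^sup>2 / 2))"
proof -
  have i: "integrable lborel (\<lambda>t. complex_of_real (std_normal_density t) * exp (\<i> * of_real (q * t)))"
    by (rule Bochner_Integration.integrable_bound[of _ "std_normal_density"]) (auto simp: norm_mult)
  have eq: "complex_of_real (exp (- t\<^sup>2 / 2)) = of_real (sqrt (2*pi)) * of_real (std_normal_density t)" for t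
    by (simp add: std_normal_density_def)
  show "integrable lborel (\<lambda>t. complex_of_real (exp (- t\<^sup>2 / 2)) * exp (\<i> * of_real (q * t)))"
    unfolding eq mult.assoc by (rule integrable_mult_right) (rule i)
  \<comment> \<open>The characteristic function of the standard normal distribution is the source of
    all Gaussian integrals here.\<close>
  have c1: "char std_normal_distribution q = of_real (exp (-(q^2)/2))"
    using char_std_normal_distribution by metis
  have c2: "char std_normal_distribution q = (LINT t|lborel. complex_of_real (std_normal_density t) * exp (\<i> * of_real (q * t)))"
    unfolding char_def by (subst integral_density) (auto simp: scaleR_conv_of_real)
  have "(LINT t|lborel. complex_of_real (exp (- t\<^sup>2 / 2)) * exp (\<i> * of_real (q * t)))
      = (LINT t|lborel. of_real (sqrt (2*pi)) * (of_real (std_normal_density t) * exp (\<i> * of_real (q * t))))"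
    by (intro Bochner_Integration.integral_cong refl) (simp only: eq mult.assoc)
  also have "\<dots> = of_real (sqrt (2*pi)) * char std_normal_distribution q"
    by (simp add: c2)
  finally show "(LINT t|lborel. complex_of_real (exp (- t\<^sup>2 / 2)) * exp (\<i> * of_real (q * t))) = of_real (sqrt (2 * pi) * exp (- q\<^sup>2 / 2))"
    by (simp only: c1 of_real_mult)
qed

text \<open>A complex linear coefficient \<open>z\<close> makes one family that is closed, up to
  constant factors, under products, multiplication by characters and the Fourier transform. For real
  \<open>z\<close> its members are multiples of translated Gaussians, so the family also provides
  every centre.\<close>

definition gauss1 :: "real \<Rightarrow> complex \<Rightarrow> real \<Rightarrow> complex" where
  "gauss1 c z t = exp (- of_real (c * t\<^sup>2) + z * of_real t)"

text \<open>Only the real part of \<open>z\<close> is completed to a square, by the shift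
  \<open>m\<close> and the scale \<open>s\<close>. The imaginary part stays as the frequency
  \<open>q\<close> of a character, so no contour has to be moved in the complex plane.\<close>

lemma
  assumes c: "c > 0"
  shows integrable_gauss1: "integrable lborel (gauss1 c z)"
    and integral_gauss1: "(LINT t|lborel. gauss1 c z t) = of_real (sqrt (pi / c)) * exp (z\<^sup>2 / (4 * of_real c))"
proof -
  define s where "s = 1 / sqrt (2 * c)"
  define q where "q = Im z * s"
  have s: "s > 0" "s \<noteq> 0" "s\<^sup>2 = 1 / (2*c)" using c by (auto simp: s_def power_divide)
  define m where "m = Re z / (2*c)"
  define K where "K = exp (of_real ((Re z)\<^sup>2 / (4*c)) + \<i> * of_real (Im z * m))"
  have eq: "gauss1 c z (m + s * t) = K * (complex_of_real (exp (- t\<^sup>2 / 2)) * exp (\<i> * of_real (q * t)))" for t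
  proof -
    have "- of_real (c * (m + s*t)\<^sup>2) + z * of_real (m + s*t) 
        = (of_real ((Re z)\<^sup>2 / (4*c)) + \<i> * of_real (Im z * m)) + (of_real (- t\<^sup>2/2) + \<i> * of_real (q * t))"
    proof (rule complex_eqI)
      have "- (c * (m + s * t)\<^sup>2) + Re z * (m + s * t) = - c * m\<^sup>2 - c * s\<^sup>2 * t\<^sup>2 - 2 * c * m * s * t + Re z * m + Re z * s * t"
        by (simp add: power2_eq_square algebra_simps)
      also have "\<dots> = (Re z)\<^sup>2 / (4*c) - t\<^sup>2/2"
        using c unfolding s by (simp add: m_def power2_eq_square field_simps)
      finally show "Re (- of_real (c * (m + s*t)\<^sup>2) + z * of_real (m + s*t)) = Re ((of_real ((Re z)\<^sup>2 / (4*c)) + \<i> * of_real (Im z * m)) + (of_real (- t\<^sup>2/2) + \<i> * of_real (q * t)))"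
        by simp
    qed (simp add: q_def algebra_simps)
    thus ?thesis by (simp only: gauss1_def K_def exp_add exp_of_real mult.assoc)
  qed
  have [measurable]: "gauss1 c z \<in> borel_measurable borel" unfolding gauss1_def by measurable
  note A = lborel_integrable_real_affine_iff[OF s(2), where t=m and f="gauss1 c z"]
  show int: "integrable lborel (gauss1 c z)"
    using A unfolding eq using integrable_mult_right[OF std_gauss_fourier(1)] by blast
  have "(LINT t|lborel. gauss1 c z t) = \<bar>s\<bar> *\<^sub>R (LINT t|lborel. gauss1 c z (m + s * t))"
    by (rule lborel_integral_real_affine[OF s(2)])
  also have "\<dots> = of_real s * (K * of_real (sqrt (2 * pi) * exp (- q\<^sup>2 / 2)))"
    unfolding eq using s by (subst Bochner_Integration.integral_mult_right[OF std_gauss_fourier(1)]) (simp only: std_gauss_fourier(2), simp add: scaleR_conv_of_real)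
  also have "\<dots> = of_real (s * sqrt (2*pi)) * (K * exp (of_real (- q\<^sup>2/2)))"
    by (simp only: exp_of_real of_real_mult mult_ac)
  also have "s * sqrt (2*pi) = sqrt (pi / c)" using c by (simp add: s_def real_sqrt_divide real_sqrt_mult)
  also have "K * exp (of_real (- q\<^sup>2/2)) = exp (z\<^sup>2 / (4 * of_real c))"
  proof -
    have "of_real ((Re z)\<^sup>2 / (4*c)) + \<i> * of_real (Im z * m) + of_real (- q\<^sup>2/2) = z\<^sup>2 / of_real (4 * c)"
    proof (rule complex_eqI)
      have "q\<^sup>2/2 = (Im z)\<^sup>2 / (4*c)" by (simp add: q_def power_mult_distrib s)
      thus "Re (of_real ((Re z)\<^sup>2 / (4*c)) + \<i> * of_real (Im z * m) + of_real (- q\<^sup>2/2)) = Re (z\<^sup>2 / of_real (4 * c))"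
        by (simp only: Re_divide_of_real) (simp add: power2_eq_square diff_divide_distrib)
      show "Im (of_real ((Re z)\<^sup>2 / (4*c)) + \<i> * of_real (Im z * m) + of_real (- q\<^sup>2/2)) = Im (z\<^sup>2 / of_real (4 * c))"
        using c by (simp only: Im_divide_of_real) (simp add: power2_eq_square m_def field_simps)
    qed
    thus ?thesis by (simp add: K_def flip: exp_add)
  qed
  finally show "(LINT t|lborel. gauss1 c z t) = of_real (sqrt (pi / c)) * exp (z\<^sup>2 / (4 * of_real c))" .
qed

definition gauss :: "real \<Rightarrow> complex ^ 'n \<Rightarrow> real ^ 'n::finite \<Rightarrow> complex" where
  "gauss c z x = (\<Prod>i\<in>UNIV. gauss1 c (z $ i) (x $ i))"

lemma gauss_measurable [measurable]: "gauss c z \<in> borel_measurable borel"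
  unfolding gauss_def gauss1_def by measurable

lemma
  assumes "c > 0"
  shows integrable_gauss: "integrable lborel (gauss c z)"
    and integral_gauss: "(LINT x|lborel. gauss c z x) = (\<Prod>i\<in>UNIV. of_real (sqrt (pi / c)) * exp ((z $ i)\<^sup>2 / (4 * of_real c)))"
  unfolding gauss_def
  using integrable_prod_vec[of "\<lambda>i. gauss1 c (z $ i)"] integral_prod_vec[of "\<lambda>i. gauss1 c (z $ i)"]
    integrable_gauss1[OF assms] integral_gauss1[OF assms] by auto

lemma exp_inner_prod:
  "exp (w * of_real (x \<bullet> y)) = (\<Prod>i\<in>UNIV. exp (w * of_real ((x::real^'n::finite) $ i * y $ i)))"
  by (simp add: inner_vec_def sum_distrib_left exp_sum)

lemma gauss_times_exp: "gauss c z x * exp (w * of_real (x \<bullet> y)) = gauss c (\<chi> i. z $ i + w * of_real (y $ i)) x"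
  unfolding gauss_def exp_inner_prod prod.distrib[symmetric]
  by (intro prod.cong refl) (simp add: gauss1_def exp_add[symmetric] algebra_simps)

lemma fourier_gauss:
  fixes z :: "complex ^ 'n::finite"
  assumes "c > 0"
  shows "fourier (gauss c z) x = (\<Prod>i\<in>UNIV. of_real (sqrt (pi / c)) * exp ((z $ i)\<^sup>2 / (4 * of_real c)))
     * gauss (pi\<^sup>2 / c) (\<chi> i. - of_real (pi / c) * \<i> * z $ i) x"
proof -
  have "fourier (gauss c z) x = (LINT \<xi>|lborel. gauss c (\<chi> i. z $ i + (- 2 * pi * \<i>) * of_real (x $ i)) \<xi>)"
    unfolding fourier_def by (intro Bochner_Integration.integral_cong refl) (simp only: gauss_times_exp inner_commute[of x])
  also have "\<dots> = (\<Prod>i\<in>UNIV. of_real (sqrt (pi / c)) * exp ((z $ i + (- 2 * pi * \<i>) * of_real (x $ i))\<^sup>2 / (4 * of_real c)))"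
    by (subst integral_gauss[OF assms]) simp
  also have "\<dots> = (\<Prod>i\<in>UNIV. of_real (sqrt (pi / c)) * exp ((z $ i)\<^sup>2 / (4 * of_real c)) * 
      gauss1 (pi\<^sup>2 / c) ((\<chi> i. - of_real (pi / c) * \<i> * z $ i) $ i) (x $ i))"
  proof (intro prod.cong refl)
    fix i
    have "(z $ i + (- 2 * pi * \<i>) * of_real (x $ i))\<^sup>2 / (4 * of_real c) = (z $ i)\<^sup>2 / (4 * of_real c) + (- of_real (pi\<^sup>2 / c * (x $ i)\<^sup>2) + (- of_real (pi / c) * \<i> * z $ i) * of_real (x $ i))"
      using assms by (simp add: power2_eq_square field_simps)
    thus "complex_of_real (sqrt (pi / c)) * exp ((z $ i + (- 2 * pi * \<i>) * of_real (x $ i))\<^sup>2 / (4 * of_real c)) = of_real (sqrt (pi / c)) * exp ((z $ i)\<^sup>2 / (4 * of_real c)) * 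
      gauss1 (pi\<^sup>2 / c) ((\<chi> i. - of_real (pi / c) * \<i> * z $ i) $ i) (x $ i)"
      by (simp add: gauss1_def exp_add[symmetric] mult.assoc)
  qed
  finally show ?thesis by (simp add: gauss_def prod.distrib)
qed

text \<open>Two explicit Gaussian transforms in succession: the parameters return to
  \<open>c\<close> and \<open>z\<close>, and the prefactors \<open>sqrt (pi / c)\<close> and
  \<open>sqrt (c / pi)\<close> cancel. Inversion for other functions is reduced to this by
  duality.\<close>

lemma inverse_fourier_gauss:
  fixes z :: "complex ^ 'n::finite"
  assumes "c > 0"
  shows "(LINT x|lborel. fourier (gauss c z) x * exp (2 * pi * \<i> * of_real (x \<bullet> \<eta>))) = gauss c z \<eta>"
proof -
  let ?K = "(\<Prod>i\<in>UNIV. of_real (sqrt (pi / c)) * exp ((z $ i)\<^sup>2 / (4 * of_real c)))"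
  let ?z = "(\<chi> i. - of_real (pi / c) * \<i> * z $ i) :: complex^'n"
  have c': "pi\<^sup>2 / c > 0" using assms by simp
  have "(LINT x|lborel. fourier (gauss c z) x * exp (2 * pi * \<i> * of_real (x \<bullet> \<eta>))) = 
     (LINT x|lborel. ?K * gauss (pi\<^sup>2 / c) (\<chi> i. ?z $ i + (2 * pi * \<i>) * of_real (\<eta> $ i)) x)"
    by (intro Bochner_Integration.integral_cong refl) (simp only: fourier_gauss[OF assms] mult.assoc[of ?K] gauss_times_exp)
  also have "\<dots> = ?K * (\<Prod>i\<in>UNIV. of_real (sqrt (pi / (pi\<^sup>2 / c))) * exp ((?z $ i + (2 * pi * \<i>) * of_real (\<eta> $ i))\<^sup>2 / (4 * of_real (pi\<^sup>2 / c))))"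
    by (subst Bochner_Integration.integral_mult_right[OF integrable_gauss[OF c']], subst integral_gauss[OF c']) simp
  also have "\<dots> = gauss c z \<eta>"
    unfolding gauss_def prod.distrib[symmetric]
  proof (intro prod.cong refl)
    fix i
    have s: "complex_of_real (sqrt (pi/c)) * of_real (sqrt (pi / (pi\<^sup>2/c))) = 1"
      using assms by (simp add: power2_eq_square flip: of_real_mult real_sqrt_mult)
    have e: "(z $ i)\<^sup>2 / (4 * of_real c) + (?z $ i + (2 * pi * \<i>) * of_real (\<eta> $ i))\<^sup>2 / (4 * of_real (pi\<^sup>2 / c)) = - of_real (c * (\<eta> $ i)\<^sup>2) + z $ i * of_real (\<eta> $ i)"
      using assms by (simp add: power2_eq_square field_simps)
    have "complex_of_real (sqrt (pi / c)) * exp ((z $ i)\<^sup>2 / (4 * of_real c)) *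
         (of_real (sqrt (pi / (pi\<^sup>2 / c))) * exp ((?z $ i + (2 * pi * \<i>) * of_real (\<eta> $ i))\<^sup>2 / (4 * of_real (pi\<^sup>2 / c))))
        = (complex_of_real (sqrt (pi/c)) * of_real (sqrt (pi / (pi\<^sup>2/c)))) * exp ((z $ i)\<^sup>2 / (4 * of_real c) + (?z $ i + (2 * pi * \<i>) * of_real (\<eta> $ i))\<^sup>2 / (4 * of_real (pi\<^sup>2 / c)))"
      by (simp only: exp_add mult_ac)
    also have "\<dots> = gauss1 c (z $ i) (\<eta> $ i)" unfolding s e gauss1_def by simp
    finally show "complex_of_real (sqrt (pi / c)) * exp ((z $ i)\<^sup>2 / (4 * of_real c)) *
         (of_real (sqrt (pi / (pi\<^sup>2 / c))) * exp ((?z $ i + (2 * pi * \<i>) * of_real (\<eta> $ i))\<^sup>2 / (4 * of_real (pi\<^sup>2 / c)))) = gauss1 c (z $ i) (\<eta> $ i)" .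
  qed
  finally show ?thesis .
qed

subsection \<open>Gaussians are Schwartz functions\<close>

lemma power_le_exp: "(t::real) \<ge> 0 \<Longrightarrow> t ^ n \<le> real n ^ n * exp t"
proof (cases "n = 0")
  case False
  assume t: "t \<ge> 0"
  have "t / n \<le> exp (t / n)" using exp_ge_add_one_self[of "t/n"] by linarith
  hence "(t / n) ^ n \<le> exp (t / n) ^ n" using t by (intro power_mono) auto
  also have "\<dots> = exp t" using False by (simp add: exp_of_nat_mult[symmetric])
  finally show ?thesis using False by (simp add: power_divide field_simps)
qed auto

lemma linear_minus_square_le:
  assumes "(c::real) > 0"
  shows "b * t - c * t\<^sup>2 \<le> b\<^sup>2 / (4 * c)"
proof -
  have "0 \<le> (2 * c * t - b)\<^sup>2" by simp
  thus ?thesis using assms by (simp add: field_simps power2_eq_square)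
qed

lemma norm_gauss1: "cmod (gauss1 c z t) = exp (Re z * t - c * t\<^sup>2)"
  by (simp add: gauss1_def algebra_simps)

text \<open>Derivatives and coordinate monomials lead out of the family \<open>gauss1\<close>, but
  not out of its polynomial multiples. In several variables one polynomial per coordinate is enough,
  because partial derivatives and monomial weights act on single factors; all Schwartz bounds thus
  reduce to one variable.\<close>

definition poly_gauss1 :: "real \<Rightarrow> complex \<Rightarrow> complex poly \<Rightarrow> real \<Rightarrow> complex" where
  "poly_gauss1 c z p t = poly p (of_real t) * gauss1 c z t"

lemma poly_gauss1_bounded:
  assumes c: "c > 0"
  shows "\<exists>B\<ge>0. \<forall>t. cmod (poly_gauss1 c z p t) \<le> B"
proof -
  \<comment> \<open>The extra 1 pays for the factor \<open>exp \<bar>t\<bar>\<close> that dominates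
    the powers of \<open>t\<close>.\<close>
  define b where "b = 1 + \<bar>Re z\<bar>"
  define B where "B = (\<Sum>k\<le>degree p. cmod (coeff p k) * (real k ^ k * exp (b\<^sup>2 / (4 * c))))"
  have "cmod (poly_gauss1 c z p t) \<le> B" for t
  proof -
    have mono: "\<bar>t\<bar> ^ k * exp (Re z * t - c * t\<^sup>2) \<le> real k ^ k * exp (b\<^sup>2 / (4 * c))" for k
    proof -
      have "\<bar>t\<bar> ^ k * exp (Re z * t - c * t\<^sup>2) \<le> (real k ^ k * exp \<bar>t\<bar>) * exp (Re z * t - c * t\<^sup>2)"
        by (intro mult_right_mono power_le_exp) auto
      also have "\<dots> = real k ^ k * exp (\<bar>t\<bar> + (Re z * t - c * t\<^sup>2))" by (simp add: exp_add[symmetric])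
      also have "\<dots> \<le> real k ^ k * exp (b\<^sup>2 / (4 * c))"
      proof (intro mult_left_mono)
        have "\<bar>t\<bar> + (Re z * t - c * t\<^sup>2) \<le> b * \<bar>t\<bar> - c * \<bar>t\<bar>\<^sup>2"
          using abs_ge_self[of "Re z * t"] by (simp add: b_def algebra_simps abs_mult)
        also have "\<dots> \<le> b\<^sup>2 / (4*c)" by (rule linear_minus_square_le[OF c])
        finally show "exp (\<bar>t\<bar> + (Re z * t - c * t\<^sup>2)) \<le> exp (b\<^sup>2 / (4*c))" by simp
      qed auto
      finally show ?thesis .
    qed
    have "cmod (poly p (of_real t)) \<le> (\<Sum>k\<le>degree p. cmod (coeff p k) * \<bar>t\<bar> ^ k)"
      unfolding poly_altdef by (rule order.trans[OF norm_sum]) (simp add: norm_mult norm_power)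
    hence "cmod (poly_gauss1 c z p t) \<le> (\<Sum>k\<le>degree p. cmod (coeff p k) * \<bar>t\<bar> ^ k) * exp (Re z * t - c * t\<^sup>2)"
      by (simp add: poly_gauss1_def norm_mult norm_gauss1)
    also have "\<dots> = (\<Sum>k\<le>degree p. cmod (coeff p k) * (\<bar>t\<bar> ^ k * exp (Re z * t - c * t\<^sup>2)))"
      by (simp add: sum_distrib_right mult.assoc)
    also have "\<dots> \<le> B" unfolding B_def by (intro sum_mono mult_left_mono mono) auto
    finally show ?thesis .
  qed
  moreover have "B \<ge> 0" unfolding B_def by (intro sum_nonneg) auto
  ultimately show ?thesis by blast
qed

definition poly_gauss_deriv :: "real \<Rightarrow> complex \<Rightarrow> complex poly \<Rightarrow> complex poly" where
  "poly_gauss_deriv c z p = pderiv p + [:z, - 2 * of_real c:] * p"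

lemma poly_gauss1_deriv: "(poly_gauss1 c z p has_vector_derivative poly_gauss1 c z (poly_gauss_deriv c z p) t) (at t within S)"
proof -
  have "((\<lambda>w. poly p w * exp (- of_real c * w\<^sup>2 + z * w)) has_field_derivative
     (poly (poly_gauss_deriv c z p) (of_real t) * exp (- of_real c * (of_real t)\<^sup>2 + z * of_real t))) (at (of_real t))"
    by (rule derivative_eq_intros poly_DERIV refl | simp)+ (simp add: poly_gauss_deriv_def algebra_simps)
  from has_vector_derivative_real_field[OF this, of S] show ?thesis
    by (simp add: poly_gauss1_def[abs_def] gauss1_def)
qed

definition poly_gauss :: "real \<Rightarrow> complex ^ 'n \<Rightarrow> ('n \<Rightarrow> complex poly) \<Rightarrow> real ^ 'n::finite \<Rightarrow> complex" where
  "poly_gauss c z p x = (\<Prod>i\<in>UNIV. poly_gauss1 c (z $ i) (p i) (x $ i))"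

lemma has_vector_derivative_poly_gauss:
  "((\<lambda>t. poly_gauss c z p (x + t *\<^sub>R axis i 1)) has_vector_derivative poly_gauss c z (p(i := poly_gauss_deriv c (z $ i) (p i))) x) (at 0)"
proof -
  let ?R = "\<Prod>j\<in>UNIV - {i}. poly_gauss1 c (z $ j) (p j) (x $ j)"
  have split: "(\<Prod>j\<in>UNIV. f j) = f i * (\<Prod>j\<in>UNIV - {i}. f j)" for f :: "'a \<Rightarrow> complex"
    by (rule prod.remove) auto
  have eq: "poly_gauss c z p (x + t *\<^sub>R axis i 1) = poly_gauss1 c (z $ i) (p i) (x $ i + t) * ?R" for t
    unfolding poly_gauss_def by (subst split) (intro arg_cong2[where f="(*)"] prod.cong, auto simp: axis_def)
  have eq': "poly_gauss c z (p(i := poly_gauss_deriv c (z $ i) (p i))) x = poly_gauss1 c (z $ i) (poly_gauss_deriv c (z $ i) (p i)) (x $ i) * ?R"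
    unfolding poly_gauss_def by (subst split) simp
  have "((\<lambda>t. poly_gauss1 c (z $ i) (p i) (x $ i + t)) has_vector_derivative poly_gauss1 c (z $ i) (poly_gauss_deriv c (z $ i) (p i)) (x $ i)) (at 0)"
  proof -
    have "((\<lambda>t. x $ i + t) has_vector_derivative 1) (at 0)"
      by (auto intro!: derivative_eq_intros)
    from vector_diff_chain_at[OF this, of "poly_gauss1 c (z $ i) (p i)"] poly_gauss1_deriv[of c "z $ i" "p i" "x $ i + 0" UNIV]
    show ?thesis by (simp add: o_def)
  qed
  from has_vector_derivative_mult_left[OF this, of ?R] show ?thesis unfolding eq eq' .
qed

lemma partial_deriv_poly_gauss: "partial_deriv i (poly_gauss c z p) = poly_gauss c z (p(i := poly_gauss_deriv c (z $ i) (p i)))"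
  unfolding partial_deriv_def by (intro ext vector_derivative_at has_vector_derivative_poly_gauss)

lemma continuous_on_poly_gauss: "continuous_on S (poly_gauss c z p)"
  unfolding poly_gauss_def[abs_def] poly_gauss1_def gauss1_def by (intro continuous_intros)

lemma Ck_on_poly_gauss: "Ck_on k UNIV (poly_gauss c z p)"
proof (induction k arbitrary: p)
  case (Suc k)
  show ?case using Suc has_vector_derivative_poly_gauss continuous_on_poly_gauss by fastforce
qed (simp add: continuous_on_poly_gauss)

lemma mi_deriv_poly_gauss: "\<exists>q. mi_deriv \<beta> (poly_gauss c z p) = poly_gauss c z q"
proof -
  have pw: "\<exists>q. (partial_deriv i ^^ n) (poly_gauss c z p) = poly_gauss c z q" for i n p
    by (induction n) (auto simp: partial_deriv_poly_gauss)
  have "\<exists>q. foldr (\<lambda>i. partial_deriv i ^^ (\<beta> $ i)) xs (poly_gauss c z p) = poly_gauss c z q" for xs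
  proof (induction xs)
    case (Cons i xs)
    then obtain q where "foldr (\<lambda>i. partial_deriv i ^^ (\<beta> $ i)) xs (poly_gauss c z p) = poly_gauss c z q" by blast
    thus ?case using pw[where i=i and n="\<beta> $ i" and p=q] by simp
  qed auto
  thus ?thesis by (simp add: mi_deriv_def)
qed

lemma schwartz_poly_gauss:
  assumes c: "c > 0"
  shows "schwartz (poly_gauss c (z :: complex ^ 'n::finite) p)"
  unfolding schwartz_def
proof (intro conjI allI)
  fix \<alpha> \<beta> :: "nat ^ 'n"
  obtain q where q: "mi_deriv \<beta> (poly_gauss c z p) = poly_gauss c z q" using mi_deriv_poly_gauss by blast
  have "\<forall>i. \<exists>B\<ge>0. \<forall>t. cmod (poly_gauss1 c (z $ i) (monom 1 (\<alpha> $ i) * q i) t) \<le> B"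
    using poly_gauss1_bounded[OF c] by blast
  then obtain B where B: "\<And>i. B i \<ge> 0" "\<And>i t. cmod (poly_gauss1 c (z $ i) (monom 1 (\<alpha> $ i) * q i) t) \<le> B i"
    by metis
  have "schwartz_weighted \<alpha> \<beta> (poly_gauss c z p) x \<le> (\<Prod>i\<in>UNIV. B i)" for x
  proof -
    have "schwartz_weighted \<alpha> \<beta> (poly_gauss c z p) x = (\<Prod>i\<in>UNIV. cmod (poly_gauss1 c (z $ i) (monom 1 (\<alpha> $ i) * q i) (x $ i)))"
      unfolding schwartz_weighted_def q poly_gauss_def prod_norm[symmetric] abs_prod prod.distrib[symmetric]
      by (intro prod.cong refl) (simp add: poly_gauss1_def norm_mult poly_monom norm_power power_abs mult.assoc)
    also have "\<dots> \<le> (\<Prod>i\<in>UNIV. B i)" by (intro prod_mono conjI B norm_ge_zero)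
    finally show ?thesis .
  qed
  thus "bdd_above (range (schwartz_weighted \<alpha> \<beta> (poly_gauss c z p)))" by (rule bdd_aboveI2)
qed (rule Ck_on_poly_gauss)

lemma schwartz_gauss:
  fixes z :: "complex ^ 'n::finite"
  assumes "c > 0"
  shows "schwartz (\<lambda>x. K * gauss c z x)"
proof -
  \<comment> \<open>An arbitrary coordinate, whose polynomial absorbs the constant
    \<open>K\<close>.\<close>
  fix i :: 'n
  have "K * gauss c z x = poly_gauss c z (\<lambda>j. if j = i then [:K:] else 1) x" for x
  proof -
    have "(\<Prod>j\<in>UNIV. if j = i then K else 1) = K" by (subst prod.delta) auto
    moreover have "poly_gauss c z (\<lambda>j. if j = i then [:K:] else 1) x = (\<Prod>j\<in>UNIV. (if j = i then K else 1) * gauss1 c (z $ j) (x $ j))"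
      unfolding poly_gauss_def by (intro prod.cong) (auto simp: poly_gauss1_def)
    ultimately show ?thesis by (simp add: gauss_def prod.distrib)
  qed
  hence "(\<lambda>x. K * gauss c z x) = poly_gauss c z (\<lambda>j. if j = i then [:K:] else 1)" by (rule ext)
  thus ?thesis using schwartz_poly_gauss[OF assms] by metis
qed

text \<open>The power of the norm is at most the product of the
  \<open>exp (m \<bar>x_i\<bar>)\<close>, and half of the Gaussian absorbs it:
  \<open>m t - (c/2) t^2\<close> has maximum \<open>m^2 / (2 c)\<close>. This provides the moments
  needed for differentiating transforms of Gaussians under the integral.\<close>

lemma norm_power_times_gauss:
  fixes z :: "complex ^ 'n::finite"
  assumes c: "c > 0"
  shows "norm x ^ m * cmod (gauss c z x) \<le> (\<Prod>i\<in>(UNIV::'n set). exp (real m ^ 2 / (2 * c))) * cmod (gauss (c / 2) z x)"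
proof -
  have "norm x \<le> (\<Sum>i\<in>UNIV. \<bar>x $ i\<bar>)" by (rule norm_le_l1_cart)
  also have "\<dots> \<le> exp (\<Sum>i\<in>UNIV. \<bar>x $ i\<bar>)" using exp_ge_add_one_self[of "\<Sum>i\<in>UNIV. \<bar>x $ i\<bar>"] by linarith
  also have "\<dots> = (\<Prod>i\<in>UNIV. exp \<bar>x $ i\<bar>)" by (rule exp_sum) simp
  finally have "norm x ^ m \<le> (\<Prod>i\<in>UNIV. exp \<bar>x $ i\<bar>) ^ m" by (rule power_mono) simp
  also have "\<dots> = (\<Prod>i\<in>UNIV. exp (real m * \<bar>x $ i\<bar>))" by (simp add: prod_power_distrib exp_of_nat_mult)
  finally have "norm x ^ m * cmod (gauss c z x) \<le> (\<Prod>i\<in>UNIV. exp (real m * \<bar>x $ i\<bar>)) * cmod (gauss c z x)"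
    by (rule mult_right_mono) simp
  also have "\<dots> = (\<Prod>i\<in>UNIV. exp (real m * \<bar>x $ i\<bar>) * cmod (gauss1 c (z $ i) (x $ i)))"
    by (simp add: gauss_def prod.distrib prod_norm)
  also have "\<dots> \<le> (\<Prod>i\<in>UNIV. exp (real m ^ 2 / (2 * c)) * cmod (gauss1 (c/2) (z $ i) (x $ i)))"
  proof (intro prod_mono conjI)
    fix i
    have "real m * \<bar>x $ i\<bar> - c/2 * \<bar>x $ i\<bar>\<^sup>2 \<le> (real m)\<^sup>2 / (4 * (c/2))"
      by (rule linear_minus_square_le) (use c in simp)
    thus "exp (real m * \<bar>x $ i\<bar>) * cmod (gauss1 c (z $ i) (x $ i)) \<le> exp (real m ^ 2 / (2 * c)) * cmod (gauss1 (c/2) (z $ i) (x $ i))"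
      by (simp add: norm_gauss1 exp_add[symmetric] field_simps)
  qed auto
  also have "\<dots> = (\<Prod>i\<in>(UNIV::'n set). exp (real m ^ 2 / (2 * c))) * cmod (gauss (c / 2) z x)"
    by (simp only: gauss_def prod.distrib prod_norm)
  finally show ?thesis .
qed

lemma integrable_norm_power_gauss:
  assumes c: "c > 0"
  shows "integrable lborel (\<lambda>x. gauss c z x * of_real (norm x ^ m))"
proof (rule Bochner_Integration.integrable_bound)
  show "integrable lborel (\<lambda>x. (\<Prod>i\<in>(UNIV::'a set). exp (real m ^ 2 / (2 * c))) * cmod (gauss (c / 2) z x))"
    using integrable_gauss[of "c/2" z] c by (intro integrable_mult_right) auto
  show "AE x in lborel. norm (gauss c z x * of_real (norm x ^ m)) \<le> norm ((\<Prod>i\<in>(UNIV::'a set). exp (real m ^ 2 / (2 * c))) * cmod (gauss (c / 2) z x))"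
  proof (intro always_eventually allI)
    fix x 
    show "norm (gauss c z x * of_real (norm x ^ m)) \<le> norm ((\<Prod>i\<in>(UNIV::'a set). exp (real m ^ 2 / (2 * c))) * cmod (gauss (c / 2) z x))"
      using norm_power_times_gauss[OF c, of x m z]
      by (simp add: norm_mult norm_power mult.commute abs_mult abs_prod)
  qed
qed simp

lemma gauss_bounded:
  assumes c: "c > 0"
  shows "\<exists>B. \<forall>x. cmod (gauss c z x) \<le> B"
proof -
  have "\<forall>i. \<exists>B\<ge>0. \<forall>t. cmod (poly_gauss1 c (z $ i) 1 t) \<le> B" using poly_gauss1_bounded[OF c] by blast
  then obtain B where B: "\<And>i. B i \<ge> 0" "\<And>i t. cmod (gauss1 c (z $ i) t) \<le> B i"
    by (simp add: poly_gauss1_def) metis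
  have "cmod (gauss c z x) \<le> (\<Prod>i\<in>UNIV. B i)" for x
    unfolding gauss_def prod_norm[symmetric] by (intro prod_mono conjI B norm_ge_zero)
  thus ?thesis by blast
qed

subsection \<open>Functions orthogonal to all Gaussians\<close>

text \<open>The exchanges of two integrals below all rest on a majorant that is a product of one
  integrable function of each variable.\<close>

lemma (in pair_sigma_finite) integrable_pair_bound:
  fixes f :: "'a \<times> 'b \<Rightarrow> 'c::{banach, second_countable_topology}" and F :: "'a \<Rightarrow> real" and G :: "'b \<Rightarrow> real"
  assumes [measurable]: "f \<in> borel_measurable (M1 \<Otimes>\<^sub>M M2)"
    and F: "integrable M1 F" and G: "integrable M2 G"
    and le: "\<And>x y. x \<in> space M1 \<Longrightarrow> y \<in> space M2 \<Longrightarrow> norm (f (x, y)) \<le> F x * G y"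
  shows "integrable (M1 \<Otimes>\<^sub>M M2) f"
proof (rule Fubini_integrable)
  have i2: "integrable M2 (\<lambda>y. f (x, y))" if "x \<in> space M1" for x
  proof (rule Bochner_Integration.integrable_bound)
    show "integrable M2 (\<lambda>y. F x * G y)" using G by simp
    show "AE y in M2. norm (f (x, y)) \<le> norm (F x * G y)"
      using le[OF that] by (intro AE_I2) (force intro: order.trans[OF _ abs_ge_self])
  qed (use that in measurable)
  thus "AE x in M1. integrable M2 (\<lambda>y. f (x, y))" by (intro AE_I2)
  show "integrable M1 (\<lambda>x. \<integral>y. norm (f (x, y)) \<partial>M2)"
  proof (rule Bochner_Integration.integrable_bound)
    show "integrable M1 (\<lambda>x. F x * (\<integral>y. G y \<partial>M2))" using F by simp
    show "AE x in M1. norm (\<integral>y. norm (f (x, y)) \<partial>M2) \<le> norm (F x * (\<integral>y. G y \<partial>M2))"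
    proof (intro AE_I2)
      fix x assume x: "x \<in> space M1"
      have "(\<integral>y. norm (f (x, y)) \<partial>M2) \<le> (\<integral>y. F x * G y \<partial>M2)"
        using i2[OF x] G by (intro integral_mono) (auto intro: le x)
      also have "\<dots> = F x * (\<integral>y. G y \<partial>M2)" by simp
      finally have "(\<integral>y. norm (f (x, y)) \<partial>M2) \<le> F x * (\<integral>y. G y \<partial>M2)" .
      thus "norm (\<integral>y. norm (f (x, y)) \<partial>M2) \<le> norm (F x * (\<integral>y. G y \<partial>M2))"
        by (simp add: integral_nonneg_AE)
    qed
  qed measurable
qed measurable

lemma lborel_integral_affine:
  fixes f :: "'a::euclidean_space \<Rightarrow> 'b::{banach, second_countable_topology}"
  assumes "c \<noteq> 0" "f \<in> borel_measurable borel"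
  shows "(LINT x|lborel. f x) = \<bar>c\<bar> ^ DIM('a) *\<^sub>R (LINT x|lborel. f (t + c *\<^sub>R x))"
  by (subst lborel_affine[OF assms(1), of t], subst integral_density)
     (use assms in \<open>auto simp: integral_distr\<close>)

text \<open>Dynkin's argument, carried out for the integrals of \<open>h\<close> themselves because
  \<open>h\<close> is complex-valued. Boxes are stable under intersection and generate the Borel
  sets; closure under complements uses the integral over the whole space, which the increasing boxes
  show to be 0.\<close>

lemma density_zero_boxes:
  fixes h :: "'a::euclidean_space \<Rightarrow> complex"
  assumes h: "integrable lborel h" and box: "\<And>l u. (LINT x:box l u|lborel. h x) = 0"
  shows "AE x in lborel. h x = 0"
proof (rule sigma_finite_measure.density_zero[OF lborel.sigma_finite_measure_axioms h])
  have si: "set_integrable lborel A h" if "A \<in> sets borel" for A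
    using set_integrable_subset[of lborel UNIV h A] h that by (simp add: set_integrable_def)
  have UN: "(LINT x:UNIV|lborel. h x) = 0"
  proof -
    have "(\<lambda>n. LINT x:box (- real n *\<^sub>R One) (real n *\<^sub>R One)|lborel. h x) \<longlonglongrightarrow> (LINT x:(\<Union>n. box (- real n *\<^sub>R One) (real n *\<^sub>R One))|lborel. h x)"
    proof (rule set_integral_cont_up)
      show "incseq (\<lambda>n. box (- real n *\<^sub>R One) (real n *\<^sub>R One :: 'a))"
        unfolding incseq_def by (intro allI impI subset_box_imp) simp
    qed (auto intro!: si)
    thus ?thesis unfolding box using UN_box_eq_UNIV[where 'a='a] by (simp add: LIMSEQ_const_iff scaleR_minus_left)
  qed
  fix A :: "'a set" assume "A \<in> sets lborel"
  hence A: "A \<in> sigma_sets UNIV (range (\<lambda>(a, b). box a b))" by (simp add: borel_eq_box)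
  have Is: "Int_stable (range (\<lambda>(a, b). box a b :: 'a set))"
    by (auto simp: Int_stable_def box_Int_box)
  have Pw: "range (\<lambda>(a, b). box a b :: 'a set) \<subseteq> Pow UNIV" by simp
  have b: "B \<in> sets borel" if "B \<in> sigma_sets UNIV (range (\<lambda>(a, b). box a b :: 'a set))" for B
    using that by (simp add: borel_eq_box)
  show "(LINT x:A|lborel. h x) = 0"
    using Is Pw A
  proof (induction rule: sigma_sets_induct_disjoint)
    case (basic A) thus ?case by (auto simp: box)
  next
    case empty show ?case by (simp add: set_lebesgue_integral_def)
  next
    case (compl A)
    have "(LINT x:A \<union> (UNIV - A)|lborel. h x) = (LINT x:A|lborel. h x) + (LINT x:UNIV - A|lborel. h x)"
      by (intro set_integral_Un si b[OF compl(1)]) (auto intro: b[OF compl(1)])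
    thus ?case using compl UN by simp
  next
    case (union A)
    have bA: "A i \<in> sets borel" for i using union(2) by (intro b) auto
    have "(LINT x:(\<Union>i. A i)|lborel. h x) = (\<Sum>i. (LINT x:(A i)|lborel. h x))"
      by (rule lebesgue_integral_countable_add)
         (use union(1) bA in \<open>auto simp: disjoint_family_on_def intro!: si sets.countable_UN\<close>)
    thus ?case using union(3) by simp
  qed
qed

text \<open>Completing the square: the real linear coefficient \<open>2 c p\<close> moves the centre
  to \<open>p\<close>, at the price of the constant \<open>exp (c |p|^2)\<close>.\<close>

lemma gauss_center:
  "gauss c (\<chi> i. of_real (2 * c * p $ i)) x = of_real (exp (c * (norm p)\<^sup>2) * exp (- c * (norm (x - p))\<^sup>2))" 
  for x p :: "real ^ 'n::finite"
proof -
  have n: "(norm y)\<^sup>2 = (\<Sum>i\<in>UNIV. (y $ i)\<^sup>2)" for y :: "real^'n"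
    by (simp add: norm_vec_def L2_set_def sum_nonneg)
  have "gauss c (\<chi> i. of_real (2 * c * p $ i)) x = (\<Prod>i\<in>UNIV. exp (of_real (- (c * (x $ i)\<^sup>2) + 2 * c * p $ i * x $ i)))"
    by (simp add: gauss_def gauss1_def)
  also have "\<dots> = exp (of_real (\<Sum>i\<in>UNIV. - (c * (x $ i)\<^sup>2) + 2 * c * p $ i * x $ i))"
    by (simp add: exp_sum)
  also have "(\<Sum>i\<in>UNIV. - (c * (x $ i)\<^sup>2) + 2 * c * p $ i * x $ i) = c * (norm p)\<^sup>2 - c * (norm (x - p))\<^sup>2"
    unfolding n sum_distrib_left sum_subtractf[symmetric]
    by (intro sum.cong refl) (simp add: power2_eq_square algebra_simps)
  finally show ?thesis by (simp only: exp_of_real exp_add[symmetric]) simp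
qed

lemma gauss_add: "gauss c z x * gauss d w x = gauss (c + d) (\<chi> i. z $ i + w $ i) x"
  unfolding gauss_def prod.distrib[symmetric]
  by (intro prod.cong refl) (simp add: gauss1_def exp_add[symmetric] algebra_simps)

text \<open>
  Multiplying \<open>g\<close> by a fixed Gaussian makes it integrable and keeps the hypothesis. Averaging the
  vanishing integrals over the centres in a box then tests it against a smoothed indicator of the box.
\<close>

lemma gauss_unique:
  fixes g :: "real ^ 'n::finite \<Rightarrow> complex"
  assumes [measurable]: "g \<in> borel_measurable borel"
    and int: "\<And>c z. c > 0 \<Longrightarrow> integrable lborel (\<lambda>x. g x * gauss c z x)"
    and zero: "\<And>c p. c > 0 \<Longrightarrow> (LINT x|lborel. g x * gauss c (\<chi> i. of_real (p $ i)) x) = 0"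
  shows "AE x in lborel. g x = 0"
proof -
  define h where "h x = g x * gauss 1 0 x" for x
  define E where "E s = exp (- (norm s)\<^sup>2)" for s :: "real^'n"
  have [measurable]: "h \<in> borel_measurable borel" unfolding h_def by measurable
  have [measurable]: "E \<in> borel_measurable borel" unfolding E_def by measurable
  have h: "integrable lborel h" unfolding h_def by (rule int) simp
  have E0: "complex_of_real (E x) = gauss 1 0 x" for x
    proof -
    have "(\<chi> i. complex_of_real (2 * 1 * (0::real^'n) $ i)) = 0" by (simp add: vec_eq_iff)
    thus ?thesis using gauss_center[of 1 0 x] by (simp add: E_def)
  qed
  have E: "integrable lborel E"
    using integrable_Re[OF integrable_gauss[of 1 "0 :: complex^'n"]] by (simp add: E0[symmetric])
  define I where "I = (LINT s|lborel. E s)"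
  have I: "I > 0"
  proof -
    have "I \<noteq> 0"
    proof
      assume "I = 0"
      hence "AE s in lborel. E s = 0" unfolding I_def by (subst (asm) integral_nonneg_eq_0_iff_AE[OF E]) (auto simp: E_def)
      then obtain N where "{s \<in> space lborel. E s \<noteq> 0} \<subseteq> N" and N: "emeasure (lborel :: (real^'n) measure) N = 0"
        by (rule AE_E) auto
      hence "N = UNIV" by (auto simp: E_def)
      thus False using N by simp
    qed
    moreover have "I \<ge> 0" unfolding I_def by (intro integral_nonneg_AE) (simp add: E_def)
    ultimately show ?thesis by simp
  qed
  \<comment> \<open>The weight in \<open>h\<close> is a Gaussian of parameter 1, so testing
    \<open>h\<close> with parameter \<open>c\<close> amounts to testing \<open>g\<close> with
    \<open>c + 1\<close>; the constant from moving the centre is divided out.\<close>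
  have hE: "(LINT x|lborel. h x * of_real (exp (- c * (norm (x - p))\<^sup>2))) = 0" if "c > 0" for c p
  proof -
    have "h x * of_real (exp (- c * (norm (x - p))\<^sup>2)) = (g x * gauss (c+1) (\<chi> i. of_real ((\<chi> i. 2 * c * p $ i) $ i)) x) * of_real (exp (- (c * (norm p)\<^sup>2)))" for x
    proof -
      have "gauss (c+1) (\<chi> i. of_real ((\<chi> i. 2 * c * p $ i) $ i)) x = gauss 1 0 x * gauss c (\<chi> i. of_real (2 * c * p $ i)) x"
        by (simp add: gauss_add add.commute)
      also have "\<dots> = gauss 1 0 x * of_real (exp (c * (norm p)\<^sup>2) * exp (- c * (norm (x - p))\<^sup>2))"
        by (simp only: gauss_center)
      also have "\<dots> * of_real (exp (- (c * (norm p)\<^sup>2))) = gauss 1 0 x * of_real (exp (- c * (norm (x - p))\<^sup>2))"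
        by (simp add: exp_minus field_simps flip: of_real_mult)
      finally show ?thesis by (simp add: h_def mult.assoc)
    qed
    thus ?thesis using zero[of "c+1" "\<chi> i. 2 * c * p $ i"] that by (simp only:) simp
  qed
  have "AE x in lborel. h x = 0"
  proof (rule density_zero_boxes[OF h])
    fix l u :: "real^'n"
    let ?Q = "indicator (box l u) :: real^'n \<Rightarrow> real"
    \<comment> \<open>The indicator of the box smoothed by \<open>E\<close> at scale
      \<open>1 / (m + 1)\<close>. It is not normalized, so its limit carries the total mass
      \<open>I\<close>.\<close>
    define K where "K m x = (LINT s|lborel. ?Q (x + (1 / real (Suc m)) *\<^sub>R s) * E s)" for m x
    have Kle: "norm (K m x) \<le> I" for m x
    proof -
      have "norm (K m x) \<le> (LINT s|lborel. norm (?Q (x + (1 / real (Suc m)) *\<^sub>R s) * E s))"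
        unfolding K_def by (rule integral_norm_bound)
      also have "\<dots> \<le> I" unfolding I_def
        by (rule integral_mono_AE'[OF E]) (auto simp: E_def indicator_def)
      finally show ?thesis .
    qed
    have [measurable]: "K m \<in> borel_measurable borel" for m
      unfolding K_def by measurable
    have Z: "(LINT x|lborel. h x * of_real (K m x)) = 0" for m
    proof -
      define r where "r = real (Suc m)"
      have r: "r > 0" by (simp add: r_def)
      \<comment> \<open>The substitution \<open>p = x + s / r\<close> turns the smoothing into an
        average, over centres \<open>p\<close> in the box, of Gaussians with parameter
        \<open>r^2\<close>; by \<open>hE\<close> each of them annihilates \<open>h\<close>.\<close>
      have Keq: "K m x = r ^ CARD('n) * (LINT p|lborel. ?Q p * exp (- r\<^sup>2 * (norm (x - p))\<^sup>2))" for x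
      proof -
        have "(LINT p|lborel. ?Q p * exp (- r\<^sup>2 * (norm (x - p))\<^sup>2)) = \<bar>1/r\<bar> ^ DIM(real^'n) *\<^sub>R (LINT s|lborel. ?Q (x + (1/r) *\<^sub>R s) * exp (- r\<^sup>2 * (norm (x - (x + (1/r) *\<^sub>R s)))\<^sup>2))"
          by (rule lborel_integral_affine) (use r in auto)
        also have "(\<lambda>s. exp (- r\<^sup>2 * (norm (x - (x + (1/r) *\<^sub>R s)))\<^sup>2)) = E"
          using r by (auto simp: E_def fun_eq_iff power_divide)
        finally show ?thesis using r unfolding K_def r_def[symmetric] by (simp add: power_divide fun_eq_iff)
      qed
      have inner: "(LINT x|lborel. of_real (r ^ CARD('n)) * (h x * of_real (?Q p * exp (- r\<^sup>2 * (norm (x - p))\<^sup>2)))) = 0" for p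
      proof -
        have "(LINT x|lborel. of_real (r ^ CARD('n)) * (h x * of_real (?Q p * exp (- r\<^sup>2 * (norm (x - p))\<^sup>2)))) = of_real (r ^ CARD('n) * ?Q p) * (LINT x|lborel. h x * of_real (exp (- r\<^sup>2 * (norm (x - p))\<^sup>2)))"
          by (simp add: mult_ac flip: integral_mult_right_zero)
        thus ?thesis using hE[of "r\<^sup>2" p] r by simp
      qed
      have "(LINT x|lborel. h x * of_real (K m x)) = (LINT x|lborel. (LINT p|lborel. of_real (r ^ CARD('n)) * (h x * of_real (?Q p * exp (- r\<^sup>2 * (norm (x - p))\<^sup>2)))))"
        by (simp add: Keq mult_ac flip: integral_complex_of_real)
      also have "\<dots> = (LINT p|lborel. (LINT x|lborel. of_real (r ^ CARD('n)) * (h x * of_real (?Q p * exp (- r\<^sup>2 * (norm (x - p))\<^sup>2)))))"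
      proof (rule lborel_pair.Fubini_integral[symmetric])
        have Qi: "integrable lborel ?Q" using emeasure_lborel_box_finite[of l u] by (simp add: integrable_indicator_iff)
        show "integrable (lborel \<Otimes>\<^sub>M lborel) (\<lambda>(x, p). of_real (r ^ CARD('n)) * (h x * of_real (?Q p * exp (- r\<^sup>2 * (norm (x - p))\<^sup>2))))"
        proof (rule pair_sigma_finite.integrable_pair_bound[OF lborel_pair.pair_sigma_finite_axioms])
          show "integrable lborel (\<lambda>x. r ^ CARD('n) * cmod (h x))" using h by simp
          show "integrable lborel ?Q" by (rule Qi)
          fix x p :: "real^'n"
          show "norm (case (x, p) of (x, p) \<Rightarrow> of_real (r ^ CARD('n)) * (h x * of_real (?Q p * exp (- r\<^sup>2 * (norm (x - p))\<^sup>2)))) \<le> r ^ CARD('n) * cmod (h x) * ?Q p"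
            using r by (auto simp: norm_mult norm_power indicator_def intro!: mult_left_mono mult_left_le)
        qed measurable
      qed
      also have "\<dots> = 0" by (simp only: inner) simp
      finally show ?thesis .
    qed
    \<comment> \<open>Off the frontier, which is a null set, the indicator is continuous, and there
      the smoothed indicators converge.\<close>
    have fr: "AE x in lborel. x \<notin> frontier (box l u)"
      using negligible_convex_frontier[OF convex_box(2), of l u]
      by (intro AE_not_in) (simp add: negligible_iff_null_sets null_sets_completion_iff)
    have "(\<lambda>m. LINT x|lborel. h x * of_real (K m x)) \<longlonglongrightarrow> (LINT x|lborel. h x * of_real (?Q x * I))"
    proof (rule integral_dominated_convergence)
      show "integrable lborel (\<lambda>x. cmod (h x) * I)" using h by simp
      show "AE x in lborel. norm (h x * of_real (K m x)) \<le> cmod (h x) * I" for m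
        using Kle[of m] by (auto simp: norm_mult intro!: mult_left_mono)
      show "AE x in lborel. (\<lambda>m. h x * of_real (K m x)) \<longlonglongrightarrow> h x * of_real (?Q x * I)"
        using fr
      proof eventually_elim
        case (elim x)
        have "(\<lambda>m. K m x) \<longlonglongrightarrow> (LINT s|lborel. ?Q x * E s)"
          unfolding K_def
        proof (rule integral_dominated_convergence[where w=E])
          show "AE s in lborel. (\<lambda>m. ?Q (x + (1 / real (Suc m)) *\<^sub>R s) * E s) \<longlonglongrightarrow> ?Q x * E s"
          proof (intro always_eventually allI tendsto_mult tendsto_const)
            fix s
            have "(\<lambda>m. 1 / real (Suc m)) \<longlonglongrightarrow> 0" by (rule LIMSEQ_Suc[OF lim_1_over_n])
            hence lim: "(\<lambda>m. x + (1 / real (Suc m)) *\<^sub>R s) \<longlonglongrightarrow> x + 0 *\<^sub>R s" by (intro tendsto_intros)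
            have "isCont ?Q x" using elim by (simp add: isCont_indicator)
            from isCont_tendsto_compose[OF this] lim show "(\<lambda>m. ?Q (x + (1 / real (Suc m)) *\<^sub>R s)) \<longlonglongrightarrow> ?Q x" by simp
          qed
        qed (use E in \<open>auto simp: E_def[abs_def] indicator_def\<close>)
        also have "(LINT s|lborel. ?Q x * E s) = ?Q x * I" by (simp add: I_def)
        finally show ?case by (intro tendsto_intros)
      qed
    qed measurable
    hence "(LINT x|lborel. h x * of_real (?Q x * I)) = 0"
      unfolding Z by (simp add: LIMSEQ_const_iff)
    also have "(LINT x|lborel. h x * of_real (?Q x * I)) = of_real I * (LINT x:box l u|lborel. h x)"
      unfolding set_lebesgue_integral_def by (subst integral_mult_right_zero[symmetric]) (simp add: mult_ac scaleR_conv_of_real)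
    finally show "(LINT x:box l u|lborel. h x) = 0" using I by simp
  qed
  thus ?thesis unfolding h_def by eventually_elim (auto simp: gauss_def gauss1_def)
qed

subsection \<open>Fourier inversion\<close>

definition inv_fourier :: "(real ^ 'n::finite \<Rightarrow> complex) \<Rightarrow> real ^ 'n \<Rightarrow> complex" where
  "inv_fourier \<theta> x = (LINT \<xi>|lborel. \<theta> \<xi> * exp (2 * pi * \<i> * of_real (x \<bullet> \<xi>)))"

lemma norm_exp_2pi: "norm (exp (2 * complex_of_real pi * \<i> * complex_of_real t)) = 1"
  "norm (exp (complex_of_real (2 * pi) * \<i> * complex_of_real t)) = 1"
  by (simp_all add: norm_exp_eq_Re)

lemma inv_fourier_measurable [measurable]:
  assumes "integrable lborel \<theta>"
  shows "inv_fourier \<theta> \<in> borel_measurable borel"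
proof -
  have [measurable]: "\<theta> \<in> borel_measurable borel" using assms by auto
  show ?thesis unfolding inv_fourier_def by measurable
qed

lemma norm_inv_fourier_le:
  assumes "integrable lborel \<theta>"
  shows "cmod (inv_fourier \<theta> x) \<le> (LINT \<xi>|lborel. cmod (\<theta> \<xi>))"
  unfolding inv_fourier_def
  by (rule order.trans[OF integral_norm_bound]) (simp add: norm_mult norm_exp_2pi)

text \<open>Fubini moves the transform from \<open>\<theta>\<close> to the Gaussian, where inversion
  is explicit. This is the bridge between integrable functions and distributional
  transforms.\<close>

lemma inv_fourier_gauss_pairing:
  assumes \<theta>: "integrable lborel \<theta>" and c: "c > 0"
  shows "(LINT x|lborel. inv_fourier \<theta> x * fourier (gauss c z) x) = (LINT \<xi>|lborel. \<theta> \<xi> * gauss c z \<xi>)"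
proof -
  let ?g = "fourier (gauss c z)"
  have [measurable]: "\<theta> \<in> borel_measurable borel" using \<theta> by auto
  have c': "pi\<^sup>2 / c > 0" using c by simp
  have g: "integrable lborel ?g"
    unfolding fourier_gauss[OF c, abs_def] by (intro integrable_mult_right integrable_gauss c')
  have [measurable]: "?g \<in> borel_measurable borel" using g by auto
  have "(LINT x|lborel. inv_fourier \<theta> x * ?g x) = (LINT x|lborel. (LINT \<xi>|lborel. \<theta> \<xi> * exp (2 * pi * \<i> * of_real (x \<bullet> \<xi>)) * ?g x))"
    by (simp add: inv_fourier_def)
  also have "\<dots> = (LINT \<xi>|lborel. (LINT x|lborel. \<theta> \<xi> * exp (2 * pi * \<i> * of_real (x \<bullet> \<xi>)) * ?g x))"
  proof (rule lborel_pair.Fubini_integral)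
    show "integrable (lborel \<Otimes>\<^sub>M lborel) (\<lambda>(\<xi>, x). \<theta> \<xi> * exp (2 * pi * \<i> * of_real (x \<bullet> \<xi>)) * ?g x)"
    proof (rule pair_sigma_finite.integrable_pair_bound[OF lborel_pair.pair_sigma_finite_axioms])
      show "integrable lborel (\<lambda>\<xi>. cmod (\<theta> \<xi>))" "integrable lborel (\<lambda>x. cmod (?g x))" using \<theta> g by auto
    qed (measurable, simp add: norm_mult norm_exp_2pi)
  qed
  also have "\<dots> = (LINT \<xi>|lborel. \<theta> \<xi> * (LINT x|lborel. ?g x * exp (2 * pi * \<i> * of_real (x \<bullet> \<xi>))))"
    by (simp add: mult_ac flip: integral_mult_right_zero)
  also have "\<dots> = (LINT \<xi>|lborel. \<theta> \<xi> * gauss c z \<xi>)"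
    by (simp only: inverse_fourier_gauss[OF c])
  finally show ?thesis .
qed

lemma continuous_inv_fourier:
  assumes \<theta>: "integrable lborel \<theta>"
  shows "continuous_on UNIV (inv_fourier \<theta>)"
proof (clarsimp simp: continuous_on_sequentially)
  fix X :: "nat \<Rightarrow> real^'a" and x assume X: "X \<longlonglongrightarrow> x"
  have [measurable]: "\<theta> \<in> borel_measurable borel" using \<theta> by auto
  show "(inv_fourier \<theta> \<circ> X) \<longlonglongrightarrow> inv_fourier \<theta> x"
    unfolding inv_fourier_def o_def
  proof (rule integral_dominated_convergence)
    show "integrable lborel (\<lambda>\<xi>. cmod (\<theta> \<xi>))" using \<theta> by simp
    show "AE \<xi> in lborel. (\<lambda>n. \<theta> \<xi> * exp (2 * pi * \<i> * of_real (X n \<bullet> \<xi>))) \<longlonglongrightarrow> \<theta> \<xi> * exp (2 * pi * \<i> * of_real (x \<bullet> \<xi>))"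
      by (intro always_eventually allI tendsto_intros X)
  qed (auto simp: norm_mult norm_exp_2pi)
qed

text \<open>\<open>H\<close> and \<open>\<theta>\<close> have the same pairing with every Gaussian.
  The result identifies the transform that appears in the compatibility condition with the function
  given on the box.\<close>

lemma fourier_is_inv_fourier:
  assumes \<theta>: "integrable lborel \<theta>" and H: "fourier_is (inv_fourier \<theta>) H"
  shows "AE \<xi> in lborel. H \<xi> = \<theta> \<xi>"
proof -
  have [measurable]: "\<theta> \<in> borel_measurable borel" using \<theta> by auto
  have Ht: "H \<in> borel_measurable lborel" "\<And>\<psi>. schwartz \<psi> \<Longrightarrow> integrable lborel (\<lambda>x. H x * \<psi> x)"
    and eq: "\<And>\<psi>. schwartz \<psi> \<Longrightarrow> (LINT x|lborel. inv_fourier \<theta> x * fourier \<psi> x) = (LINT x|lborel. H x * \<psi> x)"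
    using H by (auto simp: fourier_is_def dist_fourier_is_def tempered_function_def dist_fourier_def function_distribution_def)
  have [measurable]: "H \<in> borel_measurable borel" using Ht by simp
  have sg: "schwartz (gauss c z)" if "c > 0" for c z using schwartz_gauss[OF that, of 1 z] by simp
  have i2: "integrable lborel (\<lambda>x. \<theta> x * gauss c z x)" if c: "c > 0" for c z
  proof -
    obtain B where B: "\<And>x. cmod (gauss c z x) \<le> B"
      using gauss_bounded[OF c] by blast
    show ?thesis
    proof (rule Bochner_Integration.integrable_bound)
      show "integrable lborel (\<lambda>x. cmod (\<theta> x) * B)" using \<theta> by simp
      show "AE x in lborel. norm (\<theta> x * gauss c z x) \<le> norm (cmod (\<theta> x) * B)"
        by (intro AE_I2) (auto simp: norm_mult abs_mult intro!: mult_left_mono order.trans[OF B abs_ge_self])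
    qed measurable
  qed
  have "AE x in lborel. H x - \<theta> x = 0"
  proof (rule gauss_unique)
    fix c :: real and z assume c: "c > 0"
    show "integrable lborel (\<lambda>x. (H x - \<theta> x) * gauss c z x)"
      using Bochner_Integration.integrable_diff[OF Ht(2)[OF sg[OF c, of z]] i2[OF c, of z]] by (simp add: algebra_simps)
  next
    fix c :: real and p :: "real^'a" assume c: "c > 0"
    let ?z = "\<chi> i. complex_of_real (p $ i)"
    have "(LINT x|lborel. (H x - \<theta> x) * gauss c ?z x) = (LINT x|lborel. H x * gauss c ?z x) - (LINT x|lborel. \<theta> x * gauss c ?z x)"
      by (subst Bochner_Integration.integral_diff[symmetric]) (auto intro: Ht(2) sg c i2 simp: algebra_simps)
    also have "\<dots> = 0" using eq[OF sg[OF c, of ?z]] inv_fourier_gauss_pairing[OF \<theta> c, of ?z] by simp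
    finally show "(LINT x|lborel. (H x - \<theta> x) * gauss c ?z x) = 0" .
  qed measurable
  thus ?thesis by simp
qed

lemma inv_fourier_of_fourier_is:
  assumes f: "continuous_on UNIV f" and F: "integrable lborel F" and fF: "fourier_is f F"
  shows "f x = inv_fourier F x"
proof -
  have [measurable]: "F \<in> borel_measurable borel" using F by auto
  have [measurable]: "f \<in> borel_measurable borel" using f by (rule borel_measurable_continuous_onI)
  have ft: "\<And>\<psi>. schwartz \<psi> \<Longrightarrow> integrable lborel (\<lambda>x. f x * \<psi> x)"
    and eq: "\<And>\<psi>. schwartz \<psi> \<Longrightarrow> (LINT x|lborel. f x * fourier \<psi> x) = (LINT x|lborel. F x * \<psi> x)"
    using fF by (auto simp: fourier_is_def dist_fourier_is_def tempered_function_def dist_fourier_def function_distribution_def)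
  have sg: "schwartz (gauss c z)" if "c > 0" for c z using schwartz_gauss[OF that, of 1 z] by simp
  have i2: "integrable lborel (\<lambda>x. inv_fourier F x * gauss c z x)" if c: "c > 0" for c z
  proof (rule Bochner_Integration.integrable_bound)
    show "integrable lborel (\<lambda>x. (LINT \<xi>|lborel. cmod (F \<xi>)) * cmod (gauss c z x))" using integrable_norm[OF integrable_gauss[OF c, of z]] by simp
    show "AE x in lborel. norm (inv_fourier F x * gauss c z x) \<le> norm ((LINT \<xi>|lborel. cmod (F \<xi>)) * cmod (gauss c z x))"
      by (intro AE_I2) (auto simp: norm_mult abs_mult intro!: mult_right_mono norm_inv_fourier_le F)
    show "(\<lambda>x. inv_fourier F x * gauss c z x) \<in> borel_measurable lborel" using F by measurable
  qed
  have "AE x in lborel. f x - inv_fourier F x = 0"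
  proof (rule gauss_unique)
    show "(\<lambda>x. f x - inv_fourier F x) \<in> borel_measurable borel" using F by measurable
    fix c :: real and z assume c: "c > 0"
    show "integrable lborel (\<lambda>x. (f x - inv_fourier F x) * gauss c z x)"
      using Bochner_Integration.integrable_diff[OF ft[OF sg[OF c, of z]] i2[OF c, of z]] by (simp add: algebra_simps)
  next
    fix c :: real and p :: "real^'a" assume c: "c > 0"
    let ?z = "\<chi> i. complex_of_real (p $ i)"
    \<comment> \<open>The hypothesis on \<open>f\<close> tests it against transforms of Gaussians
      only, so the given Gaussian has to be recognized as one: parameter \<open>pi^2 / c\<close> and
      a purely imaginary linear coefficient achieve this up to the nonzero factor
      \<open>K\<close>.\<close>
    define d where "d = pi\<^sup>2 / c"
    define w :: "complex^'a" where "w = (\<chi> i. of_real (p $ i) * \<i> * of_real (pi / c))"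
    define K where "K = (\<Prod>i\<in>UNIV. of_real (sqrt (pi / d)) * exp ((w $ i)\<^sup>2 / (4 * of_real d)))"
    have d: "d > 0" using c by (simp add: d_def)
    have K: "K \<noteq> 0" using d by (simp add: K_def)
    have zz: "(\<chi> i. - of_real (pi / d) * \<i> * w $ i) = ?z"
      using c by (simp add: vec_eq_iff w_def d_def power2_eq_square mult.left_commute[of \<i>])
    have dd: "pi\<^sup>2 / d = c" using c by (simp add: d_def)
    have g: "fourier (gauss d w) x = K * gauss c ?z x" for x
      by (subst fourier_gauss[OF d]) (simp only: K_def zz dd)
    have "(LINT x|lborel. f x * fourier (gauss d w) x) = (LINT x|lborel. inv_fourier F x * fourier (gauss d w) x)"
      using eq[OF sg[OF d, of w]] inv_fourier_gauss_pairing[OF F d, of w] by simp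
    hence "K * (LINT x|lborel. f x * gauss c ?z x) = K * (LINT x|lborel. inv_fourier F x * gauss c ?z x)"
      unfolding g by (simp add: mult.left_commute)
    hence "(LINT x|lborel. f x * gauss c ?z x) = (LINT x|lborel. inv_fourier F x * gauss c ?z x)" using K by simp
    thus "(LINT x|lborel. (f x - inv_fourier F x) * gauss c ?z x) = 0"
      by (simp add: left_diff_distrib Bochner_Integration.integral_diff[OF ft[OF sg[OF c, of ?z]] i2[OF c, of ?z]])
  qed
  hence ae: "AE x in lborel. f x = inv_fourier F x" by simp
  \<comment> \<open>Almost everywhere becomes everywhere: both functions are continuous, so they
    differ on an open set, and a nonempty open set is not null.\<close>
  define D where "D = {x. f x \<noteq> inv_fourier F x}"
  have "open D" unfolding D_def
    by (rule open_Collect_neq) (intro f continuous_inv_fourier F)+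
  have "D \<in> null_sets lborel"
    using ae \<open>open D\<close> by (subst AE_iff_null_sets) (auto simp: D_def)
  hence "D = {}" using \<open>open D\<close> by (metis negligible_iff_null_sets null_sets_completionI open_not_negligible)
  thus ?thesis by (auto simp: D_def)
qed

subsection \<open>Differential operators on oscillatory integrals\<close>

text \<open>The phase \<open>w\<close> is a parameter because two cases occur:
  \<open>w \<xi> = - \<xi>\<close> gives the Fourier transform, and \<open>w \<xi> = A \<xi>\<close>
  gives the dilate of \<open>f\<close> that is sampled.\<close>

definition osc_integral :: "'a measure \<Rightarrow> ('a \<Rightarrow> real ^ 'n) \<Rightarrow> ('a \<Rightarrow> complex) \<Rightarrow> real ^ 'n::finite \<Rightarrow> complex" where
  "osc_integral M w F y = (LINT \<xi>|M. F \<xi> * exp (2 * pi * \<i> * of_real (y \<bullet> w \<xi>)))"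

lemma osc_integral_deriv:
  fixes w :: "'a \<Rightarrow> real ^ 'n::finite"
  assumes [measurable]: "w \<in> borel_measurable M"
    and F: "integrable M F" and Fw: "integrable M (\<lambda>\<xi>. F \<xi> * of_real (w \<xi> $ i))"
  shows "((\<lambda>t. osc_integral M w F (y + t *\<^sub>R axis i 1)) has_vector_derivative
          osc_integral M w (\<lambda>\<xi>. F \<xi> * (2 * pi * \<i> * of_real (w \<xi> $ i))) y) (at 0)"
proof -
  have [measurable]: "F \<in> borel_measurable M" using F by auto
  let ?e = "\<lambda>y \<xi>. exp (2 * pi * \<i> * of_real (y \<bullet> w \<xi>))"
  let ?D = "osc_integral M w (\<lambda>\<xi>. F \<xi> * (2 * pi * \<i> * of_real (w \<xi> $ i))) y"
  have intD: "integrable M (\<lambda>\<xi>. F \<xi> * (2 * pi * \<i> * of_real (w \<xi> $ i)) * ?e y \<xi>)"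
  proof (rule Bochner_Integration.integrable_bound)
    show "integrable M (\<lambda>\<xi>. norm (2 * pi * (F \<xi> * of_real (w \<xi> $ i))))"
      using Fw by (intro integrable_norm integrable_mult_right) auto
  qed (auto simp: norm_mult norm_exp_2pi)
  have intF: "integrable M (\<lambda>\<xi>. F \<xi> * ?e z \<xi>)" for z
    by (rule Bochner_Integration.integrable_bound[OF F]) (auto simp: norm_mult norm_exp_2pi)
  \<comment> \<open>The integrand of the difference quotient minus the proposed derivative.\<close>
  define r where "r h \<xi> = F \<xi> * ?e y \<xi> * ((iexp (2 * pi * w \<xi> $ i * h) - 1 - \<i> * of_real (2 * pi * w \<xi> $ i * h)) / of_real h)" for h \<xi>
  have req: "osc_integral M w F (y + h *\<^sub>R axis i 1) - osc_integral M w F y - h *\<^sub>R ?D = of_real h * (LINT \<xi>|M. r h \<xi>)" if "h \<noteq> 0" for h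
  proof -
    have "of_real h * (LINT \<xi>|M. r h \<xi>) = (LINT \<xi>|M. F \<xi> * ?e (y + h *\<^sub>R axis i 1) \<xi> - F \<xi> * ?e y \<xi> - of_real h * (F \<xi> * (2 * pi * \<i> * of_real (w \<xi> $ i)) * ?e y \<xi>))"
      unfolding integral_mult_right_zero[symmetric]
    proof (intro Bochner_Integration.integral_cong refl)
      fix \<xi>
      have "of_real h * r h \<xi> = F \<xi> * ?e y \<xi> * (iexp (2 * pi * w \<xi> $ i * h) - 1 - \<i> * of_real (2 * pi * w \<xi> $ i * h))"
        using that by (simp add: r_def)
      moreover have "?e (y + h *\<^sub>R axis i 1) \<xi> = ?e y \<xi> * iexp (2 * pi * w \<xi> $ i * h)"
        by (simp add: inner_add_left inner_axis' exp_add[symmetric] algebra_simps)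
      ultimately show "of_real h * r h \<xi> = F \<xi> * ?e (y + h *\<^sub>R axis i 1) \<xi> - F \<xi> * ?e y \<xi> - of_real h * (F \<xi> * (2 * pi * \<i> * of_real (w \<xi> $ i)) * ?e y \<xi>)"
        by (simp only:) (simp add: algebra_simps)
    qed
    also have "\<dots> = osc_integral M w F (y + h *\<^sub>R axis i 1) - osc_integral M w F y - h *\<^sub>R ?D"
      unfolding osc_integral_def scaleR_conv_of_real integral_mult_right_zero[symmetric]
      by (subst Bochner_Integration.integral_diff, intro Bochner_Integration.integrable_diff intF, intro integrable_mult_right intD,
          subst Bochner_Integration.integral_diff[OF intF intF]) simp
    finally show ?thesis by simp
  qed
  have lim: "((\<lambda>h. LINT \<xi>|M. r h \<xi>) \<longlongrightarrow> 0) (at 0)"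
    unfolding tendsto_at_iff_sequentially
  proof (intro allI impI)
    fix X :: "nat \<Rightarrow> real" assume X: "\<forall>n. X n \<in> UNIV - {0}" "X \<longlonglongrightarrow> 0"
    have "(\<lambda>n. LINT \<xi>|M. r (X n) \<xi>) \<longlonglongrightarrow> (LINT \<xi>|M. 0)"
    proof (rule integral_dominated_convergence)
      \<comment> \<open>A first-order estimate of the exponential dominates the remainder: its two
        terms contribute \<open>2 pi \<bar>w_i\<bar>\<close> each, so integrability of
        \<open>F w_i\<close> is enough. The second-order estimate is kept for the pointwise limit,
        where no majorant is involved.\<close>
      show "integrable M (\<lambda>\<xi>. 4 * pi * norm (F \<xi> * of_real (w \<xi> $ i)))"
        using Fw by (intro integrable_mult_right integrable_norm) auto
      fix n
      have "X n \<noteq> 0" using X by simp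
      { fix \<xi>
        let ?a = "2 * pi * w \<xi> $ i * X n"
        have "cmod (iexp ?a - 1 - \<i> * of_real ?a) \<le> cmod (iexp ?a - 1) + cmod (\<i> * of_real ?a)" by (rule norm_triangle_ineq4)
        also have "cmod (iexp ?a - 1) \<le> \<bar>?a\<bar>" using iexp_approx1[of ?a 0] by simp
        also have "cmod (\<i> * of_real ?a) = \<bar>?a\<bar>" by (simp only: norm_mult norm_of_real norm_ii mult_1_left)
        finally have "cmod (iexp ?a - 1 - \<i> * of_real ?a) / \<bar>X n\<bar> \<le> 2 * \<bar>?a\<bar> / \<bar>X n\<bar>"
          by (intro divide_right_mono) auto
        also have "\<dots> = 4 * pi * \<bar>w \<xi> $ i\<bar>" using \<open>X n \<noteq> 0\<close> by (simp add: abs_mult)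
        finally have "cmod (r (X n) \<xi>) \<le> cmod (F \<xi>) * (4 * pi * \<bar>w \<xi> $ i\<bar>)"
          unfolding r_def norm_mult norm_exp_2pi norm_divide norm_of_real mult_1_right
          by (intro mult_left_mono) auto
        hence "norm (r (X n) \<xi>) \<le> 4 * pi * norm (F \<xi> * of_real (w \<xi> $ i))" by (simp add: norm_mult mult_ac)
      }
      thus "AE \<xi> in M. norm (r (X n) \<xi>) \<le> 4 * pi * norm (F \<xi> * of_real (w \<xi> $ i))" by auto
    next
      show "AE \<xi> in M. (\<lambda>n. r (X n) \<xi>) \<longlonglongrightarrow> 0"
      proof (intro AE_I2)
        fix \<xi>
        let ?a = "2 * pi * w \<xi> $ i"
        show "(\<lambda>n. r (X n) \<xi>) \<longlonglongrightarrow> 0"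
        proof (rule Lim_null_comparison)
          show "(\<lambda>n. cmod (F \<xi>) * (?a\<^sup>2 * \<bar>X n\<bar> / 2)) \<longlonglongrightarrow> 0"
            using X(2) by (auto intro!: tendsto_eq_intros)
          show "\<forall>\<^sub>F n in sequentially. norm (r (X n) \<xi>) \<le> cmod (F \<xi>) * (?a\<^sup>2 * \<bar>X n\<bar> / 2)"
          proof (intro always_eventually allI)
            fix n
            have X0: "X n \<noteq> 0" using X by simp
            have "cmod (iexp (?a * X n) - 1 - \<i> * of_real (?a * X n)) \<le> \<bar>?a * X n\<bar> ^ 2 / 2"
              using iexp_approx1[of "?a * X n" 1] by (simp add: diff_diff_eq numeral_2_eq_2)
            hence "cmod (iexp (?a * X n) - 1 - \<i> * of_real (?a * X n)) / \<bar>X n\<bar> \<le> \<bar>?a * X n\<bar> ^ 2 / 2 / \<bar>X n\<bar>"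
              by (intro divide_right_mono) auto
            also have "\<dots> = ?a\<^sup>2 * \<bar>X n\<bar> / 2" using X0 by (simp add: power2_eq_square abs_mult divide_simps)
            finally show "norm (r (X n) \<xi>) \<le> cmod (F \<xi>) * (?a\<^sup>2 * \<bar>X n\<bar> / 2)"
              unfolding r_def norm_mult norm_exp_2pi norm_divide norm_of_real mult_1_right
              by (intro mult_left_mono) auto
          qed
        qed
      qed
    qed (unfold r_def, measurable)
    thus "((\<lambda>h. LINT \<xi>|M. r h \<xi>) \<circ> X) \<longlonglongrightarrow> 0" by (simp add: o_def)
  qed
  show ?thesis
    unfolding has_vector_derivative_def has_derivative_at
  proof (intro conjI)
    show "bounded_linear (\<lambda>x. x *\<^sub>R ?D)" by (rule bounded_linear_scaleR_left)
    have "((\<lambda>h. norm (LINT \<xi>|M. r h \<xi>)) \<longlongrightarrow> 0) (at 0)" using tendsto_norm[OF lim] by simp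
    moreover have "\<forall>\<^sub>F h in at 0. norm (LINT \<xi>|M. r h \<xi>) = norm (osc_integral M w F (y + (0 + h) *\<^sub>R axis i 1) - osc_integral M w F (y + 0 *\<^sub>R axis i 1) - h *\<^sub>R ?D) / norm h"
      using req by (auto simp: eventually_at norm_mult intro!: exI[of _ 1])
    ultimately show "(\<lambda>h. norm (osc_integral M w F (y + (0 + h) *\<^sub>R axis i 1) - osc_integral M w F (y + 0 *\<^sub>R axis i 1) - h *\<^sub>R ?D) / norm h) \<midarrow>0\<rightarrow> 0"
      by (rule Lim_transform_eventually)
  qed
qed

text \<open>Exponents are plain functions, since the induction over derivatives raises them one
  coordinate at a time by function update.\<close>

definition mi_monom :: "real ^ 'n \<Rightarrow> ('n \<Rightarrow> nat) \<Rightarrow> complex" where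
  "mi_monom v \<gamma> = (\<Prod>i\<in>UNIV. (2 * pi * \<i> * of_real (v $ i)) ^ \<gamma> i)"

lemma norm_mi_monom_le: "cmod (mi_monom v \<gamma>) \<le> (2 * pi) ^ (\<Sum>i\<in>UNIV. \<gamma> i) * norm v ^ (\<Sum>i\<in>UNIV. \<gamma> i)" for v :: "real ^ 'n::finite"
proof -
  have "cmod (mi_monom v \<gamma>) = (\<Prod>i\<in>UNIV. (2 * pi * \<bar>v $ i\<bar>) ^ \<gamma> i)"
    by (simp add: mi_monom_def prod_norm[symmetric] norm_power norm_mult)
  also have "\<dots> \<le> (\<Prod>i\<in>UNIV. (2 * pi * norm v) ^ \<gamma> i)"
    by (intro prod_mono conjI power_mono mult_left_mono component_le_norm_cart) auto
  also have "\<dots> = (2 * pi * norm v) ^ (\<Sum>i\<in>UNIV. \<gamma> i)" by (simp add: power_sum)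
  finally show ?thesis by (simp add: power_mult_distrib)
qed

lemma mi_monom_measurable [measurable]: "w \<in> borel_measurable M \<Longrightarrow> (\<lambda>x. mi_monom (w x) \<gamma>) \<in> borel_measurable M"
  for w :: "'a \<Rightarrow> real ^ 'n::finite"
  unfolding mi_monom_def by measurable

lemma mi_monom_upd: "mi_monom v (\<gamma>(i := Suc (\<gamma> i))) = mi_monom v \<gamma> * (2 * pi * \<i> * of_real (v $ i))" for v :: "real ^ 'n::finite"
proof -
  have s: "(\<Prod>j\<in>UNIV. f j) = f i * (\<Prod>j\<in>UNIV - {i}. f j)" for f :: "'n \<Rightarrow> complex"
    by (rule prod.remove) auto
  show ?thesis unfolding mi_monom_def by (subst (1 2) s) (simp add: mult_ac)
qed

lemma integrable_mi_monom:
  fixes w :: "'a \<Rightarrow> real ^ 'n::finite"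
  assumes [measurable]: "w \<in> borel_measurable M" "F \<in> borel_measurable M"
    and int: "integrable M (\<lambda>\<xi>. norm (w \<xi>) ^ (\<Sum>i\<in>UNIV. \<gamma> i) * cmod (F \<xi>))"
  shows "integrable M (\<lambda>\<xi>. F \<xi> * mi_monom (w \<xi>) \<gamma>)"
proof (rule Bochner_Integration.integrable_bound)
  show "integrable M (\<lambda>\<xi>. (2 * pi) ^ (\<Sum>i\<in>UNIV. \<gamma> i) * (norm (w \<xi>) ^ (\<Sum>i\<in>UNIV. \<gamma> i) * cmod (F \<xi>)))"
    using int by (rule integrable_mult_right)
  show "AE x in M. norm (F x * mi_monom (w x) \<gamma>) \<le> norm ((2 * pi) ^ (\<Sum>i\<in>UNIV. \<gamma> i) * (norm (w x) ^ (\<Sum>i\<in>UNIV. \<gamma> i) * cmod (F x)))"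
  proof (intro AE_I2)
    fix x
    have "norm (F x * mi_monom (w x) \<gamma>) \<le> cmod (F x) * ((2 * pi) ^ (\<Sum>i\<in>UNIV. \<gamma> i) * norm (w x) ^ (\<Sum>i\<in>UNIV. \<gamma> i))"
      unfolding norm_mult by (intro mult_left_mono norm_mi_monom_le) auto
    thus "norm (F x * mi_monom (w x) \<gamma>) \<le> norm ((2 * pi) ^ (\<Sum>i\<in>UNIV. \<gamma> i) * (norm (w x) ^ (\<Sum>i\<in>UNIV. \<gamma> i) * cmod (F x)))"
      by (simp add: abs_mult mult_ac)
  qed
qed measurable

text \<open>Each derivative multiplies the integrand by one factor \<open>2 pi i w_i\<close>. As
  long as the total degree stays at most \<open>N\<close>, the assumed moments justify
  differentiation under the integral.\<close>

lemma mi_deriv_osc_integral: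
  fixes w :: "'a \<Rightarrow> real ^ 'n::finite"
  assumes [measurable]: "w \<in> borel_measurable M" "F \<in> borel_measurable M"
    and int: "\<And>k. k \<le> N \<Longrightarrow> integrable M (\<lambda>\<xi>. norm (w \<xi>) ^ k * cmod (F \<xi>))"
    and \<beta>: "mi_order \<beta> \<le> N"
  shows "mi_deriv \<beta> (osc_integral M w F) = osc_integral M w (\<lambda>\<xi>. F \<xi> * mi_monom (w \<xi>) (\<lambda>i. \<beta> $ i))"
proof -
  let ?J = "\<lambda>\<gamma>. osc_integral M w (\<lambda>\<xi>. F \<xi> * mi_monom (w \<xi>) \<gamma>)"
  have step: "partial_deriv i (?J \<gamma>) = ?J (\<gamma>(i := Suc (\<gamma> i)))" if le: "(\<Sum>j\<in>UNIV. (\<gamma>(i := Suc (\<gamma> i))) j) \<le> N" for i \<gamma>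
  proof (rule ext)
    fix y
    have s: "(\<Sum>j\<in>UNIV. f j) = f i + (\<Sum>j\<in>UNIV - {i}. f j)" for f :: "'n \<Rightarrow> nat"
      by (rule sum.remove) auto
    have "(\<Sum>i\<in>UNIV. \<gamma> i) \<le> (\<Sum>j\<in>UNIV. (\<gamma>(i := Suc (\<gamma> i))) j)"
      by (intro sum_mono) auto
    hence i1: "integrable M (\<lambda>\<xi>. F \<xi> * mi_monom (w \<xi>) \<gamma>)" using le
      by (intro integrable_mi_monom int) auto
    have "integrable M (\<lambda>\<xi>. F \<xi> * mi_monom (w \<xi>) (\<gamma>(i := Suc (\<gamma> i))))"
      by (intro integrable_mi_monom int assms(1,2)) (rule le)
    hence "integrable M (\<lambda>\<xi>. (1 / (2 * pi * \<i>)) * (F \<xi> * mi_monom (w \<xi>) (\<gamma>(i := Suc (\<gamma> i)))))"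
      by (rule integrable_mult_right)
    hence i2: "integrable M (\<lambda>\<xi>. F \<xi> * mi_monom (w \<xi>) \<gamma> * of_real (w \<xi> $ i))"
      by (simp add: mi_monom_upd mult_ac)
    show "partial_deriv i (?J \<gamma>) y = ?J (\<gamma>(i := Suc (\<gamma> i))) y"
      unfolding partial_deriv_def
      by (rule vector_derivative_at, rule has_vector_derivative_eq_rhs[OF osc_integral_deriv[OF _ i1 i2]])
         (simp_all add: mi_monom_upd mult.assoc)
  qed
  have pw: "(partial_deriv i ^^ n) (?J \<gamma>) = ?J (\<gamma>(i := \<gamma> i + n))" if "(\<Sum>j\<in>UNIV. (\<gamma>(i := \<gamma> i + n)) j) \<le> N" for i \<gamma> n
    using that
  proof (induction n)
    case (Suc n)
    have "(\<Sum>j\<in>UNIV. (\<gamma>(i := \<gamma> i + n)) j) \<le> (\<Sum>j\<in>UNIV. (\<gamma>(i := \<gamma> i + Suc n)) j)"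
      by (intro sum_mono) auto
    hence "(partial_deriv i ^^ n) (?J \<gamma>) = ?J (\<gamma>(i := \<gamma> i + n))"
      using Suc.prems by (intro Suc.IH) linarith
    moreover have "partial_deriv i (?J (\<gamma>(i := \<gamma> i + n))) = ?J ((\<gamma>(i := \<gamma> i + n))(i := Suc ((\<gamma>(i := \<gamma> i + n)) i)))"
      by (rule step) (use Suc.prems in simp)
    ultimately show ?case by (simp only: funpow.simps o_apply fun_upd_upd fun_upd_same add_Suc_right)
  qed simp
  \<comment> \<open>Coordinates already processed carry their exponent from \<open>\<beta>\<close>
    and the others carry 0; distinctness ensures that no coordinate is raised twice.\<close>
  have fold: "foldr (\<lambda>i. partial_deriv i ^^ (\<beta> $ i)) xs (?J (\<lambda>_. 0)) = ?J (\<lambda>i. if i \<in> set xs then \<beta> $ i else 0)" if "distinct xs" for xs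
    using that
  proof (induction xs)
    case (Cons i xs)
    let ?\<gamma> = "\<lambda>i. if i \<in> set xs then \<beta> $ i else 0"
    have eq: "?\<gamma>(i := ?\<gamma> i + \<beta> $ i) = (\<lambda>j. if j \<in> set (i # xs) then \<beta> $ j else 0)"
      using Cons.prems by auto
    have "(\<Sum>j\<in>UNIV. (?\<gamma>(i := ?\<gamma> i + \<beta> $ i)) j) \<le> mi_order \<beta>"
      unfolding eq mi_order_def by (intro sum_mono) auto
    hence "(partial_deriv i ^^ (\<beta> $ i)) (?J ?\<gamma>) = ?J (?\<gamma>(i := ?\<gamma> i + \<beta> $ i))"
      using \<beta> by (intro pw) linarith
    thus ?case unfolding eq using Cons by simp
  qed simp
  have "set (coords :: 'n list) = UNIV \<and> distinct (coords :: 'n list)"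
    unfolding coords_def by (rule someI_ex) (rule finite_distinct_list, simp)
  hence "mi_deriv \<beta> (?J (\<lambda>_. 0)) = ?J (\<lambda>i. \<beta> $ i)"
    unfolding mi_deriv_def using fold[of coords] by simp
  thus ?thesis by (simp add: mi_monom_def)
qed

section \<open>The symbol of the operator and the transform of its distribution\<close>

definition symbol :: "nat \<Rightarrow> (nat ^ 'n::finite \<Rightarrow> complex) \<Rightarrow> real ^ 'n \<Rightarrow> complex" where
  "symbol N a v = (\<Sum>\<beta> | mi_order \<beta> \<le> N. a \<beta> * mi_monom v (\<lambda>i. \<beta> $ i))"

lemma symbol_measurable [measurable]: "w \<in> borel_measurable M \<Longrightarrow> (\<lambda>x. symbol N a (w x)) \<in> borel_measurable M"
  unfolding symbol_def by measurable

lemma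
  fixes w :: "'a \<Rightarrow> real ^ 'n::finite"
  assumes [measurable]: "w \<in> borel_measurable M" "F \<in> borel_measurable M"
    and int: "\<And>k. k \<le> N \<Longrightarrow> integrable M (\<lambda>\<xi>. norm (w \<xi>) ^ k * cmod (F \<xi>))"
  shows diff_op_osc_integral: "diff_op N a (osc_integral M w F) y = osc_integral M w (\<lambda>\<xi>. F \<xi> * symbol N a (w \<xi>)) y"
    and integrable_times_symbol: "integrable M (\<lambda>\<xi>. F \<xi> * symbol N a (w \<xi>))"
proof -
  let ?e = "\<lambda>y \<xi>. exp (2 * pi * \<i> * of_real (y \<bullet> w \<xi>))"
  have i: "integrable M (\<lambda>\<xi>. F \<xi> * mi_monom (w \<xi>) (\<lambda>i. \<beta> $ i))" if "mi_order \<beta> \<le> N" for \<beta>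
    by (intro integrable_mi_monom int) (use that in \<open>auto simp: mi_order_def\<close>)
  have ie: "integrable M (\<lambda>\<xi>. F \<xi> * mi_monom (w \<xi>) (\<lambda>i. \<beta> $ i) * ?e y \<xi>)" if "mi_order \<beta> \<le> N" for \<beta> y
    by (rule Bochner_Integration.integrable_bound[OF i[OF that]]) (auto simp: norm_mult norm_exp_2pi)
  show "integrable M (\<lambda>\<xi>. F \<xi> * symbol N a (w \<xi>))"
    unfolding symbol_def sum_distrib_left mult.left_commute[of _ "a _"]
    by (intro Bochner_Integration.integrable_sum integrable_mult_right i) simp
  have "osc_integral M w (\<lambda>\<xi>. F \<xi> * symbol N a (w \<xi>)) y = (LINT \<xi>|M. (\<Sum>\<beta> | mi_order \<beta> \<le> N. a \<beta> * (F \<xi> * mi_monom (w \<xi>) (\<lambda>i. \<beta> $ i) * ?e y \<xi>)))"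
    by (simp add: osc_integral_def symbol_def sum_distrib_left sum_distrib_right mult_ac)
  also have "\<dots> = (\<Sum>\<beta> | mi_order \<beta> \<le> N. a \<beta> * osc_integral M w (\<lambda>\<xi>. F \<xi> * mi_monom (w \<xi>) (\<lambda>i. \<beta> $ i)) y)"
    unfolding osc_integral_def integral_mult_right_zero[symmetric]
    by (rule Bochner_Integration.integral_sum) (use ie in auto)
  also have "\<dots> = diff_op N a (osc_integral M w F) y"
    unfolding diff_op_def using mi_deriv_osc_integral[OF assms(1,2) int] by (intro sum.cong refl) auto
  finally show "diff_op N a (osc_integral M w F) y = osc_integral M w (\<lambda>\<xi>. F \<xi> * symbol N a (w \<xi>)) y" ..
qed

lemma cnj_symbol: "cnj (symbol N a v) = symbol N (\<lambda>\<beta>. cnj (a \<beta>)) (- v)"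
  by (simp add: symbol_def mi_monom_def)

text \<open>The signs in \<open>assoc_distribution\<close> and \<open>dist_deriv\<close> cancel, so
  on the transform of a Gaussian the functional is the operator with conjugate coefficients,
  evaluated at 0. That transform is an oscillatory integral with phase \<open>- \<xi>\<close>, which
  turns the operator into its symbol, and uniqueness on Gaussians identifies
  \<open>G\<close>.\<close>

lemma assoc_distribution_fourier:
  assumes "dist_fourier_is (assoc_distribution N a) G"
  shows "AE \<xi> in lborel. G \<xi> = cnj (symbol N a \<xi>)"
proof -
  have Gt: "G \<in> borel_measurable lborel" "\<And>\<psi>. schwartz \<psi> \<Longrightarrow> integrable lborel (\<lambda>x. G x * \<psi> x)"
    and eq: "\<And>\<psi>. schwartz \<psi> \<Longrightarrow> assoc_distribution N a (fourier \<psi>) = (LINT x|lborel. G x * \<psi> x)"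
    using assms by (auto simp: dist_fourier_is_def tempered_function_def dist_fourier_def function_distribution_def)
  have [measurable]: "G \<in> borel_measurable borel" using Gt by simp
  have sg: "schwartz (gauss c z)" if "c > 0" for c z using schwartz_gauss[OF that, of 1 z] by simp
  have ig: "integrable lborel (\<lambda>\<xi>. norm (- \<xi>) ^ k * cmod (gauss c z \<xi>))" if "c > 0" for c z k
    using integrable_norm[OF integrable_norm_power_gauss[OF that, of z k]] by (simp add: norm_mult norm_power mult.commute)
  let ?a = "\<lambda>\<beta>. cnj (a \<beta>)"
  have i2: "integrable lborel (\<lambda>x. gauss c z x * symbol N ?a (- x))" if "c > 0" for c z
    by (rule integrable_times_symbol) (use ig[OF that] in auto)
  have as: "assoc_distribution N a (fourier (gauss c z)) = (LINT \<xi>|lborel. gauss c z \<xi> * symbol N ?a (- \<xi>))" if c: "c > 0" for c z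
  proof -
    have f: "fourier (gauss c z) = osc_integral lborel (\<lambda>\<xi>. - \<xi>) (gauss c z)"
      by (simp add: fun_eq_iff fourier_def osc_integral_def inner_commute)
    have "assoc_distribution N a (fourier (gauss c z)) = diff_op N ?a (fourier (gauss c z)) 0"
      unfolding assoc_distribution_def diff_op_def dist_deriv_def dirac_def
      by (intro sum.cong refl) (simp add: power_mult_distrib[symmetric])
    also have "\<dots> = osc_integral lborel (\<lambda>\<xi>. - \<xi>) (\<lambda>\<xi>. gauss c z \<xi> * symbol N ?a (- \<xi>)) 0"
      unfolding f by (rule diff_op_osc_integral) (use ig[OF c] in auto)
    finally show ?thesis by (simp add: osc_integral_def)
  qed
  have "AE x in lborel. G x - symbol N ?a (- x) = 0"
  proof (rule gauss_unique)
    fix c :: real and z assume c: "c > 0"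
    show "integrable lborel (\<lambda>x. (G x - symbol N ?a (- x)) * gauss c z x)"
      using Bochner_Integration.integrable_diff[OF Gt(2)[OF sg[OF c, of z]] i2[OF c, of z]] by (simp add: algebra_simps)
  next
    fix c :: real and p :: "real^'a" assume c: "c > 0"
    let ?z = "\<chi> i. complex_of_real (p $ i)"
    have "(LINT x|lborel. (G x - symbol N ?a (- x)) * gauss c ?z x) = (LINT x|lborel. G x * gauss c ?z x) - (LINT x|lborel. gauss c ?z x * symbol N ?a (- x))"
      using Bochner_Integration.integral_diff[OF Gt(2)[OF sg[OF c, of ?z]] i2[OF c, of ?z]] by (simp add: algebra_simps)
    also have "\<dots> = 0" using eq[OF sg[OF c, of ?z]] as[OF c, of ?z] by simp
    finally show "(LINT x|lborel. (G x - symbol N ?a (- x)) * gauss c ?z x) = 0" .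
  qed measurable
  thus ?thesis by (simp add: cnj_symbol)
qed

subsection \<open>Integral tails\<close>

lemma ennreal_le_suminf: "(f n :: ennreal) \<le> (\<Sum>k. f k)"
  using sum_le_suminf[of f "{n}"] by simp

lemma dyadic_scale:
  assumes "(0::real) < r" "r \<le> x"
  obtains n :: nat where "2 ^ n * r \<le> x" "x < 2 ^ Suc n * r"
proof -
  obtain k where k: "x / r < 2 ^ k" using real_arch_pow[of 2 "x / r"] by auto
  define m where "m = (LEAST k. x / r < 2 ^ k)"
  have m: "x / r < 2 ^ m" unfolding m_def using k by (rule LeastI)
  have "m \<noteq> 0" using m assms by (intro notI) (auto simp: field_simps)
  then obtain n where n: "m = Suc n" by (cases m) auto
  have "\<not> x / r < 2 ^ n" using not_less_Least[of n "\<lambda>k. x / r < 2 ^ k"] n by (simp add: m_def)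
  thus ?thesis using that[of n] m n assms by (simp add: field_simps not_less)
qed

text \<open>Dyadic shells: on the n-th one the integrand is at most
  \<open>(2^n r) powr - (d + \<epsilon>)\<close> and the volume is at most a multiple of
  \<open>(2^(n+1) r)^d\<close>, so the contributions form a geometric series of ratio
  \<open>q = 2 powr - \<epsilon>\<close>.\<close>

lemma nn_integral_norm_powr_tail:
  assumes \<epsilon>: "\<epsilon> > 0"
  shows "\<exists>c\<ge>0. \<forall>r>0. (\<integral>\<^sup>+\<xi>. ennreal (norm \<xi> powr - (real CARD('n) + \<epsilon>)) * indicator {\<xi>. r \<le> norm \<xi>} \<xi> \<partial>(lborel :: (real ^ 'n::finite) measure))
      \<le> ennreal (c * r powr - \<epsilon>)"
proof -
  let ?d = "real CARD('n)"
  define V where "V = unit_ball_vol ?d"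
  define q where "q = 2 powr - \<epsilon>"
  have q: "0 < q" "q < 1" using \<epsilon> by (auto simp: q_def powr_less_one)
  have V: "V \<ge> 0" by (simp add: V_def)
  define c where "c = V * 2 powr ?d * (1 / (1 - q))"
  have "c \<ge> 0" using V q by (simp add: c_def)
  moreover have "(\<integral>\<^sup>+\<xi>. ennreal (norm \<xi> powr - (?d + \<epsilon>)) * indicator {\<xi>. r \<le> norm \<xi>} \<xi> \<partial>(lborel :: (real ^ 'n) measure))
      \<le> ennreal (c * r powr - \<epsilon>)" if r: "r > 0" for r
  proof -
    \<comment> \<open>Whole balls replace the shells, so that the volume formula for balls applies
      directly.\<close>
    let ?f = "\<lambda>n (\<xi>::real^'n). ennreal ((2 ^ n * r) powr - (?d + \<epsilon>)) * indicator (ball 0 (2 ^ Suc n * r)) \<xi>"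
    have "(\<integral>\<^sup>+\<xi>. ennreal (norm \<xi> powr - (?d + \<epsilon>)) * indicator {\<xi>. r \<le> norm \<xi>} \<xi> \<partial>(lborel :: (real ^ 'n) measure))
       \<le> (\<integral>\<^sup>+\<xi>. (\<Sum>n. ?f n \<xi>) \<partial>lborel)"
    proof (rule nn_integral_mono)
      fix \<xi> :: "real^'n"
      show "ennreal (norm \<xi> powr - (?d + \<epsilon>)) * indicator {\<xi>. r \<le> norm \<xi>} \<xi> \<le> (\<Sum>n. ?f n \<xi>)"
      proof (cases "r \<le> norm \<xi>")
        case True
        obtain n where n: "2 ^ n * r \<le> norm \<xi>" "norm \<xi> < 2 ^ Suc n * r" by (rule dyadic_scale[OF r True])
        have "ennreal (norm \<xi> powr - (?d + \<epsilon>)) \<le> ennreal ((2 ^ n * r) powr - (?d + \<epsilon>))"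
          using n r \<epsilon> by (intro ennreal_leI powr_mono2') auto
        also have "ennreal ((2 ^ n * r) powr - (?d + \<epsilon>)) = ?f n \<xi>"
        proof -
          have "\<xi> \<in> ball 0 (2 ^ Suc n * r)" using n(2) by (simp only: mem_ball_0)
          thus ?thesis by (simp only: indicator_simps mult_1_right)
        qed
        also have "?f n \<xi> \<le> (\<Sum>n. ?f n \<xi>)" by (rule ennreal_le_suminf[where f="\<lambda>n. ?f n \<xi>" and n=n])
        finally have "ennreal (norm \<xi> powr - (?d + \<epsilon>)) \<le> (\<Sum>n. ?f n \<xi>)" .
        thus ?thesis using True by (simp only: indicator_simps mem_Collect_eq mult_1_right)
      qed simp
    qed
    also have "\<dots> = (\<Sum>n. \<integral>\<^sup>+\<xi>. ?f n \<xi> \<partial>lborel)" 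
      by (rule nn_integral_suminf) (intro borel_measurable_times_ennreal borel_measurable_const borel_measurable_indicator, simp)
    also have "\<dots> = (\<Sum>n. ennreal (V * 2 powr ?d * r powr - \<epsilon> * q ^ n))"
    proof (intro suminf_cong)
      fix n
      have "(\<integral>\<^sup>+\<xi>. ?f n \<xi> \<partial>lborel) = ennreal ((2 ^ n * r) powr - (?d + \<epsilon>)) * emeasure lborel (ball (0::real^'n) (2 ^ Suc n * r))"
        by (subst nn_integral_cmult_indicator) auto
      also have "emeasure lborel (ball (0::real^'n) (2 ^ Suc n * r)) = ennreal (V * (2 ^ Suc n * r) ^ CARD('n))"
        using r by (subst emeasure_ball) (auto simp: V_def)
      also have "ennreal ((2 ^ n * r) powr - (?d + \<epsilon>)) * \<dots> = ennreal ((2 ^ n * r) powr - (?d + \<epsilon>) * (V * (2 ^ Suc n * r) ^ CARD('n)))"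
        using r V by (subst ennreal_mult) auto
      also have "(2 ^ n * r) powr - (?d + \<epsilon>) * (V * (2 ^ Suc n * r) ^ CARD('n)) = V * 2 powr ?d * r powr - \<epsilon> * q ^ n"
      proof -
        have "(2 ^ Suc n * r) ^ CARD('n) = 2 powr ?d * (2 ^ n * r) powr ?d"
          using r by (simp add: powr_realpow power_mult_distrib)
        hence "(2 ^ n * r) powr - (?d + \<epsilon>) * (V * (2 ^ Suc n * r) ^ CARD('n)) = V * 2 powr ?d * ((2 ^ n * r) powr - (?d + \<epsilon>) * (2 ^ n * r) powr ?d)"
          by simp
        also have "(2 ^ n * r) powr - (?d + \<epsilon>) * (2 ^ n * r) powr ?d = (2 ^ n * r) powr - \<epsilon>"
          by (simp add: powr_add[symmetric])
        also have "\<dots> = r powr - \<epsilon> * q ^ n"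
        proof -
          have "(2 ^ n * r) powr - \<epsilon> = (2 ^ n) powr - \<epsilon> * r powr - \<epsilon>" using r by (simp add: powr_mult)
          also have "((2::real) ^ n) powr - \<epsilon> = q ^ n"
            by (simp add: q_def powr_powr powr_realpow[symmetric] mult.commute flip: powr_numeral)
          finally show ?thesis by simp
        qed
        finally show ?thesis by simp
      qed
      finally show "(\<integral>\<^sup>+\<xi>. ?f n \<xi> \<partial>lborel) = ennreal (V * 2 powr ?d * r powr - \<epsilon> * q ^ n)" .
    qed
    also have "\<dots> = ennreal (\<Sum>n. V * 2 powr ?d * r powr - \<epsilon> * q ^ n)"
      using q V by (intro suminf_ennreal2 summable_mult summable_geometric) auto
    also have "(\<Sum>n. V * 2 powr ?d * r powr - \<epsilon> * q ^ n) = c * r powr - \<epsilon>"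
      using q by (subst suminf_mult) (auto simp: c_def suminf_geometric summable_geometric)
    finally show ?thesis .
  qed
  ultimately show ?thesis by blast
qed

lemma decay_tail:
  fixes F :: "real ^ 'n::finite \<Rightarrow> complex"
  assumes F: "integrable lborel F" and \<epsilon>: "\<epsilon> > 0"
    and O: "(\<lambda>\<xi>. cmod (F \<xi>)) \<in> O[at_infinity](\<lambda>\<xi>. norm \<xi> powr (- (real N + real CARD('n) + \<epsilon>)))"
  shows integrable_norm_power_decay: "k \<le> N \<Longrightarrow> integrable lborel (\<lambda>\<xi>. norm \<xi> ^ k * cmod (F \<xi>))"
    and tail_integral_bound: "\<exists>K\<ge>0. \<forall>r>0. (LINT \<xi>:{\<xi>. r \<le> norm \<xi>}|lborel. norm \<xi> ^ N * cmod (F \<xi>)) \<le> K * r powr - \<epsilon>"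
proof -
  let ?d = "real CARD('n)"
  let ?g = "\<lambda>r (\<xi>::real^'n). norm \<xi> powr - (?d + \<epsilon>) * indicator {\<xi>. r \<le> norm \<xi>} \<xi>"
  have [measurable]: "F \<in> borel_measurable borel" using F by auto
  obtain C where C: "C > 0" "\<forall>\<^sub>F \<xi> in at_infinity. norm (cmod (F \<xi>)) \<le> C * norm (norm \<xi> powr (- (real N + ?d + \<epsilon>)))"
    using O by (rule landau_o.bigE)
  then obtain R1 where R1: "\<And>\<xi>. norm \<xi> \<ge> R1 \<Longrightarrow> cmod (F \<xi>) \<le> C * norm \<xi> powr (- (real N + ?d + \<epsilon>))"
    by (auto simp: eventually_at_infinity)
  define R where "R = max 1 R1"
  have R: "R \<ge> 1" "R > 0" by (auto simp: R_def)
  have dec: "norm \<xi> ^ N * cmod (F \<xi>) \<le> C * norm \<xi> powr - (?d + \<epsilon>)" if "norm \<xi> \<ge> R" for \<xi>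
  proof -
    have p: "norm \<xi> > 0" using that R by linarith
    have "norm \<xi> ^ N * cmod (F \<xi>) \<le> norm \<xi> powr N * (C * norm \<xi> powr (- (real N + ?d + \<epsilon>)))"
      using R1[of \<xi>] that p by (intro mult_mono) (auto simp: R_def powr_realpow)
    also have "\<dots> = C * norm \<xi> powr (real N + (- (real N + ?d + \<epsilon>)))" by (simp only: powr_add) simp
    finally show ?thesis by (simp add: algebra_simps)
  qed
  obtain c where c: "c \<ge> 0" "\<And>r. r > 0 \<Longrightarrow> (\<integral>\<^sup>+\<xi>. ennreal (norm \<xi> powr - (?d + \<epsilon>)) * indicator {\<xi>. r \<le> norm \<xi>} \<xi> \<partial>(lborel :: (real ^ 'n) measure)) \<le> ennreal (c * r powr - \<epsilon>)"
    using nn_integral_norm_powr_tail[OF \<epsilon>, where 'n='n] by blast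
  have nn: "(\<integral>\<^sup>+\<xi>. ennreal (?g r \<xi>) \<partial>lborel) \<le> ennreal (c * r powr - \<epsilon>)" if "r > 0" for r
    using c(2)[OF that] by (simp add: ennreal_mult ennreal_indicator)
  have gi: "integrable lborel (?g r)" if "r > 0" for r
  proof (rule integrableI_bounded)
    show "(\<integral>\<^sup>+\<xi>. ennreal (norm (?g r \<xi>)) \<partial>lborel) < \<infinity>"
      using nn[OF that] by (auto simp: less_top[symmetric] top_unique)
  qed measurable
  have gle: "(LINT \<xi>|lborel. ?g r \<xi>) \<le> c * r powr - \<epsilon>" if "r > 0" for r
    using nn[OF that] c(1) by (subst integral_eq_nn_integral) (auto intro!: enn2real_leI)
  have iN: "integrable lborel (\<lambda>\<xi>. norm \<xi> ^ N * cmod (F \<xi>))"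
  proof (rule Bochner_Integration.integrable_bound)
    show "integrable lborel (\<lambda>\<xi>. R ^ N * cmod (F \<xi>) + C * ?g R \<xi>)"
      using F gi[of R] R by (intro Bochner_Integration.integrable_add integrable_mult_right) auto
    have "norm \<xi> ^ N * cmod (F \<xi>) \<le> R ^ N * cmod (F \<xi>) + C * ?g R \<xi>" for \<xi>
    proof (cases "norm \<xi> \<ge> R")
      case True 
      have "0 \<le> R ^ N * cmod (F \<xi>)" using R by simp
      thus ?thesis using dec[OF True] True by simp
    next
      case False
      hence "norm \<xi> ^ N * cmod (F \<xi>) \<le> R ^ N * cmod (F \<xi>)" by (intro mult_right_mono power_mono) auto
      thus ?thesis using False by simp
    qed
    thus "AE \<xi> in lborel. norm (norm \<xi> ^ N * cmod (F \<xi>)) \<le> norm (R ^ N * cmod (F \<xi>) + C * ?g R \<xi>)"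
      by (intro AE_I2) (auto simp: intro: order.trans[OF _ abs_ge_self])
  qed measurable
  show "integrable lborel (\<lambda>\<xi>. norm \<xi> ^ k * cmod (F \<xi>))" if "k \<le> N"
  proof (rule Bochner_Integration.integrable_bound)
    show "integrable lborel (\<lambda>\<xi>. cmod (F \<xi>) + norm \<xi> ^ N * cmod (F \<xi>))" using F iN by auto
    have "norm \<xi> ^ k * cmod (F \<xi>) \<le> cmod (F \<xi>) + norm \<xi> ^ N * cmod (F \<xi>)" for \<xi>
    proof -
      have "norm \<xi> ^ k \<le> 1 + norm \<xi> ^ N"
      proof (cases "norm \<xi> \<le> 1")
        case True
        thus ?thesis using power_le_one[of "norm \<xi>" k] zero_le_power[of "norm \<xi>" N] norm_ge_zero[of \<xi>] by linarith
      next
        case False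
        hence "norm \<xi> ^ k \<le> norm \<xi> ^ N" by (intro power_increasing[OF that]) simp
        thus ?thesis by linarith
      qed
      from mult_right_mono[OF this, of "cmod (F \<xi>)"] show ?thesis by (simp add: algebra_simps)
    qed
    thus "AE \<xi> in lborel. norm (norm \<xi> ^ k * cmod (F \<xi>)) \<le> norm (cmod (F \<xi>) + norm \<xi> ^ N * cmod (F \<xi>))"
      by (intro AE_I2) (auto intro: order.trans[OF _ abs_ge_self])
  qed measurable
  define T0 where "T0 = (LINT \<xi>|lborel. norm \<xi> ^ N * cmod (F \<xi>))"
  have T0: "T0 \<ge> 0" unfolding T0_def by (intro integral_nonneg_AE) simp
  \<comment> \<open>For \<open>r \<ge> R\<close> the decay of \<open>F\<close> gives the part
    \<open>C c\<close>. For smaller \<open>r\<close> the full integral \<open>T0\<close> is the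
    bound, because then \<open>R powr \<epsilon> * r powr - \<epsilon>\<close> is at least
    1.\<close>
  have "(LINT \<xi>:{\<xi>. r \<le> norm \<xi>}|lborel. norm \<xi> ^ N * cmod (F \<xi>)) \<le> (C * c + T0 * R powr \<epsilon>) * r powr - \<epsilon>" if r: "r > 0" for r
  proof (cases "r \<ge> R")
    case True
    have "(LINT \<xi>:{\<xi>. r \<le> norm \<xi>}|lborel. norm \<xi> ^ N * cmod (F \<xi>)) \<le> (LINT \<xi>|lborel. C * ?g r \<xi>)"
      unfolding set_lebesgue_integral_def
    proof (rule integral_mono_AE')
      show "integrable lborel (\<lambda>\<xi>. C * ?g r \<xi>)" using gi[OF r] by (rule integrable_mult_right)
      show "AE \<xi> in lborel. indicat_real {\<xi>. r \<le> norm \<xi>} \<xi> *\<^sub>R (norm \<xi> ^ N * cmod (F \<xi>)) \<le> C * ?g r \<xi>"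
        using dec True by (auto simp: indicator_def)
      show "AE \<xi> in lborel. 0 \<le> C * ?g r \<xi>" using C(1) by simp
    qed
    also have "\<dots> \<le> C * (c * r powr - \<epsilon>)" using gle[OF r] C(1) by simp
    also have "\<dots> \<le> (C * c + T0 * R powr \<epsilon>) * r powr - \<epsilon>" using T0 by (simp add: algebra_simps)
    finally show ?thesis .
  next
    case False
    have "(LINT \<xi>:{\<xi>. r \<le> norm \<xi>}|lborel. norm \<xi> ^ N * cmod (F \<xi>)) \<le> T0"
      unfolding set_lebesgue_integral_def T0_def
      by (rule integral_mono_AE'[OF iN]) (auto simp: indicator_def)
    also have "\<dots> \<le> T0 * (R powr \<epsilon> * r powr - \<epsilon>)"
    proof -
      have "r powr \<epsilon> \<le> R powr \<epsilon>" using False r \<epsilon> by (intro powr_mono2) auto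
      hence "1 \<le> R powr \<epsilon> * r powr - \<epsilon>" using r by (simp add: powr_minus field_simps)
      thus ?thesis using T0 mult_left_mono[of 1 "R powr \<epsilon> * r powr - \<epsilon>" T0] by simp
    qed
    also have "\<dots> \<le> (C * c + T0 * R powr \<epsilon>) * r powr - \<epsilon>" using C c(1) by (simp add: algebra_simps)
    finally show ?thesis .
  qed
  moreover have "C * c + T0 * R powr \<epsilon> \<ge> 0" using C c(1) T0 by simp
  ultimately show "\<exists>K\<ge>0. \<forall>r>0. (LINT \<xi>:{\<xi>. r \<le> norm \<xi>}|lborel. norm \<xi> ^ N * cmod (F \<xi>)) \<le> K * r powr - \<epsilon>"
    by blast
qed

subsection \<open>Growth of matrix powers\<close>

lemma norm_vector_smult_complex: "norm (c *s (v :: complex ^ 'n::finite)) = cmod c * norm v"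
  by (simp add: norm_vec_def norm_mult L2_set_right_distrib)

text \<open>Horner evaluation of the vector p(A) v. For the orbit of a single vector it suffices to
  annihilate that vector, so no polynomial in matrices is formed.\<close>

definition poly_act :: "complex ^ 'n ^ 'n \<Rightarrow> complex poly \<Rightarrow> complex ^ 'n \<Rightarrow> complex ^ 'n::finite" where
  "poly_act A p v = fold_coeffs (\<lambda>a w. a *s v + A *v w) p 0"

lemma poly_act_0 [simp]: "poly_act A 0 v = 0"
  by (simp add: poly_act_def)

lemma poly_act_pCons: "poly_act A (pCons a p) v = a *s v + A *v poly_act A p v"
proof (cases "p = 0 \<and> a = 0")
  case False
  thus ?thesis by (cases "p = 0") (simp_all add: poly_act_def)
qed simp

lemma poly_act_add: "poly_act A (p + q) v = poly_act A p v + poly_act A q v"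
proof (induction p q rule: poly_induct2)
  case (pCons a p b q)
  have "poly_act A (pCons a p + pCons b q) v = (a + b) *s v + A *v poly_act A (p + q) v"
    by (simp only: add_pCons poly_act_pCons)
  also have "\<dots> = (a *s v + A *v poly_act A p v) + (b *s v + A *v poly_act A q v)"
    by (simp only: pCons.IH matrix_vector_right_distrib vector_sadd_rdistrib ac_simps)
  finally show ?case by (simp only: poly_act_pCons)
qed simp

lemma poly_act_smult: "poly_act A (Polynomial.smult c p) v = c *s poly_act A p v"
proof (induction p)
  case (pCons a p)
  have "poly_act A (Polynomial.smult c (pCons a p)) v = (c * a) *s v + A *v poly_act A (Polynomial.smult c p) v"
    by (simp only: smult_pCons poly_act_pCons)
  also have "\<dots> = c *s (a *s v + A *v poly_act A p v)"
    by (simp only: pCons.IH vector_scalar_commute vector_smult_assoc vector_add_ldistrib)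
  finally show ?case by (simp only: poly_act_pCons)
qed simp

lemma poly_act_sum: "poly_act A (\<Sum>k\<in>S. f k) v = (\<Sum>k\<in>S. poly_act A (f k) v)"
  by (induction S rule: infinite_finite_induct) (simp_all add: poly_act_add)

lemma poly_act_monom: "poly_act A (monom c k) v = c *s ((*v) A ^^ k) v"
proof (induction k)
  case (Suc k)
  thus ?case by (simp add: monom_Suc poly_act_pCons vector_scalar_commute)
qed (simp add: monom_0 poly_act_pCons)

text \<open>The linear factor commutes with q(A) and may act on the vector first. If the product
  annihilates \<open>v\<close>, then \<open>q\<close>, of smaller degree, annihilates
  \<open>A v - \<mu> v\<close>.\<close>

lemma poly_act_linear_factor:
  "poly_act A ([:- \<mu>, 1:] * q) v = poly_act A q (A *v v - \<mu> *s v)"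
proof -
  have "poly_act A ([:- \<mu>, 1:] * q) v = A *v poly_act A q v - \<mu> *s poly_act A q v"
  proof -
    have "[:- \<mu>, 1:] * q = pCons 0 q + Polynomial.smult (- \<mu>) q" by simp
    thus ?thesis by (simp only: poly_act_add poly_act_smult poly_act_pCons) (simp add: vector_smult_lneg)
  qed
  also have "\<dots> = poly_act A q (A *v v - \<mu> *s v)"
  proof (induction q)
    case (pCons a q)
    let ?w = "A *v v - \<mu> *s v"
    have "A *v (a *s v + A *v poly_act A q v) - \<mu> *s (a *s v + A *v poly_act A q v)
        = a *s ?w + A *v (A *v poly_act A q v - \<mu> *s poly_act A q v)"
      by (simp add: matrix_vector_right_distrib matrix_vector_mult_diff_distrib vector_scalar_commute
          vector_add_ldistrib vector_ssub_ldistrib vector_smult_assoc mult.commute)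
    thus ?case by (simp only: poly_act_pCons pCons.IH)
  qed simp
  finally show ?thesis .
qed

text \<open>In dimension \<open>d\<close>, the first \<open>d + 1\<close> iterates of
  \<open>v\<close> are linearly dependent.\<close>

lemma annihilating_poly:
  fixes A :: "complex ^ 'n::finite ^ 'n"
  shows "\<exists>p. p \<noteq> 0 \<and> poly_act A p v = 0"
proof -
  let ?T = "\<lambda>k. ((*v) A ^^ k) v"
  let ?K = "{..CARD('n)}"
  show ?thesis
  \<comment> \<open>The dimension count speaks of the set of iterates. Two equal iterates would make
    that set too small, so they are treated apart, by a difference of monomials.\<close>
  proof (cases "inj_on ?T ?K")
    case False
    then obtain i j where ij: "i \<noteq> j" "?T i = ?T j" by (auto simp: inj_on_def)
    have "coeff (monom (1::complex) i + monom (- 1) j) i = 1" using ij by simp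
    hence "monom (1::complex) i + monom (- 1) j \<noteq> 0" by (metis coeff_0 zero_neq_one)
    moreover have "poly_act A (monom 1 i + monom (- 1) j) v = 0"
      using ij by (simp add: poly_act_add poly_act_monom vector_smult_lneg)
    ultimately show ?thesis by blast
  next
    case True
    have fin: "finite (?T ` ?K)" by simp
    have "card (?T ` ?K) > CARD('n)" using True by (simp add: card_image)
    moreover have "vec.dim (?T ` ?K) \<le> CARD('n)" using vec.dim_subset_UNIV[of "?T ` ?K"] by (simp add: vec.dimension_def card_cart_basis)
    ultimately have "vec.dependent (?T ` ?K)"
      by (intro vec.dependent_biggerset_general) linarith
    then obtain u w where u: "w \<in> ?T ` ?K" "u w \<noteq> 0" "(\<Sum>x\<in>?T ` ?K. u x *s x) = 0"
      by (auto simp: vec.dependent_finite[OF fin])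
    define p where "p = (\<Sum>k\<in>?K. monom (u (?T k)) k)"
    obtain k where k: "k \<in> ?K" "w = ?T k" using u by auto
    have "coeff p k = (\<Sum>i\<in>?K. if i = k then u (?T i) else 0)"
      by (simp add: p_def coeff_sum)
    also have "\<dots> = u w" using k by (simp add: sum.delta)
    finally have "p \<noteq> 0" using u(2) by auto
    moreover have "poly_act A p v = (\<Sum>k\<in>?K. u (?T k) *s ?T k)"
      by (simp add: p_def poly_act_sum poly_act_monom)
    moreover have "\<dots> = (\<Sum>x\<in>?T ` ?K. u x *s x)" by (simp add: sum.reindex[OF True])
    ultimately show ?thesis using u(3) by auto
  qed
qed

text \<open>
  The vector \<open>v\<close> is annihilated by a polynomial in \<open>A\<close>, and a root \<open>\<mu>\<close> is split off at a time: the orbit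
  of \<open>w = A v - \<mu> v\<close> is bounded by induction. If \<open>\<mu>\<close> is an eigenvalue, the orbit of \<open>v\<close> satisfies a
  recursion with factor \<open>\<theta> / |\<mu>| < 1\<close> driven by that of \<open>w\<close>; otherwise \<open>A - \<mu>\<close> is invertible.
\<close>

lemma inverse_orbit_bounded:
  fixes A B :: "complex ^ 'n::finite ^ 'n"
  assumes AB: "A ** B = mat 1" and BA: "B ** A = mat 1" and \<theta>: "\<theta> > 0"
    and ev: "\<And>\<mu> v. v \<noteq> 0 \<Longrightarrow> A *v v = \<mu> *s v \<Longrightarrow> \<theta> < cmod \<mu>"
  shows "\<exists>K. \<forall>j. norm (((*v) B ^^ j) v) * \<theta> ^ j \<le> K"
proof -
  let ?B = "\<lambda>j. (*v) B ^^ j"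
  have Bdiff: "?B j (x - y) = ?B j x - ?B j y" for j x y
    by (induction j) (simp_all add: matrix_vector_mult_diff_distrib)
  have Bsc: "?B j (c *s x) = c *s ?B j x" for j c x
    by (induction j) (simp_all add: vector_scalar_commute)
  have BA': "B *v (A *v x) = x" "A *v (B *v x) = x" for x
    by (simp_all add: matrix_vector_mul_assoc AB BA)
  \<comment> \<open>One inverse step cancels \<open>A\<close>. This is what makes the orbit of
    \<open>w\<close> a two-term expression in consecutive members of the orbit of
    \<open>v\<close>.\<close>
  have BSA: "?B (Suc j) (A *v x) = ?B j x" for j x
    by (simp only: funpow_Suc_right o_apply BA')
  have BA'': "?B j (A *v x) = A *v ?B j x" for j x
  proof (cases j)
    case (Suc i)
    thus ?thesis using BSA[of i x] BA'(2)[of "?B i x"] by simp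
  qed simp
  have main: "\<exists>K. \<forall>j. norm (?B j v) * \<theta> ^ j \<le> K" if "p \<noteq> 0" "poly_act A p v = 0" for p v
    using that
  proof (induction "degree p" arbitrary: p v)
    case 0
    then obtain a where a: "p = [:a:]" "a \<noteq> 0" by (metis degree_eq_zeroE pCons_0_0)
    hence "v = 0" using 0 by (simp add: poly_act_pCons)
    have "?B j v = 0" for j by (induction j) (simp_all add: \<open>v = 0\<close>)
    thus ?case by auto
  next
    case (Suc n)
    obtain \<mu> where "poly p \<mu> = 0"
      using fundamental_theorem_of_algebra[of p] Suc(2) by (metis constant_degree nat.simps(3))
    then obtain q where q: "p = [:- \<mu>, 1:] * q" by (metis poly_eq_0_iff_dvd dvdE)
    define w where "w = A *v v - \<mu> *s v"
    have "q \<noteq> 0" using q Suc.prems by auto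
    hence "n = degree q" using Suc(2) unfolding q by (subst (asm) degree_mult_eq) auto
    moreover have "poly_act A q w = 0" using Suc.prems(2) unfolding q by (simp only: poly_act_linear_factor w_def)
    ultimately obtain K where K: "\<And>j. norm (?B j w) * \<theta> ^ j \<le> K" using Suc(1) \<open>q \<noteq> 0\<close> by blast
    show ?case
    proof (cases "\<exists>x. x \<noteq> 0 \<and> A *v x = \<mu> *s x")
      case True
      hence \<mu>: "\<theta> < cmod \<mu>" using ev by blast
      have cm: "cmod \<mu> > 0" using \<mu> \<theta> by linarith
      define \<rho> where "\<rho> = \<theta> / cmod \<mu>"
      define L where "L = \<bar>K\<bar> / cmod \<mu>"
      have \<rho>: "0 < \<rho>" "\<rho> < 1" using \<mu> \<theta> less_trans[OF \<theta> \<mu>] by (simp_all add: \<rho>_def)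
      \<comment> \<open>At least the initial value and at least \<open>L / (1 - \<rho>)\<close>, the
        fixed point of the map sending \<open>t\<close> to \<open>\<rho> t + L\<close>; hence the
        recursion never exceeds \<open>X\<close>.\<close>
      define X where "X = max (norm v) (L / (1 - \<rho>))"
      have "norm (?B j v) * \<theta> ^ j \<le> X" for j
      proof (induction j)
        case (Suc j)
        have "?B (Suc j) w = ?B j v - \<mu> *s ?B (Suc j) v"
          by (simp only: w_def Bdiff Bsc BSA)
        hence "\<mu> *s ?B (Suc j) v = ?B j v - ?B (Suc j) w" by (simp only: algebra_simps)
        hence "cmod \<mu> * norm (?B (Suc j) v) \<le> norm (?B j v) + norm (?B (Suc j) w)"
          using norm_triangle_ineq4[of "?B j v" "?B (Suc j) w"] norm_vector_smult_complex[of \<mu> "?B (Suc j) v"] by metis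
        hence "cmod \<mu> * norm (?B (Suc j) v) * \<theta> ^ Suc j \<le> (norm (?B j v) + norm (?B (Suc j) w)) * \<theta> ^ Suc j"
          using \<theta> by (intro mult_right_mono) auto
        also have "\<dots> = \<theta> * (norm (?B j v) * \<theta> ^ j) + norm (?B (Suc j) w) * \<theta> ^ Suc j" by (simp add: algebra_simps)
        also have "\<dots> \<le> \<theta> * X + \<bar>K\<bar>" using Suc.IH \<theta> K[of "Suc j"] by (intro add_mono mult_left_mono) auto
        finally have "norm (?B (Suc j) v) * \<theta> ^ Suc j \<le> (\<theta> * X + \<bar>K\<bar>) / cmod \<mu>"
          using cm by (simp add: pos_le_divide_eq mult_ac)
        also have "\<dots> = \<rho> * X + L" by (simp add: \<rho>_def L_def add_divide_distrib)
        also have "\<dots> \<le> X"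
        proof -
          have "L / (1 - \<rho>) \<le> X" by (simp add: X_def)
          thus ?thesis using \<rho> by (simp add: divide_le_eq algebra_simps)
        qed
        finally show ?case .
      qed (simp add: X_def)
      thus ?thesis by blast
    next
      case False
      have M: "(A - (\<chi> i j. if i = j then \<mu> else 0)) *v x = A *v x - \<mu> *s x" for x
      proof -
        have "(\<chi> i j. if i = j then \<mu> else 0) *v x = \<mu> *s x"
          by (simp add: vec_eq_iff matrix_vector_mult_def if_distrib[of "\<lambda>a. a * _"] sum.delta cong: if_cong)
        thus ?thesis by (simp add: matrix_vector_mult_diff_rdistrib)
      qed
      \<comment> \<open>No eigenvector means a trivial kernel, hence a left inverse
        \<open>P\<close>, and \<open>P\<close> recovers the orbit of \<open>v\<close> from that of
        \<open>w\<close> term by term.\<close>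
      have "\<exists>P. P ** (A - (\<chi> i j. if i = j then \<mu> else 0)) = mat 1"
        by (subst matrix_left_invertible_ker) (use False in \<open>auto simp: M\<close>)
      then obtain P where P: "P ** (A - (\<chi> i j. if i = j then \<mu> else 0)) = mat 1" by blast
      have Pv: "P *v (A *v x - \<mu> *s x) = x" for x
        by (simp only: M[symmetric] matrix_vector_mul_assoc P matrix_vector_mul_lid)
      obtain D where D: "\<And>x. norm (P *v x) \<le> norm x * D"
        using bounded_linear.bounded[OF matrix_vector_mul_bounded_linear[of P]] by blast
      have "norm (?B j v) * \<theta> ^ j \<le> K * \<bar>D\<bar>" for j
      proof -
        have "?B j w = A *v ?B j v - \<mu> *s ?B j v" by (simp only: w_def Bdiff Bsc BA'')
        hence "norm (?B j v) = norm (P *v ?B j w)" by (simp add: Pv)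
        also have "\<dots> \<le> norm (?B j w) * D" by (rule D)
        also have "\<dots> \<le> norm (?B j w) * \<bar>D\<bar>" by (intro mult_left_mono) auto
        finally have "norm (?B j v) * \<theta> ^ j \<le> (norm (?B j w) * \<bar>D\<bar>) * \<theta> ^ j" using \<theta> by (intro mult_right_mono) auto
        also have "\<dots> = (norm (?B j w) * \<theta> ^ j) * \<bar>D\<bar>" by simp
        also have "\<dots> \<le> K * \<bar>D\<bar>" by (intro mult_right_mono K) auto
        finally show ?thesis .
      qed
      thus ?thesis by blast
    qed
  qed
  show ?thesis using annihilating_poly[of A v] main by blast
qed


section \<open>Integer powers of the dilation matrix and their norms\<close>

lemma
  fixes A B :: "real ^ 'n::finite ^ 'n"
  shows transpose_mat_pow: "transpose (((**) A ^^ k) (mat 1)) = ((**) (transpose A) ^^ k) (mat 1)"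
    and mat_pow_inverse: "A ** B = mat 1 \<Longrightarrow> ((**) A ^^ k) (mat 1) ** ((**) B ^^ k) (mat 1) = mat 1"
proof -
  have c: "((**) A ^^ k) (mat 1) ** A = A ** ((**) A ^^ k) (mat 1)" for A :: "real ^ 'n ^ 'n" and k
    by (induction k) (simp_all flip: matrix_mul_assoc)
  show "transpose (((**) A ^^ k) (mat 1)) = ((**) (transpose A) ^^ k) (mat 1)"
    by (induction k) (simp_all add: matrix_transpose_mul c)
  show "((**) A ^^ k) (mat 1) ** ((**) B ^^ k) (mat 1) = mat 1" if "A ** B = mat 1"
  proof (induction k)
    case (Suc k)
    have "((**) A ^^ Suc k) (mat 1) ** ((**) B ^^ Suc k) (mat 1) = (((**) A ^^ k) (mat 1) ** A) ** (B ** ((**) B ^^ k) (mat 1))"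
      by (simp add: c)
    also have "\<dots> = ((**) A ^^ k) (mat 1) ** (A ** B) ** ((**) B ^^ k) (mat 1)"
      by (simp only: matrix_mul_assoc)
    finally show ?case by (simp add: that Suc)
  qed simp
qed

text \<open>A real kernel vector would be an eigenvector for 0, whose modulus does not exceed
  1.\<close>

lemma dilation_matrix_invertible:
  assumes "dilation_matrix M"
  shows "invertible M"
proof (rule ccontr)
  assume "\<not> invertible M"
  then obtain x where x: "x \<noteq> 0" "M *v x = 0"
    by (auto simp: invertible_left_inverse matrix_left_invertible_ker)
  let ?v = "\<chi> i. complex_of_real (x $ i)"
  have "?v \<noteq> 0" using x(1) by (auto simp: vec_eq_iff)
  moreover have "map_matrix complex_of_real M *v ?v = 0 *s ?v"
  proof (simp add: vec_eq_iff, intro allI)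
    fix i
    have "(map_matrix complex_of_real M *v ?v) $ i = complex_of_real ((M *v x) $ i)"
      by (simp add: matrix_vector_mult_def)
    thus "(map_matrix complex_of_real M *v ?v) $ i = 0" by (simp add: x(2))
  qed
  ultimately have "eigenvalue_of M 0" unfolding eigenvalue_of_def by blast
  thus False using assms by (auto simp: dilation_matrix_def)
qed

lemma matrix_inv_works:
  assumes "invertible M"
  shows "M ** matrix_inv M = mat 1" "matrix_inv M ** M = mat 1"
proof -
  have "\<exists>A'. M ** A' = mat 1 \<and> A' ** M = mat 1" using assms by (simp add: invertible_def)
  from someI_ex[OF this] show "M ** matrix_inv M = mat 1" "matrix_inv M ** M = mat 1"
    by (simp_all add: matrix_inv_def)
qed

lemma
  fixes M :: "real ^ 'n::finite ^ 'n"
  assumes "invertible M"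
  shows mat_powi_minus_mult: "mat_powi M (- j) ** mat_powi M j = mat 1"
    and mat_powi_transpose: "mat_powi (transpose M) j = transpose (mat_powi M j)"
proof -
  let ?B = "matrix_inv M"
  have inv: "M ** ?B = mat 1" "?B ** M = mat 1" using assms by (auto simp: matrix_inv_works)
  have tinv: "matrix_inv (transpose M) = transpose ?B"
  proof -
    have t: "transpose M ** transpose ?B = mat 1" "transpose ?B ** transpose M = mat 1"
      by (simp_all add: inv flip: matrix_transpose_mul)
    hence "invertible (transpose M)" by (auto simp: invertible_def)
    from matrix_inv_works(2)[OF this] have "matrix_inv (transpose M) ** (transpose M ** transpose ?B) = transpose ?B"
      by (simp add: matrix_mul_assoc)
    thus ?thesis by (simp add: t)
  qed
  show "mat_powi M (- j) ** mat_powi M j = mat 1"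
  proof (cases "j \<ge> 0")
    case True
    thus ?thesis using mat_pow_inverse[OF inv(2), of "nat j"] by (cases "j = 0") (auto simp: mat_powi_def)
  next
    case False
    thus ?thesis using mat_pow_inverse[OF inv(1), of "nat (- j)"] by (auto simp: mat_powi_def)
  qed
  show "mat_powi (transpose M) j = transpose (mat_powi M j)"
    by (simp add: mat_powi_def transpose_mat_pow tinv)
qed

lemma map_matrix_mult:
  fixes A B :: "real ^ 'n::finite ^ 'n"
  shows "map_matrix complex_of_real (A ** B) = map_matrix complex_of_real A ** map_matrix complex_of_real B"
  by (simp add: vec_eq_iff matrix_matrix_mult_def)

lemma map_matrix_mat_1: "map_matrix complex_of_real (mat 1) = (mat 1 :: complex ^ 'n::finite ^ 'n)"
  by (simp add: vec_eq_iff mat_def)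

text \<open>The matrix is complexified because its eigenvalues are complex: the entries of the
  powers of the inverse are coordinates of orbits of unit vectors, which
  \<open>inverse_orbit_bounded\<close> controls. The lower bound \<open>J\<close> is inherent. As
  \<open>j\<close> tends to minus infinity the norm is at least the largest eigenvalue modulus to
  the power \<open>\<bar>j\<bar>\<close>, which outgrows every multiple of
  \<open>\<theta> powr (- j)\<close>.\<close>

lemma op_norm_mat_powi_le:
  fixes M :: "real ^ 'n::finite ^ 'n"
  assumes M: "invertible M" and \<theta>: "\<theta> > 0" and ev: "\<And>\<mu>. eigenvalue_of M \<mu> \<Longrightarrow> \<theta> < cmod \<mu>"
  shows "\<exists>K\<ge>0. \<forall>j\<ge>J. op_norm (mat_powi (transpose M) (- j)) \<le> K * \<theta> powr (- of_int j)"
proof -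
  let ?B = "matrix_inv M"
  let ?c = "map_matrix complex_of_real"
  have inv: "M ** ?B = mat 1" "?B ** M = mat 1" using M by (auto simp: matrix_inv_works)
  have cinv: "?c M ** ?c ?B = mat 1" "?c ?B ** ?c M = mat 1"
    by (simp_all only: map_matrix_mult[symmetric] inv map_matrix_mat_1)
  have "\<exists>K. \<forall>j. norm (((*v) (?c ?B) ^^ j) v) * \<theta> ^ j \<le> K" for v
    by (rule inverse_orbit_bounded[OF cinv \<theta>]) (use ev in \<open>auto simp: eigenvalue_of_def\<close>)
  then obtain K where K: "\<And>v j. norm (((*v) (?c ?B) ^^ j) v) * \<theta> ^ j \<le> K v" by metis
  define L where "L = (\<Sum>i\<in>UNIV. \<bar>K (axis i 1)\<bar>)"
  have ent: "\<bar>((**) ?B ^^ j) (mat 1) $ i $ k\<bar> * \<theta> ^ j \<le> L" for j i k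
  proof -
    have pw: "((*v) (?c ?B) ^^ j) v = ?c (((**) ?B ^^ j) (mat 1)) *v v" for v
      by (induction j) (simp_all add: map_matrix_mat_1 map_matrix_mult matrix_vector_mul_assoc)
    have "complex_of_real (((**) ?B ^^ j) (mat 1) $ i $ k) = (((*v) (?c ?B) ^^ j) (axis k 1)) $ i"
      by (simp add: pw matrix_vector_mult_def axis_def if_distrib sum.delta cong: if_cong)
    hence "\<bar>((**) ?B ^^ j) (mat 1) $ i $ k\<bar> \<le> norm (((*v) (?c ?B) ^^ j) (axis k 1))"
      using Finite_Cartesian_Product.norm_nth_le[of "((*v) (?c ?B) ^^ j) (axis k 1)" i] by (metis norm_of_real)
    hence "\<bar>((**) ?B ^^ j) (mat 1) $ i $ k\<bar> * \<theta> ^ j \<le> K (axis k 1)"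
      using K[of j "axis k 1"] \<theta> by (meson mult_right_mono order.trans zero_le_power less_imp_le)
    also have "\<dots> \<le> \<bar>K (axis k 1)\<bar>" by simp
    also have "\<dots> \<le> L" unfolding L_def by (rule member_le_sum) auto
    finally show ?thesis .
  qed
  let ?d = "real CARD('n)"
  let ?N = "\<lambda>j. op_norm (mat_powi (transpose M) (- j))"
  have nonneg: "?N j \<le> ?d * ?d * L * \<theta> powr (- of_int j)" if "j \<ge> 0" for j
  proof -
    have mp: "mat_powi M (- j) = ((**) ?B ^^ nat j) (mat 1)"
      using that by (cases "j = 0") (auto simp: mat_powi_def)
    \<comment> \<open>The factor \<open>d^2\<close> is the cost of bounding the operator norm by the
      entries.\<close>
    have "?N j \<le> ?d * ?d * (L / \<theta> ^ nat j)"
      unfolding op_norm_def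
    proof (rule onorm_le_matrix_component)
      fix i k
      show "\<bar>mat_powi (transpose M) (- j) $ i $ k\<bar> \<le> L / \<theta> ^ nat j"
      proof -
        have "mat_powi (transpose M) (- j) $ i $ k = ((**) ?B ^^ nat j) (mat 1) $ k $ i"
          by (simp only: mat_powi_transpose[OF M] mp) (simp add: transpose_def)
        thus ?thesis using ent[of "nat j" k i] \<theta> by (simp add: field_simps)
      qed
    qed
    also have "\<dots> = ?d * ?d * L * \<theta> powr (- of_int j)"
    proof -
      have "\<theta> powr (of_int j) = \<theta> ^ nat j" using that \<theta> powr_realpow[of \<theta> "nat j"] by simp
      thus ?thesis by (simp add: powr_minus divide_inverse)
    qed
    finally show ?thesis .
  qed
  \<comment> \<open>The finitely many negative exponents from \<open>J\<close> on are covered by the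
    sum of their ratios, which is empty when \<open>J \<ge> 0\<close>.\<close>
  define K1 where "K1 = (\<Sum>j\<in>{J..<0}. \<bar>?N j / \<theta> powr (- of_int j)\<bar>)"
  have neg: "?N j \<le> K1 * \<theta> powr (- of_int j)" if "J \<le> j" "j < 0" for j
  proof -
    have "?N j / \<theta> powr (- of_int j) \<le> \<bar>?N j / \<theta> powr (- of_int j)\<bar>" by (rule abs_ge_self)
    also have "\<dots> \<le> K1" unfolding K1_def by (rule member_le_sum) (use that in auto)
    finally show ?thesis using \<theta> by (simp add: pos_divide_le_eq)
  qed
  have L0: "L \<ge> 0" "K1 \<ge> 0" unfolding L_def K1_def by (auto intro!: sum_nonneg)
  show ?thesis
  proof (intro exI[of _ "?d * ?d * L + K1"] conjI allI impI)
    fix j assume "J \<le> j"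
    show "?N j \<le> (?d * ?d * L + K1) * \<theta> powr (- of_int j)"
    proof (cases "j \<ge> 0")
      case True
      have "0 \<le> K1 * \<theta> powr (- of_int j)" using L0 by simp
      thus ?thesis using nonneg[OF True] by (simp add: distrib_right)
    next
      case False
      have "0 \<le> ?d * ?d * L * \<theta> powr (- of_int j)" using L0 by simp
      thus ?thesis using neg[OF \<open>J \<le> j\<close>] False by (simp add: distrib_right)
    qed
  qed (use L0 in auto)
qed

subsection \<open>Integrated Dirichlet kernels\<close>

text \<open>Partial sums of the sawtooth series, with limit \<open>1/2 - frac x\<close> off the
  integers. Adding \<open>x\<close> gives an antiderivative of the Dirichlet kernel.\<close>

definition sin_sum :: "nat \<Rightarrow> real \<Rightarrow> real" where
  "sin_sum R x = (\<Sum>k=1..R. sin (2 * pi * real k * x) / (pi * real k))"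

lemma sin_sum_periodic: "sin_sum R (x + of_int l) = sin_sum R x"
proof -
  have "sin (2 * pi * real k * (x + of_int l)) = sin (2 * pi * real k * x)" for k
  proof -
    have "sin (2 * pi * real k * (x + of_int l)) = sin (2 * pi * real k * x + of_int (int k * l) * (2 * pi))"
      by (simp add: algebra_simps)
    also have "\<dots> = sin (2 * pi * real k * x)" using sin_int_2pin[of "int k * l"] cos_int_2pin[of "int k * l"]
      by (simp only: sin_add mult.commute[of "of_int (int k * l)"])
    finally show ?thesis .
  qed
  thus ?thesis by (simp add: sin_sum_def)
qed

lemma sin_sum_minus: "sin_sum R (- x) = - sin_sum R x"
  by (simp add: sin_sum_def sum_negf)

text \<open>Multiplication by \<open>sin (pi x)\<close> makes the cosine sum telescope.\<close>

lemma dirichlet_kernel_closed: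
  "(1 + 2 * (\<Sum>k=1..R. cos (2 * pi * real k * x))) * sin (pi * x) = sin ((2 * real R + 1) * pi * x)" for x :: real
proof (induction R)
  case (Suc R)
  have "2 * cos (2 * pi * real (Suc R) * x) * sin (pi * x) = sin ((2 * real (Suc R) + 1) * pi * x) - sin ((2 * real R + 1) * pi * x)"
  proof -
    have "(2 * real (Suc R) + 1) * pi * x = 2 * pi * real (Suc R) * x + pi * x"
      "(2 * real R + 1) * pi * x = 2 * pi * real (Suc R) * x - pi * x" by (simp_all add: algebra_simps)
    thus ?thesis by (simp only: sin_add sin_diff)
  qed
  thus ?case using Suc by (simp add: algebra_simps)
qed simp

text \<open>
  The error has derivative \<open>sin ((2R + 1) \<pi> t) / sin (\<pi> t)\<close>. Integrating it by parts leaves a remainder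
  whose derivative is dominated by that of \<open>1 / ((2R + 1) \<pi> sin (\<pi> t))\<close>.
\<close>

lemma sin_sum_error:
  assumes x: "0 < x" "x \<le> 1/2"
  shows "\<bar>sin_sum R x - (1/2 - x)\<bar> \<le> 2 / ((2 * real R + 1) * pi * sin (pi * x))"
proof -
  define m where "m = 2 * real R + 1"
  have m: "m > 0" by (simp add: m_def)
  \<comment> \<open>With the boundary term of the integration by parts added, the derivative of the
    error gains a factor \<open>1 / m\<close>, and a cosine is all that distinguishes it from the
    derivative of \<open>V\<close>.\<close>
  define W where "W t = sin_sum R t - (1/2 - t) + cos (m * pi * t) / (m * pi * sin (pi * t))" for t
  define V where "V t = 1 / (m * pi * sin (pi * t))" for t
  have sp: "sin (pi * t) > 0" if "0 < t" "t \<le> 1/2" for t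
    using that by (intro sin_gt_zero) (auto simp: field_simps)
  have cp: "cos (pi * t) \<ge> 0" if "0 < t" "t \<le> 1/2" for t
    using that by (intro cos_ge_zero) (auto simp: field_simps intro: order.trans[of _ 0])
  have dW: "(W has_real_derivative - cos (m * pi * t) * cos (pi * t) / (m * (sin (pi * t))\<^sup>2)) (at t)" if t: "0 < t" "t \<le> 1/2" for t
  proof -
    note s = sp[OF t]
    have d1: "(sin_sum R has_real_derivative (\<Sum>k=1..R. 2 * cos (2 * pi * real k * t))) (at t)"
      unfolding sin_sum_def by (auto intro!: derivative_eq_intros sum.cong)
    have "(W has_real_derivative ((\<Sum>k=1..R. 2 * cos (2 * pi * real k * t)) + 1 + 
        (- sin (m * pi * t) * (m * pi) * (m * pi * sin (pi * t)) - cos (m * pi * t) * (m * pi * (cos (pi * t) * pi))) / (m * pi * sin (pi * t))\<^sup>2)) (at t)"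
      unfolding W_def using s m by (auto intro!: derivative_eq_intros d1 simp: power2_eq_square)
    moreover have "(\<Sum>k=1..R. 2 * cos (2 * pi * real k * t)) + 1 = sin (m * pi * t) / sin (pi * t)"
      using dirichlet_kernel_closed[where R=R and x=t] s by (simp add: m_def field_simps sum_distrib_left)
    moreover have "sin (m * pi * t) / sin (pi * t) + (- sin (m * pi * t) * (m * pi) * (m * pi * sin (pi * t)) - cos (m * pi * t) * (m * pi * (cos (pi * t) * pi))) / (m * pi * sin (pi * t))\<^sup>2
        = - cos (m * pi * t) * cos (pi * t) / (m * (sin (pi * t))\<^sup>2)"
      using s m by (simp add: field_simps power2_eq_square)
    ultimately show ?thesis by simp
  qed
  have dV: "(V has_real_derivative - cos (pi * t) / (m * (sin (pi * t))\<^sup>2)) (at t)" if t: "0 < t" "t \<le> 1/2" for t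
  proof -
    note s = sp[OF t]
    have "(V has_real_derivative - (m * pi * (cos (pi * t) * pi)) / (m * pi * sin (pi * t))\<^sup>2) (at t)"
      unfolding V_def using s m by (auto intro!: derivative_eq_intros simp: power2_eq_square)
    moreover have "- (m * pi * (cos (pi * t) * pi)) / (m * pi * sin (pi * t))\<^sup>2 = - cos (pi * t) / (m * (sin (pi * t))\<^sup>2)"
      using s m by (simp add: field_simps power2_eq_square)
    ultimately show ?thesis by simp
  qed
  \<comment> \<open>The comparison is anchored at 1/2, where the sine sum, \<open>1/2 - t\<close>
    and, because \<open>m\<close> is an odd integer, the boundary term all vanish.\<close>
  have W0: "W (1/2) = 0"
  proof -
    have "sin (2 * pi * real k * (1/2)) = 0" for k by (simp add: mult.commute[of pi])
    moreover have "cos (m * pi * (1/2)) = 0"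
    proof -
      have "m * pi * (1/2) = real R * pi + pi/2" by (simp add: m_def field_simps)
      thus ?thesis by (simp only: cos_add) (simp add: mult.commute)
    qed
    ultimately show ?thesis by (simp add: W_def sin_sum_def)
  qed
  have mono1: "(W - V) x \<le> (W - V) (1/2)"
  proof (rule DERIV_nonneg_imp_nondecreasing[OF x(2)])
    fix t assume t: "x \<le> t" "t \<le> 1/2"
    have "- cos (m * pi * t) * cos (pi * t) / (m * (sin (pi * t))\<^sup>2) - - cos (pi * t) / (m * (sin (pi * t))\<^sup>2) = (1 - cos (m * pi * t)) * cos (pi * t) / (m * (sin (pi * t))\<^sup>2)"
      by (simp add: field_simps diff_divide_distrib[symmetric])
    also have "\<dots> \<ge> 0" using cp[of t] t x m by (intro divide_nonneg_nonneg mult_nonneg_nonneg) auto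
    finally show "\<exists>y. ((W - V) has_real_derivative y) (at t) \<and> 0 \<le> y"
      using DERIV_diff[OF dW[of t] dV[of t]] t x by (auto simp: fun_diff_def)
  qed
  have mono2: "(\<lambda>t. - (W t + V t)) x \<le> (\<lambda>t. - (W t + V t)) (1/2)"
  proof (rule DERIV_nonneg_imp_nondecreasing[OF x(2)])
    fix t assume t: "x \<le> t" "t \<le> 1/2"
    have "- (- cos (m * pi * t) * cos (pi * t) / (m * (sin (pi * t))\<^sup>2) + - cos (pi * t) / (m * (sin (pi * t))\<^sup>2)) = (1 + cos (m * pi * t)) * cos (pi * t) / (m * (sin (pi * t))\<^sup>2)"
      by (simp add: field_simps add_divide_distrib[symmetric])
    also have "\<dots> \<ge> 0" using cp[of t] t x m cos_ge_minus_one[of "m * pi * t"] by (intro divide_nonneg_nonneg mult_nonneg_nonneg) (simp_all only:, auto)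
    finally show "\<exists>y. ((\<lambda>t. - (W t + V t)) has_real_derivative y) (at t) \<and> 0 \<le> y"
      using DERIV_minus[OF DERIV_add[OF dW[of t] dV[of t]]] t x by auto
  qed
  have Vh: "V (1/2) \<ge> 0" using m by (simp add: V_def)
  have "\<bar>W x\<bar> \<le> V x" using mono1 mono2 W0 Vh by (simp add: fun_diff_def abs_le_iff)
  moreover have "\<bar>cos (m * pi * x) / (m * pi * sin (pi * x))\<bar> \<le> V x"
    using sp[OF x] m abs_cos_le_one[of "m * pi * x"] by (simp add: V_def abs_mult divide_right_mono)
  moreover have "sin_sum R x - (1/2 - x) = W x - cos (m * pi * x) / (m * pi * sin (pi * x))" by (simp add: W_def)
  \<comment> \<open>One \<open>V x\<close> bounds \<open>W x\<close>, the other bounds the boundary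
    term; hence the 2 in the estimate.\<close>
  ultimately have "\<bar>sin_sum R x - (1/2 - x)\<bar> \<le> V x + V x"
    by (metis abs_triangle_ineq4 add_mono order.trans)
  thus ?thesis by (simp add: V_def m_def add_divide_distrib[symmetric])
qed

text \<open>By concavity on \<open>[0, 1/2]\<close> the chord joining the end points lies below the
  sine.\<close>

lemma sin_ge_linear: "0 \<le> x \<Longrightarrow> x \<le> 1/2 \<Longrightarrow> 2 * x \<le> sin (pi * x)"
proof -
  assume x: "0 \<le> x" "x \<le> 1/2"
  have "convex_on {0..1/2} (\<lambda>x. - sin (pi * x))"
  proof (rule f''_ge0_imp_convex)
    fix x :: real assume x: "x \<in> {0..1/2}"
    show "((\<lambda>x. - sin (pi * x)) has_real_derivative - (pi * cos (pi * x))) (at x)"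
      by (auto intro!: derivative_eq_intros)
    show "((\<lambda>x. - (pi * cos (pi * x))) has_real_derivative pi * (pi * sin (pi * x))) (at x)"
      by (auto intro!: derivative_eq_intros)
    show "0 \<le> pi * (pi * sin (pi * x))" using x by (intro mult_nonneg_nonneg sin_ge_zero) auto
  qed auto
  from convex_onD[OF this, of "2 * x" 0 "1/2"] x show ?thesis by simp
qed

text \<open>The error bound degenerates at 0, so two regimes meet at \<open>1 / (2 R + 1)\<close>:
  up to it the sum is at most \<open>2 R x\<close> term by term, beyond it the error is at most 1/2.
  Thus the overshoot near the jump is bounded uniformly in \<open>R\<close>.\<close>

lemma sin_sum_bounded_half:
  assumes x: "0 < x" "x \<le> 1/2"
  shows "\<bar>sin_sum R x\<bar> \<le> 2"
proof (cases "x \<le> 1 / (2 * real R + 1)")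
  case True
  have "\<bar>sin_sum R x\<bar> \<le> (\<Sum>k=1..R. \<bar>sin (2 * pi * real k * x) / (pi * real k)\<bar>)"
    unfolding sin_sum_def by (rule sum_abs)
  also have "\<dots> \<le> (\<Sum>k=1..R. 2 * x)"
  proof (rule sum_mono)
    fix k assume k: "k \<in> {1..R}"
    have "\<bar>sin (2 * pi * real k * x)\<bar> \<le> 2 * pi * real k * x"
      using abs_sin_x_le_abs_x[of "2 * pi * real k * x"] x by simp
    thus "\<bar>sin (2 * pi * real k * x) / (pi * real k)\<bar> \<le> 2 * x"
      using k x by (simp add: abs_mult field_simps)
  qed
  also have "\<dots> = 2 * real R * x" by simp
  also have "\<dots> \<le> (2 * real R + 1) * x" using x by (simp add: algebra_simps)
  also have "\<dots> \<le> 1" using True by (simp add: field_simps)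
  finally show ?thesis by simp
next
  case False
  have s: "2 * x \<le> sin (pi * x)" by (rule sin_ge_linear) (use x in auto)
  have Rx: "(2 * real R + 1) * x \<ge> 1" using False by (simp add: field_simps)
  have "1 * (2 * 2) \<le> ((2 * real R + 1) * x) * (pi * 2)" using Rx pi_ge_two x by (intro mult_mono) auto
  also have "\<dots> = (2 * real R + 1) * pi * (2 * x)" by simp
  also have "\<dots> \<le> (2 * real R + 1) * pi * sin (pi * x)" using s by (intro mult_left_mono) auto
  finally have "2 / ((2 * real R + 1) * pi * sin (pi * x)) \<le> 2 / 4" by (intro divide_left_mono) auto
  thus ?thesis using sin_sum_error[OF x, of R] x by linarith
qed

lemma sin_sum_bounded: "\<bar>sin_sum R x\<bar> \<le> 2"
proof -
  define l where "l = round x"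
  define y where "y = x - of_int l"
  have y: "\<bar>y\<bar> \<le> 1/2" unfolding y_def l_def using of_int_round_abs_le[of x] by linarith
  have "sin_sum R x = sin_sum R y" using sin_sum_periodic[of R y l] by (simp add: y_def)
  moreover have "\<bar>sin_sum R y\<bar> \<le> 2"
  proof -
    consider "y = 0" | "y > 0" | "y < 0" by linarith
    thus ?thesis
    proof cases
      case 1 thus ?thesis by (simp add: sin_sum_def)
    next
      case 2 thus ?thesis using sin_sum_bounded_half[of y] y by simp
    next
      case 3 thus ?thesis using sin_sum_bounded_half[of "- y"] y by (simp add: sin_sum_minus)
    qed
  qed
  ultimately show ?thesis by simp
qed

lemma sin_sum_tendsto_half:
  assumes x: "0 < x" "x \<le> 1/2"
  shows "(\<lambda>R. sin_sum R x) \<longlonglongrightarrow> 1/2 - x"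
proof -
  have s: "sin (pi * x) > 0" using sin_ge_linear[of x] x by linarith
  have "(\<lambda>R. sin_sum R x - (1/2 - x)) \<longlonglongrightarrow> 0"
  proof (rule Lim_null_comparison)
    show "\<forall>\<^sub>F R in sequentially. norm (sin_sum R x - (1/2 - x)) \<le> 2 / ((2 * real R + 1) * pi * sin (pi * x))"
      using sin_sum_error[OF x] by (intro always_eventually allI) simp
    show "(\<lambda>R. 2 / ((2 * real R + 1) * pi * sin (pi * x))) \<longlonglongrightarrow> 0"
      using s by real_asymp
  qed
  thus ?thesis by (simp add: LIM_zero_iff)
qed

lemma sin_sum_tendsto:
  assumes "x \<notin> \<int>"
  shows "(\<lambda>R. sin_sum R x) \<longlonglongrightarrow> 1/2 - frac x"
proof -
  define y where "y = frac x"
  have y: "0 < y" "y < 1" using assms by (auto simp: y_def frac_lt_1 frac_gt_0_iff)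
  have eq: "sin_sum R x = sin_sum R y" for R
    using sin_sum_periodic[of R y "\<lfloor>x\<rfloor>"] by (simp add: y_def frac_def)
  show ?thesis
  proof (cases "y \<le> 1/2")
    case True thus ?thesis using sin_sum_tendsto_half[of y] y by (simp add: eq y_def)
  next
    case False
    have "(\<lambda>R. sin_sum R (1 - y)) \<longlonglongrightarrow> 1/2 - (1 - y)"
      using False y by (intro sin_sum_tendsto_half) auto
    moreover have "sin_sum R (1 - y) = - sin_sum R y" for R
      using sin_sum_periodic[of R "- y" 1] by (simp add: sin_sum_minus)
    ultimately have "(\<lambda>R. - sin_sum R y) \<longlonglongrightarrow> - (1/2 - y)" by (simp add: algebra_simps)
    hence "(\<lambda>R. sin_sum R y) \<longlonglongrightarrow> 1/2 - y" by (rule tendsto_minus_cancel)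
    thus ?thesis by (simp only: eq y_def)
  qed
qed

section \<open>The Dirichlet kernel and its integrals over intervals\<close>

definition dirichlet :: "nat \<Rightarrow> real \<Rightarrow> complex" where
  "dirichlet R t = (\<Sum>k\<in>{- int R..int R}. exp (2 * pi * \<i> * of_real (of_int k * t)))"

lemma dirichlet_cos: "dirichlet R t = of_real (1 + 2 * (\<Sum>k=1..R. cos (2 * pi * real k * t)))"
proof (induction R)
  case (Suc R)
  have "{- int (Suc R)..int (Suc R)} = insert (int (Suc R)) (insert (- int (Suc R)) {- int R..int R})" by auto
  hence "dirichlet (Suc R) t = exp (2 * pi * \<i> * of_real (real (Suc R) * t)) + (exp (2 * pi * \<i> * of_real (- real (Suc R) * t)) + dirichlet R t)"
    unfolding dirichlet_def by simp
  also have "exp (2 * pi * \<i> * of_real (real (Suc R) * t)) + (exp (2 * pi * \<i> * of_real (- real (Suc R) * t)) + dirichlet R t) = of_real (2 * cos (2 * pi * real (Suc R) * t)) + dirichlet R t"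
  proof -
    have c: "exp (2 * pi * \<i> * of_real s) = cis (2 * pi * s)" for s by (simp add: cis_conv_exp mult_ac)
    have "cis (2 * pi * s) + cis (2 * pi * (- s)) = of_real (2 * cos (2 * pi * s))" for s
      by (simp add: complex_eq_iff)
    moreover have "- real (Suc R) * t = - (real (Suc R) * t)" by (simp only: mult_minus_left)
    ultimately show ?thesis unfolding c by (simp only: mult.assoc flip: add.assoc)
  qed
  finally show ?case by (simp add: Suc algebra_simps)
qed (simp add: dirichlet_def)

lemma norm_dirichlet_le: "cmod (dirichlet R t) \<le> 2 * real R + 1"
  unfolding dirichlet_def by (rule order.trans[OF norm_sum]) (simp add: norm_exp_eq_Re)

lemma dirichlet_measurable [measurable]: "dirichlet R \<in> borel_measurable borel"
  unfolding dirichlet_def by measurable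

definition dirichlet_int :: "nat \<Rightarrow> real \<Rightarrow> real \<Rightarrow> real \<Rightarrow> real" where
  "dirichlet_int R s t \<eta> = (t - s) + sin_sum R (t - \<eta>) - sin_sum R (s - \<eta>)"

lemma integral_dirichlet:
  assumes "s \<le> t"
  shows "(LINT \<zeta>|lborel. indicator {s..t} \<zeta> *\<^sub>R dirichlet R (\<zeta> - \<eta>)) = of_real (dirichlet_int R s t \<eta>)"
proof -
  have "(LINT \<zeta>|lborel. indicator {s..t} \<zeta> *\<^sub>R dirichlet R (\<zeta> - \<eta>)) 
     = of_real (t + sin_sum R (t - \<eta>)) - of_real (s + sin_sum R (s - \<eta>))"
  proof (rule integral_FTC_atLeastAtMost[OF assms, where F="\<lambda>\<zeta>. complex_of_real (\<zeta> + sin_sum R (\<zeta> - \<eta>))"])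
    fix x
    have "((\<lambda>\<zeta>. \<zeta> + sin_sum R (\<zeta> - \<eta>)) has_real_derivative 1 + 2 * (\<Sum>k=1..R. cos (2 * pi * real k * (x - \<eta>)))) (at x within {s..t})"
      unfolding sin_sum_def by (auto intro!: derivative_eq_intros sum.cong simp: sum_distrib_left)
    from has_vector_derivative_of_real[OF this] show "((\<lambda>\<zeta>. complex_of_real (\<zeta> + sin_sum R (\<zeta> - \<eta>))) has_vector_derivative dirichlet R (x - \<eta>)) (at x within {s..t})"
      unfolding dirichlet_cos .
  next
    show "continuous_on {s..t} (\<lambda>\<zeta>. dirichlet R (\<zeta> - \<eta>))"
      unfolding dirichlet_def by (intro continuous_intros)
  qed
  thus ?thesis by (simp add: dirichlet_int_def)
qed

lemma dirichlet_int_bound: "\<bar>dirichlet_int R s t \<eta>\<bar> \<le> \<bar>t - s\<bar> + 4"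
  unfolding dirichlet_int_def using sin_sum_bounded[of R "t - \<eta>"] sin_sum_bounded[of R "s - \<eta>"] by linarith

text \<open>The linear terms cancel against the sawtooth limits and only jumps remain. For
  \<open>s \<le> t\<close> the limit is the number of integer translates of \<open>\<eta>\<close> in
  the interval, none of which is an end point.\<close>

lemma dirichlet_int_tendsto:
  assumes "t - \<eta> \<notin> \<int>" "s - \<eta> \<notin> \<int>"
  shows "(\<lambda>R. dirichlet_int R s t \<eta>) \<longlonglongrightarrow> of_int (\<lfloor>t - \<eta>\<rfloor> - \<lfloor>s - \<eta>\<rfloor>)"
proof -
  have "(\<lambda>R. dirichlet_int R s t \<eta>) \<longlonglongrightarrow> (t - s) + (1/2 - frac (t - \<eta>)) - (1/2 - frac (s - \<eta>))"
    unfolding dirichlet_int_def by (intro tendsto_intros sin_sum_tendsto assms)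
  thus ?thesis by (simp add: frac_def algebra_simps)
qed

text \<open>\<open>Z\<close> may be any finite set that contains the hits, so that one index set
  serves all positions of the left end point.\<close>

lemma card_floor_diff:
  assumes "s \<le> t" "finite Z" "\<And>l. s < \<eta> + of_int l \<Longrightarrow> \<eta> + of_int l \<le> t \<Longrightarrow> l \<in> Z"
  shows "(\<Sum>l\<in>Z. if s < \<eta> + of_int l \<and> \<eta> + of_int l \<le> t then 1 else (0::real)) = of_int (\<lfloor>t - \<eta>\<rfloor> - \<lfloor>s - \<eta>\<rfloor>)"
proof -
  have "(\<Sum>l\<in>Z. if s < \<eta> + of_int l \<and> \<eta> + of_int l \<le> t then 1 else (0::real)) = real (card {l\<in>Z. s < \<eta> + of_int l \<and> \<eta> + of_int l \<le> t})"
    using assms(2) by (simp add: sum.If_cases Int_def)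
  also have "{l\<in>Z. s < \<eta> + of_int l \<and> \<eta> + of_int l \<le> t} = {\<lfloor>s - \<eta>\<rfloor><..\<lfloor>t - \<eta>\<rfloor>}"
    using assms(3) by (auto simp: floor_less_iff le_floor_iff algebra_simps)
  also have "card \<dots> = nat (\<lfloor>t - \<eta>\<rfloor> - \<lfloor>s - \<eta>\<rfloor>)" by simp
  also have "real (nat (\<lfloor>t - \<eta>\<rfloor> - \<lfloor>s - \<eta>\<rfloor>)) = of_int (\<lfloor>t - \<eta>\<rfloor> - \<lfloor>s - \<eta>\<rfloor>)"
    using floor_mono[of "s - \<eta>" "t - \<eta>"] assms(1) by simp
  finally show ?thesis .
qed

subsection \<open>Representation of smooth functions on a box\<close>

lemma Ck_on_continuous: "Ck_on k S f \<Longrightarrow> continuous_on S f"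
  by (cases k) auto

lemma Ck_on_SucD:
  assumes "Ck_on (Suc k) S f"
  shows "\<exists>g. Ck_on k S g \<and> (\<forall>x\<in>S. ((\<lambda>t. f (x + t *\<^sub>R axis i 1)) has_vector_derivative g x) (at 0 within {t. x + t *\<^sub>R axis i 1 \<in> S}))"
  using assms unfolding Ck_on.simps by blast

lemma Ck_on_Suc_imp: "Ck_on (Suc k) S f \<Longrightarrow> Ck_on k S f"
proof (induction k arbitrary: f)
  case (Suc k)
  have "\<exists>g. Ck_on k S g \<and> (\<forall>x\<in>S. ((\<lambda>t. f (x + t *\<^sub>R axis i 1)) has_vector_derivative g x) (at 0 within {t. x + t *\<^sub>R axis i 1 \<in> S}))" for i
  proof -
    obtain g where "Ck_on (Suc k) S g" "\<And>x. x \<in> S \<Longrightarrow> ((\<lambda>t. f (x + t *\<^sub>R axis i 1)) has_vector_derivative g x) (at 0 within {t. x + t *\<^sub>R axis i 1 \<in> S})"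
      using Ck_on_SucD[OF Suc.prems, where i=i] by blast
    thus ?thesis using Suc.IH[of g] by blast
  qed
  thus ?case using Suc.prems by simp
qed simp

text \<open>The combination \<open>f + c g\<close> is the one that the product rule with a character
  produces.\<close>

lemma Ck_on_add_mult: "Ck_on k S f \<Longrightarrow> Ck_on k S g \<Longrightarrow> Ck_on k S (\<lambda>x. f x + c * g x)"
proof (induction k arbitrary: f g)
  case 0
  thus ?case by (auto intro!: continuous_intros)
next
  case (Suc k)
  have "\<exists>h. Ck_on k S h \<and> (\<forall>x\<in>S. ((\<lambda>t. f (x + t *\<^sub>R axis i 1) + c * g (x + t *\<^sub>R axis i 1)) has_vector_derivative h x) (at 0 within {t. x + t *\<^sub>R axis i 1 \<in> S}))" for i
  proof -
    obtain f' where f': "Ck_on k S f'" "\<And>x. x \<in> S \<Longrightarrow> ((\<lambda>t. f (x + t *\<^sub>R axis i 1)) has_vector_derivative f' x) (at 0 within {t. x + t *\<^sub>R axis i 1 \<in> S})"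
      using Ck_on_SucD[OF Suc.prems(1), where i=i] by blast
    obtain g' where g': "Ck_on k S g'" "\<And>x. x \<in> S \<Longrightarrow> ((\<lambda>t. g (x + t *\<^sub>R axis i 1)) has_vector_derivative g' x) (at 0 within {t. x + t *\<^sub>R axis i 1 \<in> S})"
      using Ck_on_SucD[OF Suc.prems(2), where i=i] by blast
    show ?thesis
      by (intro exI[of _ "\<lambda>x. f' x + c * g' x"] conjI ballI Suc.IH f' g' has_vector_derivative_add has_vector_derivative_mult_right)
  qed
  moreover have "continuous_on S (\<lambda>x. f x + c * g x)" using Suc.prems by (auto intro!: continuous_intros)
  ultimately show ?case by simp
qed

text \<open>Differentiating the character only contributes constants, so for every \<open>y\<close>
  the modulated function is as smooth on the box as \<open>\<theta>\<close> and has a representation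
  of its own.\<close>

lemma Ck_on_times_exp: "Ck_on k S f \<Longrightarrow> Ck_on k S (\<lambda>x. f x * exp (2 * pi * \<i> * of_real (y \<bullet> x)))"
proof (induction k arbitrary: f)
  case 0
  thus ?case by (auto intro!: continuous_intros)
next
  case (Suc k)
  let ?e = "\<lambda>x. exp (2 * pi * \<i> * of_real (y \<bullet> x))"
  have "\<exists>h. Ck_on k S h \<and> (\<forall>x\<in>S. ((\<lambda>t. f (x + t *\<^sub>R axis i 1) * ?e (x + t *\<^sub>R axis i 1)) has_vector_derivative h x) (at 0 within {t. x + t *\<^sub>R axis i 1 \<in> S}))" for i
  proof -
    obtain f' where f': "Ck_on k S f'" "\<And>x. x \<in> S \<Longrightarrow> ((\<lambda>t. f (x + t *\<^sub>R axis i 1)) has_vector_derivative f' x) (at 0 within {t. x + t *\<^sub>R axis i 1 \<in> S})"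
      using Ck_on_SucD[OF Suc.prems(1), where i=i] by blast
    let ?c = "2 * pi * \<i> * of_real (y $ i)"
    have e: "((\<lambda>t. ?e (x + t *\<^sub>R axis i 1)) has_vector_derivative ?c * ?e x) (at 0 within T)" for x T
    proof -
      have eq: "?e (x + t *\<^sub>R axis i 1) = ?e x * exp (?c * of_real t)" for t
        by (simp add: inner_add_right inner_axis exp_add[symmetric] algebra_simps)
      have "((\<lambda>z. ?e x * exp (?c * z)) has_field_derivative ?c * ?e x) (at (of_real 0))"
        by (auto intro!: derivative_eq_intros)
      from has_vector_derivative_real_field[OF this] show ?thesis unfolding eq .
    qed
    have "Ck_on k S (\<lambda>x. (f' x + ?c * f x) * ?e x)"
      by (intro Suc.IH Ck_on_add_mult f' Ck_on_Suc_imp[OF Suc.prems])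
    moreover have "((\<lambda>t. f (x + t *\<^sub>R axis i 1) * ?e (x + t *\<^sub>R axis i 1)) has_vector_derivative (f' x + ?c * f x) * ?e x) (at 0 within {t. x + t *\<^sub>R axis i 1 \<in> S})" if "x \<in> S" for x
      using has_vector_derivative_mult[OF f'(2)[OF that] e[of x]] by (simp add: algebra_simps)
    ultimately show ?thesis by blast
  qed
  moreover have "continuous_on S (\<lambda>x. f x * ?e x)" using Ck_on_continuous[OF Suc.prems] by (auto intro!: continuous_intros)
  ultimately show ?case by simp
qed

section \<open>The fundamental theorem of calculus, one coordinate at a time\<close>

definition vec_upd :: "real ^ 'n \<Rightarrow> 'n \<Rightarrow> real \<Rightarrow> real ^ 'n::finite" where
  "vec_upd x i t = (\<chi> j. if j = i then t else x $ j)"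

lemma vec_upd_nth [simp]: "vec_upd x i t $ j = (if j = i then t else x $ j)"
  by (simp add: vec_upd_def)

lemma vec_upd_measurable [measurable]: 
  assumes "f \<in> borel_measurable M" "g \<in> borel_measurable M"
  shows "(\<lambda>x. vec_upd (f x) i (g x)) \<in> borel_measurable M"
proof -
  note [measurable] = assms
  have "(\<lambda>x. if j = i then g x else f x $ j) \<in> borel_measurable M" for j by (cases "j = i") simp_all
  thus ?thesis unfolding vec_upd_def by (rule borel_measurable_vec_lambda)
qed

lemma FTC_coordinate:
  fixes f :: "real ^ 'n::finite \<Rightarrow> complex"
  assumes g: "\<And>x. x \<in> cbox a b \<Longrightarrow> ((\<lambda>t. f (x + t *\<^sub>R axis i 1)) has_vector_derivative g x) (at 0 within {t. x + t *\<^sub>R axis i 1 \<in> cbox a b})"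
    and cg: "continuous_on (cbox a b) g" and z: "z \<in> cbox a b"
  shows "(LINT t|lborel. indicator {a $ i..z $ i} t *\<^sub>R g (vec_upd z i t)) = f z - f (vec_upd z i (a $ i))"
    and "integrable lborel (\<lambda>t. indicator {a $ i..z $ i} t *\<^sub>R g (vec_upd z i t))"
proof -
  have zb: "a $ j \<le> z $ j" "z $ j \<le> b $ j" for j using z by (auto simp: mem_box_cart)
  have inb: "vec_upd z i t \<in> cbox a b" if "a $ i \<le> t" "t \<le> b $ i" for t
    using that zb by (simp add: mem_box_cart)
  have uz: "vec_upd z i (z $ i) = z" by (simp add: vec_eq_iff)
  have d: "((\<lambda>t. f (vec_upd z i t)) has_vector_derivative g (vec_upd z i t)) (at t within {a $ i..z $ i})" if t: "a $ i \<le> t" "t \<le> z $ i" for t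
  proof -
    have sh: "vec_upd z i t + s *\<^sub>R axis i 1 = vec_upd z i (t + s)" for s
      by (simp add: vec_eq_iff axis_def)
    have tb: "vec_upd z i t \<in> cbox a b" by (rule inb) (use t zb[of i] in auto)
    have "((\<lambda>s. f (vec_upd z i (t + s))) has_vector_derivative g (vec_upd z i t)) (at 0 within {s. vec_upd z i (t + s) \<in> cbox a b})"
      using g[OF tb] unfolding sh .
    \<comment> \<open>The coordinate line stays in the box over \<open>[a_i, z_i]\<close>, so a
      derivative within the box restricts to one within this interval, including its ends.\<close>
    hence "((\<lambda>s. f (vec_upd z i (t + s))) has_vector_derivative g (vec_upd z i t)) (at 0 within (\<lambda>\<tau>. \<tau> - t) ` {a $ i..z $ i})"
    proof (rule has_vector_derivative_within_subset)
      show "(\<lambda>\<tau>. \<tau> - t) ` {a $ i..z $ i} \<subseteq> {s. vec_upd z i (t + s) \<in> cbox a b}"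
        using zb(2)[of i] by (auto intro!: inb)
    qed
    moreover have "((\<lambda>\<tau>. \<tau> - t) has_vector_derivative 1) (at t within {a $ i..z $ i})"
      by (auto intro!: derivative_eq_intros)
    ultimately show ?thesis
      using vector_diff_chain_within[of "\<lambda>\<tau>. \<tau> - t" 1 t "{a $ i..z $ i}" "\<lambda>s. f (vec_upd z i (t + s))" "g (vec_upd z i t)"] by (simp add: o_def)
  qed
  have cu: "continuous_on {a $ i..z $ i} (\<lambda>t. g (vec_upd z i t))"
  proof (rule continuous_on_compose2[OF cg])
    show "continuous_on {a $ i..z $ i} (vec_upd z i)"
    proof -
      have "continuous_on {a $ i..z $ i} (\<lambda>t. if j = i then t else z $ j)" for j
        by (cases "j = i") simp_all
      thus ?thesis unfolding vec_upd_def by (rule continuous_on_vec_lambda)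
    qed
    show "vec_upd z i ` {a $ i..z $ i} \<subseteq> cbox a b" using zb(2)[of i] by (auto intro!: inb)
  qed
  show "(LINT t|lborel. indicator {a $ i..z $ i} t *\<^sub>R g (vec_upd z i t)) = f z - f (vec_upd z i (a $ i))"
    using integral_FTC_atLeastAtMost[OF zb(1)[of i] d cu] by (simp add: uz)
  show "integrable lborel (\<lambda>t. indicator {a $ i..z $ i} t *\<^sub>R g (vec_upd z i t))"
    using borel_integrable_atLeastAtMost'[OF cu] by (simp add: set_integrable_def)
qed

text \<open>A state of the induction over coordinates: those in \<open>E\<close> have already been
  replaced by integration variables, the others still belong to the point.\<close>

definition glue :: "'n set \<Rightarrow> ('n \<Rightarrow> real) \<Rightarrow> real ^ 'n \<Rightarrow> real ^ 'n::finite" where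
  "glue E w z = (\<chi> i. if i \<in> E then w i else z $ i)"

lemma glue_measurable [measurable]:
  "(\<lambda>w. glue E w z) \<in> measurable (PiM E (\<lambda>_. lborel)) borel"
proof -
  have "(\<lambda>w. if j \<in> E then w j else z $ j) \<in> borel_measurable (PiM E (\<lambda>_. lborel :: real measure))" for j
    by (cases "j \<in> E") simp_all
  thus ?thesis unfolding glue_def by (rule borel_measurable_vec_lambda)
qed

text \<open>
  The fundamental theorem of calculus in each coordinate, \<open>v z = v a + \<integral>\<^sub>a\<^sup>z v'\<close>, where the boundary term
  is written as an integral over the extra interval \<open>[a - 1, a]\<close>. Thus a single Lebesgue integral
  replaces the sum over all faces of the box.
\<close>

lemma box_representation_aux:
  fixes a b :: "real ^ 'n::finite" and E :: "'n set"
  assumes "Ck_on (card E) (cbox a b) v"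
  shows "\<exists>c B. c \<in> borel_measurable borel \<and> (\<forall>x. cmod (c x) \<le> B) \<and>
    (\<forall>z\<in>cbox a b. v z = (LINT w|PiM E (\<lambda>_. lborel). (\<Prod>i\<in>E. indicator {a $ i - 1..z $ i} (w i)) *\<^sub>R c (glue E w z)))"
proof -
  have "finite E" by simp
  thus ?thesis using assms
  proof (induction E arbitrary: v rule: finite_induct)
    case empty
    have cv: "continuous_on (cbox a b) v" using empty by simp
    \<comment> \<open>The cut-off makes the density bounded and Borel measurable on the whole
      space.\<close>
    define c where "c x = indicat_real (cbox a b) x *\<^sub>R v x" for x
    have m: "c \<in> borel_measurable borel" unfolding c_def
      by (rule borel_measurable_continuous_on_indicator[OF _ cv]) simp
    have "compact (v ` cbox a b)" by (intro compact_continuous_image cv compact_cbox)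
    then obtain B where B: "\<And>x. x \<in> cbox a b \<Longrightarrow> cmod (v x) \<le> B"
      using compact_imp_bounded bounded_iff by (metis imageI)
    have "\<forall>x. cmod (c x) \<le> \<bar>B\<bar>"
      using order.trans[OF B abs_ge_self] by (auto simp: c_def indicator_def)
    moreover have "\<forall>z\<in>cbox a b. v z = (LINT w|PiM {} (\<lambda>_. lborel). (\<Prod>i\<in>{}. indicator {a $ i - 1..z $ i} (w i)) *\<^sub>R c (glue {} w z))"
    proof
      fix z assume z: "z \<in> cbox a b"
      have "glue {} w z = z" for w by (simp add: glue_def)
      thus "v z = (LINT w|PiM {} (\<lambda>_. lborel). (\<Prod>i\<in>{}. indicator {a $ i - 1..z $ i} (w i)) *\<^sub>R c (glue {} w z))"
        using z by (simp add: c_def PiM_empty lebesgue_integral_count_space_finite)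
    qed
    ultimately show ?case using m by blast
  next
    case (insert i E)
    interpret product_sigma_finite "\<lambda>_::'n. lborel :: real measure" by standard
    interpret E: sigma_finite_measure "PiM E (\<lambda>_::'n. lborel :: real measure)" by (rule sigma_finite) (rule insert)
    interpret pr: pair_sigma_finite "PiM E (\<lambda>_::'n. lborel :: real measure)" "lborel :: real measure" by standard
    \<comment> \<open>One derivative is spent on the coordinate \<open>i\<close>. Both
      \<open>v\<close> and its derivative \<open>g\<close> still have \<open>card E\<close> of them,
      so the induction hypothesis represents each of the two.\<close>
    have Cv: "Ck_on (Suc (card E)) (cbox a b) v" using insert by simp
    obtain g where g: "Ck_on (card E) (cbox a b) g" "\<And>x. x \<in> cbox a b \<Longrightarrow> ((\<lambda>t. v (x + t *\<^sub>R axis i 1)) has_vector_derivative g x) (at 0 within {t. x + t *\<^sub>R axis i 1 \<in> cbox a b})"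
      using Ck_on_SucD[OF Cv, where i=i] by blast
    obtain c0 B0 where c0 [measurable]: "c0 \<in> borel_measurable borel" and B0: "\<And>x. cmod (c0 x) \<le> B0"
      and r0: "\<And>z. z \<in> cbox a b \<Longrightarrow> v z = (LINT w|PiM E (\<lambda>_. lborel). (\<Prod>i\<in>E. indicator {a $ i - 1..z $ i} (w i)) *\<^sub>R c0 (glue E w z))"
      using insert.IH[OF Ck_on_Suc_imp[OF Cv]] by blast
    obtain c1 B1 where c1 [measurable]: "c1 \<in> borel_measurable borel" and B1: "\<And>x. cmod (c1 x) \<le> B1"
      and r1: "\<And>z. z \<in> cbox a b \<Longrightarrow> g z = (LINT w|PiM E (\<lambda>_. lborel). (\<Prod>i\<in>E. indicator {a $ i - 1..z $ i} (w i)) *\<^sub>R c1 (glue E w z))"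
      using insert.IH[OF g(1)] by blast
    \<comment> \<open>For \<open>x_i \<le> a_i\<close> this is the density of \<open>v\<close> on
      the face, constant in \<open>x_i\<close>; the added interval has length 1 and thus reproduces
      the boundary term with weight 1. Beyond the face it is the density of the derivative.\<close>
    define c where "c x = (if x $ i \<le> a $ i then c0 (vec_upd x i (a $ i)) else c1 x)" for x
    define B where "B = max B0 B1"
    have m [measurable]: "c \<in> borel_measurable borel" unfolding c_def by measurable
    have B: "cmod (c x) \<le> B" for x using B0[of "vec_upd x i (a $ i)"] B1[of x] by (auto simp: c_def B_def)
    have "v z = (LINT w|PiM (insert i E) (\<lambda>_. lborel). (\<Prod>i\<in>insert i E. indicator {a $ i - 1..z $ i} (w i)) *\<^sub>R c (glue (insert i E) w z))"
      if z: "z \<in> cbox a b" for z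
    proof -
      have zb: "a $ j \<le> z $ j" "z $ j \<le> b $ j" for j using z by (auto simp: mem_box_cart)
      let ?I = "\<lambda>w. (\<Prod>j\<in>E. indicat_real {a $ j - 1..z $ j} (w j))"
      let ?f = "\<lambda>w. (\<Prod>i\<in>insert i E. indicat_real {a $ i - 1..z $ i} (w i)) *\<^sub>R c (glue (insert i E) w z)"
      let ?h = "\<lambda>w t. indicat_real {a $ i - 1..z $ i} t *\<^sub>R ?I w *\<^sub>R c (vec_upd (glue E w z) i t)"
      have bi: "integrable lborel (indicat_real {a $ j - 1..z $ j})" for j
        by (rule integrable_real_indicator) (auto simp: emeasure_lborel_Icc_eq)
      have hb: "?f (w(i := t)) = ?h w t" for w t
      proof -
        have "glue (insert i E) (w(i := t)) z = vec_upd (glue E w z) i t" by (auto simp: vec_eq_iff glue_def)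
        moreover have "(\<Prod>j\<in>insert i E. indicat_real {a $ j - 1..z $ j} ((w(i := t)) j)) = indicat_real {a $ i - 1..z $ i} t * ?I w"
          using insert(1,2) by (subst prod.insert) (auto intro!: arg_cong2[where f="(*)"] prod.cong)
        ultimately show ?thesis by (simp only: scaleR_scaleR)
      qed
      have intf: "integrable (PiM (insert i E) (\<lambda>_. lborel)) ?f"
      proof (rule Bochner_Integration.integrable_bound)
        show "integrable (PiM (insert i E) (\<lambda>_. lborel)) (\<lambda>w. (\<Prod>i\<in>insert i E. indicat_real {a $ i - 1..z $ i} (w i)) * B)"
          using insert(1) by (intro integrable_mult_left product_integrable_prod bi) auto
        show "AE w in PiM (insert i E) (\<lambda>_. lborel). norm (?f w) \<le> norm ((\<Prod>i\<in>insert i E. indicat_real {a $ i - 1..z $ i} (w i)) * B)"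
          by (intro AE_I2) (auto simp: abs_mult intro!: mult_left_mono order.trans[OF B abs_ge_self])
      qed measurable
      have "(LINT w|PiM (insert i E) (\<lambda>_. lborel). ?f w) = (LINT w|PiM E (\<lambda>_. lborel). (LINT t|lborel. ?h w t))"
        by (subst product_integral_insert[OF insert(1,2) intf]) (simp only: hb)
      \<comment> \<open>With the new coordinate outermost, the inner integral for fixed
        \<open>t\<close> is a representation already known, either of \<open>v\<close> on the face
        or of \<open>g\<close>.\<close>
      also have "\<dots> = (LINT t|lborel. (LINT w|PiM E (\<lambda>_. lborel). ?h w t))"
      proof (rule pr.Fubini_integral[symmetric], rule pr.integrable_pair_bound)
        show "integrable (PiM E (\<lambda>_. lborel)) (\<lambda>w. ?I w * B)"
          using insert(1) by (intro integrable_mult_left product_integrable_prod bi) auto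
        show "integrable lborel (indicat_real {a $ i - 1..z $ i})" by (rule bi)
        show "(\<lambda>(w, t). ?h w t) \<in> borel_measurable (PiM E (\<lambda>_. lborel) \<Otimes>\<^sub>M lborel)" 
        proof -
          have [measurable]: "(\<lambda>p. glue E (fst p) z) \<in> borel_measurable (PiM E (\<lambda>_. lborel) \<Otimes>\<^sub>M (lborel :: real measure))"
            by (rule measurable_compose[OF measurable_fst glue_measurable])
          show ?thesis unfolding split_beta' by measurable
        qed
        fix w and t :: real
        show "norm (case (w, t) of (w, t) \<Rightarrow> ?h w t) \<le> ?I w * B * indicat_real {a $ i - 1..z $ i} t"
          using mult_left_mono[OF B, of "?I w" "vec_upd (glue E w z) i t"] by (auto simp: indicator_def[of "{a $ i - 1..z $ i}"] abs_prod prod_nonneg)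
      qed
      also have "\<dots> = (LINT t|lborel. indicat_real {a $ i - 1..a $ i} t *\<^sub>R v (vec_upd z i (a $ i)) + indicat_real {a $ i..z $ i} t *\<^sub>R g (vec_upd z i t))"
      proof (rule integral_cong_AE)
        have gl: "vec_upd (glue E w z) i t = glue E w (vec_upd z i t)" for w t using insert(2) by (auto simp: vec_eq_iff glue_def)
        have up: "vec_upd z i s \<in> cbox a b" if "a $ i \<le> s" "s \<le> z $ i" for s
        proof -
          have "a $ j \<le> (if j = i then s else z $ j) \<and> (if j = i then s else z $ j) \<le> b $ j" for j
            using that zb[of j] by auto
          thus ?thesis by (simp add: mem_box_cart)
        qed
        have Iu: "(\<Prod>j\<in>E. indicat_real {a $ j - 1..vec_upd z i s $ j} (w j)) = ?I w" for s w
          using insert(2) by (intro prod.cong) auto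
        have A1: "(LINT w|PiM E (\<lambda>_. lborel). ?h w t) = v (vec_upd z i (a $ i))" if t: "a $ i - 1 \<le> t" "t \<le> a $ i" for t
        proof -
          have "vec_upd (vec_upd (glue E w z) i t) i (a $ i) = glue E w (vec_upd z i (a $ i))" for w
            using insert(2) by (auto simp: vec_eq_iff glue_def)
          hence "?h w t = ?I w *\<^sub>R c0 (glue E w (vec_upd z i (a $ i)))" for w
            using t zb[of i] by (simp add: c_def)
          thus ?thesis using r0[OF up[of "a $ i"]] zb[of i] by (simp only: Iu)
        qed
        have A2: "(LINT w|PiM E (\<lambda>_. lborel). ?h w t) = g (vec_upd z i t)" if t: "a $ i < t" "t \<le> z $ i" for t
        proof -
          have "?h w t = ?I w *\<^sub>R c1 (vec_upd (glue E w z) i t)" for w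
            using t zb[of i] by (simp add: c_def)
          hence "?h w t = ?I w *\<^sub>R c1 (glue E w (vec_upd z i t))" for w
            by (simp only: gl)
          moreover have "vec_upd z i t \<in> cbox a b" using up t by simp
          ultimately show ?thesis using r1[of "vec_upd z i t"] by (simp only: Iu)
        qed
        have A3: "(LINT w|PiM E (\<lambda>_. lborel). ?h w t) = 0" if "t < a $ i - 1 \<or> t > z $ i" for t
          using that by (auto simp: indicator_def[of "{a $ i - 1..z $ i}"])
        \<comment> \<open>At \<open>t = a_i\<close> both intervals contribute, but a single point
          does not affect the integral.\<close>
        have "AE t in lborel. t \<noteq> a $ i" by (rule AE_lborel_singleton)
        thus "AE t in lborel. (LINT w|PiM E (\<lambda>_. lborel). ?h w t) = indicat_real {a $ i - 1..a $ i} t *\<^sub>R v (vec_upd z i (a $ i)) + indicat_real {a $ i..z $ i} t *\<^sub>R g (vec_upd z i t)"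
        proof eventually_elim
          case (elim t)
          consider "t < a $ i - 1 \<or> t > z $ i" | "a $ i - 1 \<le> t" "t < a $ i" | "a $ i < t" "t \<le> z $ i" using elim by linarith
          thus ?case
          proof cases
            case 1 thus ?thesis using A3[OF 1] zb[of i] by auto
          next
            case 2 thus ?thesis using A1[of t] zb[of i] by simp
          next
            case 3 thus ?thesis using A2[of t] zb[of i] by simp
          qed
        qed
        show "(\<lambda>t. LINT w|PiM E (\<lambda>_. lborel). ?h w t) \<in> borel_measurable lborel"
        proof -
          have [measurable]: "(\<lambda>p. glue E (snd p) z) \<in> borel_measurable ((lborel :: real measure) \<Otimes>\<^sub>M PiM E (\<lambda>_. lborel))"
            by (rule measurable_compose[OF measurable_snd glue_measurable])
          show ?thesis by (rule E.borel_measurable_lebesgue_integral) (unfold split_beta', measurable)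
        qed
        show "(\<lambda>t. indicat_real {a $ i - 1..a $ i} t *\<^sub>R v (vec_upd z i (a $ i)) + indicat_real {a $ i..z $ i} t *\<^sub>R g (vec_upd z i t)) \<in> borel_measurable lborel"
          using FTC_coordinate(2)[OF g(2) Ck_on_continuous[OF g(1)] z] by (intro borel_measurable_add) auto
      qed
      also have "\<dots> = v (vec_upd z i (a $ i)) + (v z - v (vec_upd z i (a $ i)))"
        using FTC_coordinate[OF g(2) Ck_on_continuous[OF g(1)] z]
        by (subst Bochner_Integration.integral_add) auto
      finally show ?thesis by simp
    qed
    thus ?case using m B by blast
  qed
qed

lemma box_representation:
  fixes a b :: "real ^ 'n::finite"
  assumes "Ck_on CARD('n) (cbox a b) v"
  obtains c B where "c \<in> borel_measurable borel" "\<And>x. cmod (c x) \<le> B"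
    "\<And>z. z \<in> cbox a b \<Longrightarrow> v z = (LINT w|lborel. (\<Prod>i\<in>UNIV. indicator {a $ i - 1..z $ i} (w $ i)) *\<^sub>R c w)"
proof -
  obtain c B where c [measurable]: "c \<in> borel_measurable borel" and B: "\<And>x. cmod (c x) \<le> B" and
    v: "\<And>z. z \<in> cbox a b \<Longrightarrow> v z = (LINT w|PiM UNIV (\<lambda>_. lborel). (\<Prod>i\<in>UNIV. indicator {a $ i - 1..z $ i} (w i)) *\<^sub>R c (glue UNIV w z))"
    using box_representation_aux[of UNIV a b v] assms by blast
  have "v z = (LINT w|lborel. (\<Prod>i\<in>UNIV. indicator {a $ i - 1..z $ i} (w $ i)) *\<^sub>R c w)" if "z \<in> cbox a b" for z
    by (subst integral_lborel_vec) (simp_all add: v[OF that] glue_def)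
  thus ?thesis using that c B by blast
qed

subsection \<open>Cubic Fourier partial sums\<close>

lemma bij_betw_vec_PiE:
  "bij_betw vec_lambda (PiE UNIV Z) {k :: 'b ^ 'n::finite. \<forall>i. k $ i \<in> Z i}"
  by (rule bij_betwI[where g="\<lambda>k i. k $ i"]) (auto simp: PiE_def Pi_def)

lemma prod_sum_vec:
  fixes f :: "'n::finite \<Rightarrow> 'b \<Rightarrow> 'c::comm_semiring_1"
  assumes "\<And>i. finite (Z i)"
  shows "(\<Prod>i\<in>UNIV. \<Sum>l\<in>Z i. f i l) = (\<Sum>k | \<forall>i. k $ i \<in> Z i. \<Prod>i\<in>UNIV. f i (k $ i))"
proof -
  have "(\<Prod>i\<in>UNIV. \<Sum>l\<in>Z i. f i l) = (\<Sum>g\<in>PiE UNIV Z. \<Prod>i\<in>UNIV. f i (g i))"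
    using assms by (intro prod_sum_PiE) auto
  also have "\<dots> = (\<Sum>k | \<forall>i. k $ i \<in> Z i. \<Prod>i\<in>UNIV. f i (k $ i))"
    using sum.reindex_bij_betw[OF bij_betw_vec_PiE, of "\<lambda>k. \<Prod>i\<in>UNIV. f i (k $ i)" Z] by simp
  finally show ?thesis .
qed

lemma finite_vec_Collect:
  assumes "\<And>i. finite (Z i)"
  shows "finite {k :: 'b ^ 'n::finite. \<forall>i. k $ i \<in> Z i}"
  using bij_betw_finite[OF bij_betw_vec_PiE[of Z]] finite_PiE[of UNIV Z] assms by simp

definition fourier_sum :: "(real ^ 'n::finite \<Rightarrow> complex) \<Rightarrow> nat \<Rightarrow> real ^ 'n \<Rightarrow> complex" where
  "fourier_sum u R \<eta> = (LINT \<zeta>|lborel. u \<zeta> * (\<Prod>i\<in>UNIV. dirichlet R (\<zeta> $ i - \<eta> $ i)))"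

text \<open>Summation over cubes is what makes the kernel a product of one-dimensional Dirichlet
  kernels, on which all later estimates rest.\<close>

lemma prod_dirichlet:
  "(\<Prod>i\<in>UNIV. dirichlet R (v $ i)) = (\<Sum>k | \<forall>i. \<bar>k $ i\<bar> \<le> int R. exp (2 * pi * \<i> * of_real (int_vec k \<bullet> v)))"
  for v :: "real ^ 'n::finite"
proof -
  have "(\<Prod>i\<in>UNIV. dirichlet R (v $ i)) = (\<Sum>k | \<forall>i. k $ i \<in> {- int R..int R}. \<Prod>i\<in>UNIV. exp (2 * pi * \<i> * of_real (of_int (k $ i) * v $ i)))"
    unfolding dirichlet_def by (rule prod_sum_vec) simp
  also have "{k :: int ^ 'n. \<forall>i. k $ i \<in> {- int R..int R}} = {k. \<forall>i. \<bar>k $ i\<bar> \<le> int R}"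
    by (auto simp: abs_le_iff) (metis minus_le_iff)+
  finally show ?thesis by (simp only: exp_inner_prod int_vec_def vec_lambda_beta)
qed

text \<open>The values at \<open>y + k\<close> are, up to the sign of \<open>k\<close>, the Fourier
  coefficients of the periodization of the modulated function. Their symmetric partial sum is
  therefore that function integrated against the Dirichlet kernel.\<close>

lemma inv_fourier_cubic_sum:
  assumes \<theta>: "integrable lborel \<theta>"
  shows "(\<Sum>k | \<forall>i. \<bar>k $ i\<bar> \<le> int R. inv_fourier \<theta> (y + int_vec k) * exp (2 * pi * \<i> * of_real (- int_vec k \<bullet> \<eta>)))
     = fourier_sum (\<lambda>\<zeta>. \<theta> \<zeta> * exp (2 * pi * \<i> * of_real (y \<bullet> \<zeta>))) R \<eta>"
proof -
  let ?e = "\<lambda>t::real. exp (2 * pi * \<i> * of_real t)"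
  have [measurable]: "\<theta> \<in> borel_measurable borel" using \<theta> by auto
  have i: "integrable lborel (\<lambda>\<zeta>. \<theta> \<zeta> * ?e ((y + int_vec k) \<bullet> \<zeta>))" for k
    by (rule Bochner_Integration.integrable_bound[OF \<theta>]) (auto simp: norm_mult norm_exp_2pi)
  have "(\<Sum>k | \<forall>i. \<bar>k $ i\<bar> \<le> int R. inv_fourier \<theta> (y + int_vec k) * ?e (- int_vec k \<bullet> \<eta>))
      = (LINT \<zeta>|lborel. (\<Sum>k | \<forall>i. \<bar>k $ i\<bar> \<le> int R. \<theta> \<zeta> * ?e ((y + int_vec k) \<bullet> \<zeta>) * ?e (- int_vec k \<bullet> \<eta>)))"
    unfolding inv_fourier_def integral_mult_left_zero[symmetric]
    by (rule Bochner_Integration.integral_sum[symmetric]) (intro integrable_mult_left i)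
  also have "\<dots> = fourier_sum (\<lambda>\<zeta>. \<theta> \<zeta> * ?e (y \<bullet> \<zeta>)) R \<eta>"
    unfolding fourier_sum_def
  proof (intro Bochner_Integration.integral_cong refl)
    fix \<zeta>
    have "(\<Prod>i\<in>UNIV. dirichlet R (\<zeta> $ i - \<eta> $ i)) = (\<Sum>k | \<forall>i. \<bar>k $ i\<bar> \<le> int R. ?e (int_vec k \<bullet> (\<zeta> - \<eta>)))"
      using prod_dirichlet[of R "\<zeta> - \<eta>"] by simp
    moreover have "\<theta> \<zeta> * ?e ((y + int_vec k) \<bullet> \<zeta>) * ?e (- int_vec k \<bullet> \<eta>) = \<theta> \<zeta> * ?e (y \<bullet> \<zeta>) * ?e (int_vec k \<bullet> (\<zeta> - \<eta>))" for k
      by (simp add: inner_add_left inner_diff_right exp_add[symmetric] algebra_simps)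
    ultimately show "(\<Sum>k | \<forall>i. \<bar>k $ i\<bar> \<le> int R. \<theta> \<zeta> * ?e ((y + int_vec k) \<bullet> \<zeta>) * ?e (- int_vec k \<bullet> \<eta>)) = \<theta> \<zeta> * ?e (y \<bullet> \<zeta>) * (\<Prod>i\<in>UNIV. dirichlet R (\<zeta> $ i - \<eta> $ i))"
      by (simp only: sum_distrib_left)
  qed
  finally show ?thesis .
qed

section \<open>Almost every point avoids the jumps\<close>

lemma AE_inner_neq: "r \<noteq> 0 \<Longrightarrow> AE x in lborel. r \<bullet> x \<noteq> (c::real)" for r :: "'a::euclidean_space"
proof -
  assume r: "r \<noteq> 0"
  have "negligible {x. r \<bullet> x = c}" using r by (intro negligible_hyperplane) simp
  moreover have "closed {x. r \<bullet> x = c}" by (rule closed_hyperplane)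
  ultimately have "{x. r \<bullet> x = c} \<in> null_sets lborel" 
    by (simp add: negligible_iff_null_sets null_sets_completion_iff)
  from AE_not_in[OF this] show ?thesis by simp
qed

lemma AE_inner_diff_not_Ints:
  fixes r :: "'a::euclidean_space"
  assumes "r \<noteq> 0"
  shows "AE x in lborel. c - r \<bullet> x \<notin> \<int>"
proof -
  have "AE x in lborel. \<forall>l::int. r \<bullet> x \<noteq> c - of_int l"
    using AE_inner_neq[OF assms] by (subst AE_all_countable) auto
  thus ?thesis
  proof eventually_elim
    case (elim x)
    show ?case
    proof
      assume "c - r \<bullet> x \<in> \<int>"
      then obtain l where "c - r \<bullet> x = of_int l" by (rule Ints_cases)
      thus False using elim[rule_format, of l] by simp
    qed
  qed
qed

text \<open>Read for fixed \<open>w\<close>, the kernel becomes the indicator of the interval from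
  \<open>max a w\<close> to \<open>b\<close> in the variable \<open>\<zeta>\<close>. This exchange
  of roles turns the representation into a superposition of indicators of boxes.\<close>

lemma indicator_swap:
  fixes a b :: real
  assumes "a \<le> b"
  shows "indicat_real {a - 1..\<zeta>} w * indicat_real {a..b} \<zeta> = indicat_real {a - 1..b} w * indicat_real {max a w..b} \<zeta>"
  using assms by (auto simp: indicator_def)

text \<open>Everything about the partial sums of \<open>u\<close> is derived from these data; the
  bounds involve only \<open>B\<close> and the box.\<close>

locale box_function =
  fixes a b :: "real ^ 'n::finite" and u :: "real ^ 'n \<Rightarrow> complex" and c :: "real ^ 'n \<Rightarrow> complex" and B :: real
  assumes ab: "\<And>i. a $ i \<le> b $ i"
    and zero: "\<And>z. z \<notin> cbox a b \<Longrightarrow> u z = 0"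
    and c_measurable [measurable]: "c \<in> borel_measurable borel"
    and c_bound: "\<And>x. cmod (c x) \<le> B"
    and rep: "\<And>z. z \<in> cbox a b \<Longrightarrow> u z = (LINT w|lborel. (\<Prod>i\<in>UNIV. indicator {a $ i - 1..z $ i} (w $ i)) *\<^sub>R c w)"
begin

definition box_weight :: "real ^ 'n \<Rightarrow> real" where
  "box_weight w = (\<Prod>i\<in>UNIV. indicator {a $ i - 1..b $ i} (w $ i))"

lemma box_weight_nonneg: "box_weight w \<ge> 0"
  by (simp add: box_weight_def prod_nonneg)

lemma box_weight_nonzeroD: "box_weight w \<noteq> 0 \<Longrightarrow> w $ i \<le> b $ i"
  by (auto simp: box_weight_def prod_zero_iff indicator_def split: if_splits)

lemma box_weight_measurable [measurable]: "box_weight \<in> borel_measurable borel"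
  unfolding box_weight_def by measurable

lemma integrable_indicator_prod: "integrable lborel (\<lambda>w::real^'n. \<Prod>i\<in>UNIV. indicat_real {p i..q i} (w $ i))"
proof -
  have "integrable lborel (\<lambda>w::real^'n. \<Prod>i\<in>UNIV. complex_of_real (indicat_real {p i..q i} (w $ i)))"
    by (intro integrable_prod_vec integrable_of_real integrable_real_indicator) (auto simp: emeasure_lborel_Icc_eq)
  from integrable_Re[OF this] show ?thesis by (simp flip: of_real_prod)
qed

lemma integrable_box_weight: "integrable lborel box_weight"
  unfolding box_weight_def by (rule integrable_indicator_prod)

lemma B_nonneg: "B \<ge> 0"
  using c_bound[of 0] norm_ge_zero[of "c 0"] by linarith

lemma cbox_indicator: "indicat_real (cbox a b) z = (\<Prod>i\<in>UNIV. indicator {a $ i..b $ i} (z $ i))"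
proof (cases "z \<in> cbox a b")
  case False
  then obtain i where "z $ i \<notin> {a $ i..b $ i}" by (auto simp: mem_box_cart)
  hence "(\<Prod>i\<in>UNIV. indicat_real {a $ i..b $ i} (z $ i)) = 0"
    unfolding prod_zero_iff[OF finite] by (intro bexI[of _ i]) auto
  thus ?thesis using False by simp
qed (simp add: mem_box_cart)

lemma corner_indicator_measurable [measurable]:
  "(\<lambda>w::real^'n. \<Prod>i\<in>UNIV. indicat_real {max (a $ i) (w $ i)..b $ i} (z $ i)) \<in> borel_measurable borel"
proof -
  have "(\<lambda>w::real^'n. \<Prod>i\<in>UNIV. indicat_real {max (a $ i) (w $ i)..b $ i} (z $ i))
      = (\<lambda>w. \<Prod>i\<in>UNIV. if max (a $ i) (w $ i) \<le> z $ i \<and> z $ i \<le> b $ i then 1 else 0)"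
    by (intro ext prod.cong refl) (auto simp: indicator_def)
  also have "\<dots> \<in> borel_measurable borel" by measurable
  finally show ?thesis .
qed

text \<open>Valid at every point, also outside the box, where all the box indicators vanish. In this
  form \<open>u\<close> can be integrated against kernels over the whole space.\<close>

lemma u_swap:
  "u z = (LINT w|lborel. (box_weight w * (\<Prod>i\<in>UNIV. indicator {max (a $ i) (w $ i)..b $ i} (z $ i))) *\<^sub>R c w)"
proof -
  have eq: "box_weight w * (\<Prod>i\<in>UNIV. indicator {max (a $ i) (w $ i)..b $ i} (z $ i)) = indicat_real (cbox a b) z * (\<Prod>i\<in>UNIV. indicator {a $ i - 1..z $ i} (w $ i))" for w
    unfolding cbox_indicator box_weight_def prod.distrib[symmetric]
    by (intro prod.cong refl) (metis indicator_swap ab mult.commute)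
  show ?thesis unfolding eq using rep[of z] zero[of z] by (cases "z \<in> cbox a b") simp_all
qed

text \<open>For fixed \<open>w\<close> the integral over \<open>z\<close> runs over a box and splits
  into one-dimensional integrals of Dirichlet kernels. The majorant for Fubini may be crude:
  \<open>R\<close> is fixed and the kernel is at most \<open>(2 R + 1)^d\<close>.\<close>

lemma fourier_sum_eq:
  "fourier_sum u R \<eta> = (LINT w|lborel. of_real (box_weight w * (\<Prod>i\<in>UNIV. dirichlet_int R (max (a $ i) (w $ i)) (b $ i) (\<eta> $ i))) * c w)"
proof -
  let ?J = "\<lambda>w z. \<Prod>i\<in>UNIV. indicat_real {max (a $ i) (w $ i)..b $ i} (z $ i)"
  let ?D = "\<lambda>z. \<Prod>i\<in>UNIV. dirichlet R (z $ i - \<eta> $ i)"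
  have Jm [measurable]: "(\<lambda>p. ?J (fst p) (snd p)) \<in> borel_measurable (lborel \<Otimes>\<^sub>M lborel)"
  proof -
    have "(\<lambda>p. ?J (fst p) (snd p)) = (\<lambda>p::(real^'n) \<times> (real^'n). \<Prod>i\<in>UNIV. if max (a $ i) (fst p $ i) \<le> snd p $ i \<and> snd p $ i \<le> b $ i then 1 else 0)"
      by (intro ext prod.cong refl) (auto simp: indicator_def)
    also have "\<dots> \<in> borel_measurable (lborel \<Otimes>\<^sub>M lborel)" by measurable
    finally show ?thesis .
  qed
  have Dm [measurable]: "?D \<in> borel_measurable borel" by measurable
  have "fourier_sum u R \<eta> = (LINT z|lborel. (LINT w|lborel. (box_weight w * ?J w z) *\<^sub>R c w * ?D z))"
    unfolding fourier_sum_def by (simp only: u_swap[of z for z] integral_mult_left_zero)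
  also have "\<dots> = (LINT w|lborel. (LINT z|lborel. (box_weight w * ?J w z) *\<^sub>R c w * ?D z))"
  proof (rule lborel_pair.Fubini_integral, rule pair_sigma_finite.integrable_pair_bound[OF lborel_pair.pair_sigma_finite_axioms])
    show "integrable lborel (\<lambda>w. box_weight w * (B * (\<Prod>i\<in>(UNIV::'n set). 2 * real R + 1)))"
      by (intro integrable_mult_left integrable_box_weight)
    show "integrable lborel (\<lambda>z::real^'n. \<Prod>i\<in>UNIV. indicat_real {a $ i..b $ i} (z $ i))" by (rule integrable_indicator_prod)
    show "(\<lambda>(w, z). (box_weight w * ?J w z) *\<^sub>R c w * ?D z) \<in> borel_measurable (lborel \<Otimes>\<^sub>M lborel)"
      unfolding split_beta' by measurable
    fix w z
    have D: "cmod (?D z) \<le> (\<Prod>i\<in>(UNIV::'n set). 2 * real R + 1)"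
      unfolding prod_norm[symmetric] by (intro prod_mono conjI norm_dirichlet_le) auto
    have J: "?J w z \<le> (\<Prod>i\<in>UNIV. indicat_real {a $ i..b $ i} (z $ i))"
      by (intro prod_mono) (auto simp: indicator_def)
    have J0: "0 \<le> ?J w z" by (intro prod_nonneg) auto
    have "norm ((box_weight w * ?J w z) *\<^sub>R c w * ?D z) = box_weight w * ?J w z * (cmod (c w) * cmod (?D z))"
      using box_weight_nonneg[of w] J0 by (simp add: norm_mult)
    also have "\<dots> \<le> box_weight w * (\<Prod>i\<in>UNIV. indicat_real {a $ i..b $ i} (z $ i)) * (B * (\<Prod>i\<in>(UNIV::'n set). 2 * real R + 1))"
      by (intro mult_mono J D c_bound mult_nonneg_nonneg box_weight_nonneg prod_nonneg B_nonneg order.refl J0) auto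
    finally show "norm (case (w, z) of (w, z) \<Rightarrow> (box_weight w * ?J w z) *\<^sub>R c w * ?D z) \<le> box_weight w * (B * (\<Prod>i\<in>(UNIV::'n set). 2 * real R + 1)) * (\<Prod>i\<in>UNIV. indicat_real {a $ i..b $ i} (z $ i))"
      by (simp add: mult_ac)
  qed
  also have "\<dots> = (LINT w|lborel. of_real (box_weight w * (\<Prod>i\<in>UNIV. dirichlet_int R (max (a $ i) (w $ i)) (b $ i) (\<eta> $ i))) * c w)"
  proof (intro Bochner_Integration.integral_cong refl)
    fix w
    show "(LINT z|lborel. (box_weight w * ?J w z) *\<^sub>R c w * ?D z) = of_real (box_weight w * (\<Prod>i\<in>UNIV. dirichlet_int R (max (a $ i) (w $ i)) (b $ i) (\<eta> $ i))) * c w"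
    \<comment> \<open>Where the weight is nonzero, \<open>w \<le> b\<close> holds in each
      coordinate, so the end points are ordered as the one-dimensional integral requires.\<close>
    proof (cases "box_weight w = 0")
      case False
      have wb: "w $ i \<le> b $ i" for i
      by (rule box_weight_nonzeroD[OF False])
      have "(LINT z|lborel. (box_weight w * ?J w z) *\<^sub>R c w * ?D z) = (LINT z|lborel. (of_real (box_weight w) * c w) * (\<Prod>i\<in>UNIV. indicator {max (a $ i) (w $ i)..b $ i} (z $ i) *\<^sub>R dirichlet R (z $ i - \<eta> $ i)))"
        by (intro Bochner_Integration.integral_cong refl) (simp add: scaleR_conv_of_real prod.distrib mult_ac)
      also have "\<dots> = (of_real (box_weight w) * c w) * (LINT z|lborel. (\<Prod>i\<in>UNIV. indicator {max (a $ i) (w $ i)..b $ i} ((z::real^'n) $ i) *\<^sub>R dirichlet R (z $ i - \<eta> $ i)))"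
        by (rule integral_mult_right_zero)
      also have "(LINT z|lborel. (\<Prod>i\<in>UNIV. indicator {max (a $ i) (w $ i)..b $ i} ((z::real^'n) $ i) *\<^sub>R dirichlet R (z $ i - \<eta> $ i))) = (\<Prod>i\<in>UNIV. LINT t|lborel. indicator {max (a $ i) (w $ i)..b $ i} t *\<^sub>R dirichlet R (t - \<eta> $ i))"
      proof (rule integral_prod_vec)
        fix i
        have "continuous_on {max (a $ i) (w $ i)..b $ i} (\<lambda>t. dirichlet R (t - \<eta> $ i))"
          unfolding dirichlet_def by (intro continuous_intros)
        thus "integrable lborel (\<lambda>t. indicat_real {max (a $ i) (w $ i)..b $ i} t *\<^sub>R dirichlet R (t - \<eta> $ i))"
          using borel_integrable_atLeastAtMost' by (force simp: set_integrable_def)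
      qed
      also have "\<dots> = (\<Prod>i\<in>UNIV. of_real (dirichlet_int R (max (a $ i) (w $ i)) (b $ i) (\<eta> $ i)))"
        by (intro prod.cong refl integral_dirichlet) (use ab wb in auto)
      finally show ?thesis by (simp add: mult_ac)
    qed simp
  qed
  finally show ?thesis .
qed

lemma dirichlet_int_measurable [measurable]:
  "(\<lambda>w::real^'n. dirichlet_int R (max (a $ i) (w $ i)) (b $ i) t) \<in> borel_measurable borel"
  unfolding dirichlet_int_def sin_sum_def by measurable

text \<open>Uniform in \<open>R\<close> and \<open>\<eta>\<close>: an integrated kernel is at most
  the length of its interval plus 4, as two sine sums are bounded by 2 each.\<close>

definition S_bound :: real where "S_bound = B * (\<Prod>i\<in>UNIV. b $ i - a $ i + 4)"

lemma summand_bound: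
  "cmod (of_real (box_weight w * (\<Prod>i\<in>UNIV. dirichlet_int R (max (a $ i) (w $ i)) (b $ i) (\<eta> $ i))) * c w) \<le> box_weight w * S_bound"
proof (cases "box_weight w = 0")
  case False
  have wb: "w $ i \<le> b $ i" for i
  by (rule box_weight_nonzeroD[OF False])
  have "\<bar>\<Prod>i\<in>UNIV. dirichlet_int R (max (a $ i) (w $ i)) (b $ i) (\<eta> $ i)\<bar> \<le> (\<Prod>i\<in>UNIV. b $ i - a $ i + 4)"
    unfolding abs_prod
  proof (intro prod_mono conjI)
    fix i
    have "\<bar>dirichlet_int R (max (a $ i) (w $ i)) (b $ i) (\<eta> $ i)\<bar> \<le> \<bar>b $ i - max (a $ i) (w $ i)\<bar> + 4"
      by (rule dirichlet_int_bound)
    also have "\<dots> \<le> b $ i - a $ i + 4" using ab[of i] wb[of i] by auto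
    finally show "\<bar>dirichlet_int R (max (a $ i) (w $ i)) (b $ i) (\<eta> $ i)\<bar> \<le> b $ i - a $ i + 4" .
  qed auto
  hence "\<bar>\<Prod>i\<in>UNIV. dirichlet_int R (max (a $ i) (w $ i)) (b $ i) (\<eta> $ i)\<bar> * cmod (c w) \<le> (\<Prod>i\<in>UNIV. b $ i - a $ i + 4) * B"
    by (intro mult_mono c_bound) (auto intro!: prod_nonneg add_nonneg_nonneg simp: ab)
  hence "box_weight w * (\<bar>\<Prod>i\<in>UNIV. dirichlet_int R (max (a $ i) (w $ i)) (b $ i) (\<eta> $ i)\<bar> * cmod (c w)) \<le> box_weight w * S_bound"
    by (intro mult_left_mono box_weight_nonneg) (simp add: S_bound_def mult.commute)
  thus ?thesis by (simp only: norm_mult norm_of_real abs_mult abs_of_nonneg[OF box_weight_nonneg] mult.assoc)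
qed simp

lemma fourier_sum_bounded: "cmod (fourier_sum u R \<eta>) \<le> (LINT w|lborel. box_weight w) * S_bound"
proof -
  have "cmod (fourier_sum u R \<eta>) \<le> (LINT w|lborel. cmod (of_real (box_weight w * (\<Prod>i\<in>UNIV. dirichlet_int R (max (a $ i) (w $ i)) (b $ i) (\<eta> $ i))) * c w))"
    unfolding fourier_sum_eq by (rule integral_norm_bound)
  also have "\<dots> \<le> (LINT w|lborel. box_weight w * S_bound)"
    by (intro integral_mono_AE' integrable_mult_left integrable_box_weight AE_I2 summand_bound order.trans[OF norm_ge_zero summand_bound])
  finally show ?thesis by simp
qed

definition lattice_hits :: "real ^ 'n \<Rightarrow> (int ^ 'n) set" where
  "lattice_hits \<eta> = {k. \<eta> + int_vec k \<in> cbox a b}"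

lemma lattice_hits_subset: "lattice_hits \<eta> \<subseteq> {k. \<forall>i. k $ i \<in> {\<lceil>a $ i - \<eta> $ i\<rceil>..\<lfloor>b $ i - \<eta> $ i\<rfloor>}}"
  by (auto simp: lattice_hits_def mem_box_cart int_vec_def ceiling_le_iff le_floor_iff algebra_simps)

lemma finite_lattice_hits: "finite (lattice_hits \<eta>)"
  by (rule finite_subset[OF lattice_hits_subset finite_vec_Collect]) simp

text \<open>This count, and not the bound on the partial sums, enters the constant of the error
  estimate.\<close>

lemma card_lattice_hits: "real (card (lattice_hits \<eta>)) \<le> (\<Prod>i\<in>UNIV. b $ i - a $ i + 1)"
proof -
  let ?Z = "\<lambda>i. {\<lceil>a $ i - \<eta> $ i\<rceil>..\<lfloor>b $ i - \<eta> $ i\<rfloor>}"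
  have "card (lattice_hits \<eta>) \<le> card {k::int^'n. \<forall>i. k $ i \<in> ?Z i}"
    by (rule card_mono[OF finite_vec_Collect lattice_hits_subset]) simp
  hence "real (card (lattice_hits \<eta>)) \<le> real (card {k::int^'n. \<forall>i. k $ i \<in> ?Z i})" by simp
  also have "\<dots> = (\<Sum>k::int^'n | \<forall>i. k $ i \<in> ?Z i. \<Prod>i\<in>(UNIV::'n set). 1)" by simp
  also have "\<dots> = (\<Prod>i\<in>(UNIV::'n set). \<Sum>l\<in>?Z i. 1)" by (rule prod_sum_vec[symmetric]) simp
  also have "\<dots> \<le> (\<Prod>i\<in>UNIV. b $ i - a $ i + 1)"
  proof (intro prod_mono conjI)
    fix i
    have "real_of_int (\<lfloor>b $ i - \<eta> $ i\<rfloor> - \<lceil>a $ i - \<eta> $ i\<rceil> + 1) \<le> b $ i - a $ i + 1"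
      using of_int_floor_le[of "b $ i - \<eta> $ i"] le_of_int_ceiling[of "a $ i - \<eta> $ i"]
      by (simp only: of_int_add of_int_diff of_int_1)
    moreover have "0 \<le> b $ i - a $ i + 1" using ab[of i] by simp
    ultimately have "max 0 (real_of_int (\<lfloor>b $ i - \<eta> $ i\<rfloor> - \<lceil>a $ i - \<eta> $ i\<rceil> + 1)) \<le> b $ i - a $ i + 1" by simp
    thus "(\<Sum>l\<in>?Z i. 1) \<le> b $ i - a $ i + 1" by (simp add: max_def split: if_splits)
  qed (simp add: sum_nonneg)
  finally show ?thesis .
qed

text \<open>The assumptions keep \<open>\<eta>\<close> off the jumps at the fixed faces; for the
  faces that move with \<open>w\<close>, almost every \<open>w\<close> will do. Each interval factor
  then tends to a count of translates, and integrating the product of the counts against the density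
  gives back the sum of the values of \<open>u\<close>.\<close>

lemma fourier_sum_tendsto:
  assumes an: "\<And>i. a $ i - \<eta> $ i \<notin> \<int>" and bn: "\<And>i. b $ i - \<eta> $ i \<notin> \<int>"
  shows "(\<lambda>R. fourier_sum u R \<eta>) \<longlonglongrightarrow> (\<Sum>k\<in>lattice_hits \<eta>. u (\<eta> + int_vec k))"
proof -
  define Z where "Z i = {\<lceil>a $ i - \<eta> $ i\<rceil>..\<lfloor>b $ i - \<eta> $ i\<rfloor>}" for i
  let ?Q = "{k::int^'n. \<forall>i. k $ i \<in> Z i}"
  let ?J = "\<lambda>w z. \<Prod>i\<in>UNIV. indicat_real {max (a $ i) (w $ i)..b $ i} (z $ i)"
  have wn: "AE w in lborel. \<forall>i. w $ i - \<eta> $ i \<notin> \<int>"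
  proof -
    have "AE w::real^'n in lborel. - (\<eta> $ i) - (- axis i 1) \<bullet> w \<notin> \<int>" for i :: 'n
      by (rule AE_inner_diff_not_Ints) (simp add: axis_eq_0_iff)
    thus ?thesis by (subst AE_all_countable) (simp add: inner_axis')
  qed
  have "(\<lambda>R. fourier_sum u R \<eta>) \<longlonglongrightarrow> (LINT w|lborel. (\<Sum>k\<in>?Q. (box_weight w * ?J w (\<eta> + int_vec k)) *\<^sub>R c w))"
    unfolding fourier_sum_eq
  proof (rule integral_dominated_convergence)
    show "integrable lborel (\<lambda>w. box_weight w * S_bound)" by (intro integrable_mult_left integrable_box_weight)
    show "AE w in lborel. norm (of_real (box_weight w * (\<Prod>i\<in>UNIV. dirichlet_int R (max (a $ i) (w $ i)) (b $ i) (\<eta> $ i))) * c w) \<le> box_weight w * S_bound" for R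
      by (intro AE_I2 summand_bound)
    show "AE w in lborel. (\<lambda>R. of_real (box_weight w * (\<Prod>i\<in>UNIV. dirichlet_int R (max (a $ i) (w $ i)) (b $ i) (\<eta> $ i))) * c w) \<longlonglongrightarrow> (\<Sum>k\<in>?Q. (box_weight w * ?J w (\<eta> + int_vec k)) *\<^sub>R c w)"
      using wn
    proof eventually_elim
      case (elim w)
      show ?case
      proof (cases "box_weight w = 0")
        case False
        have wb: "w $ i \<le> b $ i" for i
        by (rule box_weight_nonzeroD[OF False])
        have tn: "max (a $ i) (w $ i) - \<eta> $ i \<notin> \<int>" for i using an[of i] elim by (simp add: max_def)
        have fl: "of_int (\<lfloor>b $ i - \<eta> $ i\<rfloor> - \<lfloor>max (a $ i) (w $ i) - \<eta> $ i\<rfloor>) = (\<Sum>l\<in>Z i. indicat_real {max (a $ i) (w $ i)..b $ i} (\<eta> $ i + of_int l))" for i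
        proof -
          have "of_int (\<lfloor>b $ i - \<eta> $ i\<rfloor> - \<lfloor>max (a $ i) (w $ i) - \<eta> $ i\<rfloor>) = (\<Sum>l\<in>Z i. if max (a $ i) (w $ i) < \<eta> $ i + of_int l \<and> \<eta> $ i + of_int l \<le> b $ i then 1 else (0::real))"
            by (rule card_floor_diff[symmetric]) (use ab[of i] wb[of i] in \<open>auto simp: Z_def ceiling_le_iff le_floor_iff\<close>)
          \<comment> \<open>Floors count a half-open interval. Its left end is not a translate of
            \<open>\<eta>\<close>, so the closed interval has the same count.\<close>
          also have "\<dots> = (\<Sum>l\<in>Z i. indicat_real {max (a $ i) (w $ i)..b $ i} (\<eta> $ i + of_int l))"
          proof (intro sum.cong refl)
            fix l
            have "max (a $ i) (w $ i) \<noteq> \<eta> $ i + of_int l" using tn[of i] by (metis Ints_of_int add_diff_cancel_left')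
            thus "(if max (a $ i) (w $ i) < \<eta> $ i + of_int l \<and> \<eta> $ i + of_int l \<le> b $ i then 1 else (0::real)) = indicat_real {max (a $ i) (w $ i)..b $ i} (\<eta> $ i + of_int l)"
              by (auto simp: indicator_def)
          qed
          finally show ?thesis .
        qed
        have "(\<lambda>R. of_real (box_weight w * (\<Prod>i\<in>UNIV. dirichlet_int R (max (a $ i) (w $ i)) (b $ i) (\<eta> $ i))) * c w)
           \<longlonglongrightarrow> of_real (box_weight w * (\<Prod>i\<in>UNIV. of_int (\<lfloor>b $ i - \<eta> $ i\<rfloor> - \<lfloor>max (a $ i) (w $ i) - \<eta> $ i\<rfloor>))) * c w"
          by (intro tendsto_intros dirichlet_int_tendsto bn tn)
        also have "(\<Prod>i\<in>UNIV. real_of_int (\<lfloor>b $ i - \<eta> $ i\<rfloor> - \<lfloor>max (a $ i) (w $ i) - \<eta> $ i\<rfloor>)) = (\<Prod>i\<in>UNIV. (\<Sum>l\<in>Z i. indicat_real {max (a $ i) (w $ i)..b $ i} (\<eta> $ i + of_int l)))"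
          by (simp only: fl)
        also have "\<dots> = (\<Sum>k\<in>?Q. ?J w (\<eta> + int_vec k))"
          by (subst prod_sum_vec) (simp_all add: Z_def int_vec_def)
        finally show ?thesis by (simp add: sum_distrib_left sum_distrib_right scaleR_conv_of_real)
      qed simp
    qed
    show "(\<lambda>w. \<Sum>k\<in>?Q. (box_weight w * ?J w (\<eta> + int_vec k)) *\<^sub>R c w) \<in> borel_measurable lborel" by measurable
  qed measurable
  also have "(LINT w|lborel. (\<Sum>k\<in>?Q. (box_weight w * ?J w (\<eta> + int_vec k)) *\<^sub>R c w)) = (\<Sum>k\<in>?Q. u (\<eta> + int_vec k))"
    unfolding u_swap[of "\<eta> + int_vec k" for k]
  proof (rule Bochner_Integration.integral_sum)
    fix k assume "k \<in> ?Q"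
    show "integrable lborel (\<lambda>w. (box_weight w * ?J w (\<eta> + int_vec k)) *\<^sub>R c w)"
    proof (rule Bochner_Integration.integrable_bound)
      show "integrable lborel (\<lambda>w. box_weight w * B)" by (intro integrable_mult_left integrable_box_weight)
      have nb: "norm ((box_weight w * ?J w z) *\<^sub>R c w) \<le> box_weight w * B" for w z
      proof -
        have "?J w z \<le> 1" by (intro prod_le_1) auto
        moreover have "0 \<le> ?J w z" by (intro prod_nonneg) auto
        ultimately have "?J w z * cmod (c w) \<le> 1 * B" by (intro mult_mono c_bound) auto
        thus ?thesis using box_weight_nonneg[of w] \<open>0 \<le> ?J w z\<close> mult_left_mono[of "?J w z * cmod (c w)" B "box_weight w"]
          by (simp add: abs_mult mult.assoc)
      qed
      show "AE w in lborel. norm ((box_weight w * ?J w (\<eta> + int_vec k)) *\<^sub>R c w) \<le> norm (box_weight w * B)"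
        by (intro AE_I2, rule order.trans[OF nb]) (simp only: real_norm_def abs_ge_self)
    qed measurable
  qed
  also have "\<dots> = (\<Sum>k\<in>lattice_hits \<eta>. u (\<eta> + int_vec k))"
  proof (rule sum.mono_neutral_right)
    show "finite ?Q" by (rule finite_vec_Collect) (simp add: Z_def)
    show "lattice_hits \<eta> \<subseteq> ?Q" using lattice_hits_subset by (simp add: Z_def)
    show "\<forall>k\<in>?Q - lattice_hits \<eta>. u (\<eta> + int_vec k) = 0" using zero by (auto simp: lattice_hits_def)
  qed
  finally show ?thesis .
qed

end

subsection \<open>The error estimate\<close>

lemma AE_lborel_iff_negligible:
  fixes P :: "'a::euclidean_space \<Rightarrow> bool"
  shows "(AE x in lborel. P x) \<longleftrightarrow> negligible {x. \<not> P x}"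
proof
  assume "AE x in lborel. P x"
  then obtain N where N: "{x \<in> space lborel. \<not> P x} \<subseteq> N" "emeasure lborel N = 0" "N \<in> sets lborel" by (rule AE_E)
  hence "N \<in> null_sets lborel" by auto
  hence "negligible N" unfolding negligible_iff_null_sets by (rule null_sets_completionI)
  thus "negligible {x. \<not> P x}" by (rule negligible_subset) (use N(1) in auto)
next
  assume "negligible {x. \<not> P x}"
  then obtain N where "N \<in> null_sets lborel" "{x. \<not> P x} \<subseteq> N"
    by (auto simp: negligible_iff_null_sets null_sets_completion_iff2)
  thus "AE x in lborel. P x" by (intro AE_I'[of N]) auto
qed

lemma AE_lborel_affine:
  fixes A :: "real ^ 'n::finite ^ 'n"
  assumes "invertible A" and P: "AE x in lborel. P x"
  shows "AE x in lborel. P (A *v x + c)"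
proof -
  let ?B = "matrix_inv A"
  have "{x. \<not> P (A *v x + c)} \<subseteq> (*v) ?B ` ((+) (- c) ` {x. \<not> P x})"
  proof
    fix x assume "x \<in> {x. \<not> P (A *v x + c)}"
    moreover have "x = ?B *v (- c + (A *v x + c))"
      by (simp add: matrix_vector_mul_assoc matrix_inv_works[OF assms(1)])
    ultimately show "x \<in> (*v) ?B ` ((+) (- c) ` {x. \<not> P x})" by blast
  qed
  moreover have "negligible ((*v) ?B ` ((+) (- c) ` {x. \<not> P x}))"
    using P by (intro negligible_differentiable_image_negligible negligible_translation linear_imp_differentiable_on)
      (simp_all add: AE_lborel_iff_negligible)
  ultimately show ?thesis unfolding AE_lborel_iff_negligible by (rule negligible_subset[rotated])
qed

text \<open>Away from the origin \<open>norm \<eta> / \<delta>\<close> is at least 1, so every lower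
  power of it is at most the N-th.\<close>

lemma norm_symbol_le:
  fixes a :: "nat ^ 'n::finite \<Rightarrow> complex"
  assumes \<delta>: "\<delta> > 0"
  shows "\<exists>K\<ge>0. \<forall>\<eta>. \<delta> \<le> norm \<eta> \<longrightarrow> cmod (symbol N a \<eta>) \<le> K * norm \<eta> ^ N"
proof (intro exI conjI allI impI)
  let ?K = "\<Sum>\<beta> | mi_order \<beta> \<le> N. cmod (a \<beta>) * ((2 * pi) ^ mi_order \<beta> * (\<delta> ^ mi_order \<beta> / \<delta> ^ N))"
  show "0 \<le> ?K" using \<delta> by (intro sum_nonneg) auto
  fix \<eta> :: "real ^ 'n" assume \<eta>: "\<delta> \<le> norm \<eta>"
  have "cmod (symbol N a \<eta>) \<le> (\<Sum>\<beta> | mi_order \<beta> \<le> N. cmod (a \<beta>) * ((2 * pi) ^ mi_order \<beta> * (\<delta> ^ mi_order \<beta> / \<delta> ^ N)) * norm \<eta> ^ N)"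
    unfolding symbol_def
  proof (rule order.trans[OF norm_sum], rule sum_mono)
    fix \<beta> :: "nat ^ 'n" assume "\<beta> \<in> {\<beta>. mi_order \<beta> \<le> N}"
    hence le: "mi_order \<beta> \<le> N" by simp
    have "cmod (a \<beta> * mi_monom \<eta> (\<lambda>i. \<beta> $ i)) \<le> cmod (a \<beta>) * ((2 * pi) ^ mi_order \<beta> * norm \<eta> ^ mi_order \<beta>)"
      unfolding norm_mult mi_order_def by (intro mult_left_mono norm_mi_monom_le) auto
    also have "norm \<eta> ^ mi_order \<beta> \<le> \<delta> ^ mi_order \<beta> / \<delta> ^ N * norm \<eta> ^ N"
    proof -
      have "(norm \<eta> / \<delta>) ^ mi_order \<beta> \<le> (norm \<eta> / \<delta>) ^ N"
        using \<eta> \<delta> by (intro power_increasing le) simp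
      thus ?thesis using \<delta> by (simp add: power_divide field_simps)
    qed
    finally show "cmod (a \<beta> * mi_monom \<eta> (\<lambda>i. \<beta> $ i)) \<le> cmod (a \<beta>) * ((2 * pi) ^ mi_order \<beta> * (\<delta> ^ mi_order \<beta> / \<delta> ^ N)) * norm \<eta> ^ N"
      by (simp add: mult_left_mono mult.assoc)
  qed
  thus "cmod (symbol N a \<eta>) \<le> ?K * norm \<eta> ^ N" by (simp only: sum_distrib_right)
qed

lemma int_vec_0 [simp]: "int_vec 0 = 0"
  by (simp add: int_vec_def vec_eq_iff)

text \<open>The case of one dilation, with \<open>A\<close> and \<open>y\<close> in place of
  \<open>j\<close> and \<open>x\<close>. The constant is written out because it has to be visibly
  independent of \<open>F\<close>, \<open>A\<close> and \<open>y\<close>.\<close>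

lemma sampling_error:
  fixes A :: "real ^ 'n::finite ^ 'n" and \<theta> :: "real ^ 'n \<Rightarrow> complex"
  assumes A: "invertible A" and \<delta>: "\<delta> > 0"
    and ab: "\<And>i. l $ i < r $ i" and zero: "\<And>\<xi>. \<xi> \<notin> cbox l r \<Longrightarrow> \<theta> \<xi> = 0" and Ck: "Ck_on CARD('n) (cbox l r) \<theta>"
    and \<theta>: "integrable lborel \<theta>" and T: "\<And>\<xi>. cmod (\<theta> \<xi>) \<le> T"
    and one: "AE \<eta> in lborel. norm \<eta> < \<delta> \<longrightarrow> \<theta> \<eta> * symbol N a \<eta> = 1"
    and vanish: "\<And>k. k \<noteq> 0 \<Longrightarrow> AE \<eta> in lborel. norm \<eta> < \<delta> \<longrightarrow> \<theta> (\<eta> + int_vec k) = 0"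
    and K: "K \<ge> 0" "\<And>\<eta>. \<delta> \<le> norm \<eta> \<Longrightarrow> cmod (symbol N a \<eta>) \<le> K * norm \<eta> ^ N"
    and F: "F \<in> borel_measurable borel" and iF: "\<And>k. k \<le> N \<Longrightarrow> integrable lborel (\<lambda>\<xi>. norm \<xi> ^ k * cmod (F \<xi>))"
  shows "\<exists>L. (\<lambda>R. \<Sum>k | \<forall>i. \<bar>k $ i\<bar> \<le> int R. diff_op N a (osc_integral lborel ((*v) A) F) (- int_vec k) * inv_fourier \<theta> (y + int_vec k)) \<longlonglongrightarrow> L
    \<and> cmod (osc_integral lborel ((*v) A) F y - L) \<le> (1 / \<delta> ^ N + K * (T * (\<Prod>i\<in>UNIV. r $ i - l $ i + 1))) * op_norm A ^ N *
         (LINT \<xi>:{\<xi>. \<delta> \<le> norm (A *v \<xi>)}|lborel. norm \<xi> ^ N * cmod (F \<xi>))"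
proof -
  let ?e = "\<lambda>t::real. exp (2 * pi * \<i> * of_real t)"
  let ?w = "(*v) A"
  define V where "V = (\<Prod>i\<in>UNIV. r $ i - l $ i + 1)"
  define C where "C = 1 / \<delta> ^ N + K * (T * V)"
  define u where "u z = \<theta> z * ?e (y \<bullet> z)" for z
  have [measurable]: "F \<in> borel_measurable borel" "\<theta> \<in> borel_measurable borel" using F \<theta> by auto
  have [measurable]: "?w \<in> borel_measurable borel"
    by (intro borel_measurable_continuous_onI linear_continuous_on matrix_vector_mul_bounded_linear)
  have [measurable]: "u \<in> borel_measurable borel" unfolding u_def by measurable
  have wn: "norm (?w \<xi>) \<le> op_norm A * norm \<xi>" for \<xi>
    unfolding op_norm_def by (rule onorm[OF matrix_vector_mul_bounded_linear])
  have op0: "op_norm A \<ge> 0" unfolding op_norm_def by (rule onorm_pos_le[OF matrix_vector_mul_bounded_linear])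
  have iw: "integrable lborel (\<lambda>\<xi>. norm (?w \<xi>) ^ k * cmod (F \<xi>))" if "k \<le> N" for k
  proof (rule Bochner_Integration.integrable_bound)
    show "integrable lborel (\<lambda>\<xi>. op_norm A ^ k * (norm \<xi> ^ k * cmod (F \<xi>)))" by (intro integrable_mult_right iF that)
    have "norm (?w \<xi>) ^ k * cmod (F \<xi>) \<le> op_norm A ^ k * (norm \<xi> ^ k * cmod (F \<xi>))" for \<xi>
      using mult_right_mono[OF power_mono[OF wn norm_ge_zero, of \<xi> k], of "cmod (F \<xi>)"] by (simp add: power_mult_distrib mult.assoc)
    thus "AE \<xi> in lborel. norm (norm (?w \<xi>) ^ k * cmod (F \<xi>)) \<le> norm (op_norm A ^ k * (norm \<xi> ^ k * cmod (F \<xi>)))"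
      using op0 by (simp add: abs_mult)
  qed measurable
  have Fint: "integrable lborel F" using iF[of 0] integrable_norm_iff[of F lborel] by simp
  let ?FP = "\<lambda>\<xi>. F \<xi> * symbol N a (?w \<xi>)"
  have iFP: "integrable lborel ?FP" by (rule integrable_times_symbol[OF _ _ iw]) measurable
  \<comment> \<open>The density and its bound depend on \<open>y\<close>. They enter only the
    majorant \<open>S\<close> for the passage to the limit.\<close>
  obtain c B where c: "c \<in> borel_measurable borel" "\<And>x. cmod (c x) \<le> B"
    "\<And>z. z \<in> cbox l r \<Longrightarrow> u z = (LINT w|lborel. (\<Prod>i\<in>UNIV. indicator {l $ i - 1..z $ i} (w $ i)) *\<^sub>R c w)"
    using box_representation[of l r u] Ck_on_times_exp[OF Ck, of y] unfolding u_def by blast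
  interpret bf: box_function l r u c B
    by unfold_locales (use ab less_imp_le c zero in \<open>auto simp: u_def\<close>)
  let ?hits = "bf.lattice_hits"
  let ?\<Theta> = "\<lambda>\<eta>. \<Sum>k\<in>?hits \<eta>. u (\<eta> + int_vec k)"
  have sum_eq: "(\<Sum>k | \<forall>i. \<bar>k $ i\<bar> \<le> int R. diff_op N a (osc_integral lborel ?w F) (- int_vec k) * inv_fourier \<theta> (y + int_vec k))
      = (LINT \<xi>|lborel. ?FP \<xi> * fourier_sum u R (?w \<xi>))" for R
  proof -
    have ik: "integrable lborel (\<lambda>\<xi>. ?FP \<xi> * ?e (- int_vec k \<bullet> ?w \<xi>))" for k
      by (rule Bochner_Integration.integrable_bound[OF iFP]) (auto simp: norm_mult norm_exp_2pi)
    have "(\<Sum>k | \<forall>i. \<bar>k $ i\<bar> \<le> int R. diff_op N a (osc_integral lborel ?w F) (- int_vec k) * inv_fourier \<theta> (y + int_vec k))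
       = (\<Sum>k | \<forall>i. \<bar>k $ i\<bar> \<le> int R. (LINT \<xi>|lborel. ?FP \<xi> * ?e (- int_vec k \<bullet> ?w \<xi>) * inv_fourier \<theta> (y + int_vec k)))"
    proof (intro sum.cong refl)
      fix k
      have "diff_op N a (osc_integral lborel ?w F) (- int_vec k) = osc_integral lborel ?w ?FP (- int_vec k)"
        by (rule diff_op_osc_integral[OF _ _ iw]) measurable
      thus "diff_op N a (osc_integral lborel ?w F) (- int_vec k) * inv_fourier \<theta> (y + int_vec k) = (LINT \<xi>|lborel. ?FP \<xi> * ?e (- int_vec k \<bullet> ?w \<xi>) * inv_fourier \<theta> (y + int_vec k))"
        by (simp only: osc_integral_def integral_mult_left_zero)
    qed
    also have "\<dots> = (LINT \<xi>|lborel. (\<Sum>k | \<forall>i. \<bar>k $ i\<bar> \<le> int R. ?FP \<xi> * ?e (- int_vec k \<bullet> ?w \<xi>) * inv_fourier \<theta> (y + int_vec k)))"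
      by (rule Bochner_Integration.integral_sum[symmetric]) (intro integrable_mult_left ik)
    also have "\<dots> = (LINT \<xi>|lborel. ?FP \<xi> * fourier_sum u R (?w \<xi>))"
      unfolding u_def inv_fourier_cubic_sum[OF \<theta>, symmetric] sum_distrib_left
      by (intro Bochner_Integration.integral_cong refl sum.cong) (simp only: mult_ac)
    finally show ?thesis .
  qed
  have fsm [measurable]: "(\<lambda>\<xi>. fourier_sum u R (?w \<xi>)) \<in> borel_measurable borel" for R
    unfolding fourier_sum_def by measurable
  \<comment> \<open>Defined as a limit of measurable functions, so that the periodization along
    \<open>A\<close> is measurable up to a null set without a study of its varying index
    set.\<close>
  define \<Lambda> where "\<Lambda> \<xi> = lim (\<lambda>R. fourier_sum u R (?w \<xi>))" for \<xi>
  have [measurable]: "\<Lambda> \<in> borel_measurable borel" unfolding \<Lambda>_def by (rule borel_measurable_lim_metric) (rule fsm)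
  \<comment> \<open>No row of an invertible matrix vanishes, so each coordinate of
    \<open>A \<xi>\<close> avoids countably many values for almost every
    \<open>\<xi>\<close>.\<close>
  have generic: "AE \<xi> in lborel. \<forall>i. l $ i - ?w \<xi> $ i \<notin> \<int> \<and> r $ i - ?w \<xi> $ i \<notin> \<int>"
  proof -
    have row: "row i A \<noteq> 0" for i
    proof
      assume "row i A = 0"
      hence "(A ** matrix_inv A) $ i $ i = 0" by (simp add: matrix_matrix_mult_def row_def vec_eq_iff)
      thus False by (simp add: matrix_inv_works[OF A] mat_def)
    qed
    have comp: "?w \<xi> $ i = row i A \<bullet> \<xi>" for \<xi> i
      by (simp add: matrix_vector_mult_def row_def inner_vec_def)
    have "AE \<xi> in lborel. l $ i - row i A \<bullet> \<xi> \<notin> \<int> \<and> r $ i - row i A \<bullet> \<xi> \<notin> \<int>" for i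
      using AE_inner_diff_not_Ints[OF row] by (intro AE_conjI)
    thus ?thesis unfolding comp by (subst AE_all_countable) auto
  qed
  have conv: "AE \<xi> in lborel. (\<lambda>R. fourier_sum u R (?w \<xi>)) \<longlonglongrightarrow> ?\<Theta> (?w \<xi>) \<and> \<Lambda> \<xi> = ?\<Theta> (?w \<xi>)"
    using generic
  proof eventually_elim
    case (elim \<xi>)
    have "(\<lambda>R. fourier_sum u R (?w \<xi>)) \<longlonglongrightarrow> ?\<Theta> (?w \<xi>)" by (rule bf.fourier_sum_tendsto) (use elim in auto)
    thus ?case using limI by (auto simp: \<Lambda>_def)
  qed
  define S where "S = (LINT w|lborel. bf.box_weight w) * bf.S_bound"
  have limit: "(\<lambda>R. LINT \<xi>|lborel. ?FP \<xi> * fourier_sum u R (?w \<xi>)) \<longlonglongrightarrow> (LINT \<xi>|lborel. ?FP \<xi> * \<Lambda> \<xi>)"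
  proof (rule integral_dominated_convergence)
    show "integrable lborel (\<lambda>\<xi>. cmod (?FP \<xi>) * S)" using iFP by (intro integrable_mult_left integrable_norm)
    show "AE \<xi> in lborel. norm (?FP \<xi> * fourier_sum u R (?w \<xi>)) \<le> cmod (?FP \<xi>) * S" for R
      unfolding norm_mult[of "?FP \<xi>" for \<xi>] S_def by (intro AE_I2 mult_left_mono bf.fourier_sum_bounded) auto
    show "AE \<xi> in lborel. (\<lambda>R. ?FP \<xi> * fourier_sum u R (?w \<xi>)) \<longlonglongrightarrow> ?FP \<xi> * \<Lambda> \<xi>"
      using conv by eventually_elim (auto intro!: tendsto_intros)
  qed measurable
  have \<Theta>_le: "cmod (?\<Theta> \<eta>) \<le> T * V" for \<eta>
  proof -
    have T0: "T \<ge> 0" using T[of 0] norm_ge_zero[of "\<theta> 0"] by linarith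
    have "cmod (?\<Theta> \<eta>) \<le> (\<Sum>k\<in>?hits \<eta>. T)"
      by (rule order.trans[OF norm_sum], rule sum_mono) (simp add: u_def norm_mult norm_exp_2pi T)
    also have "\<dots> = T * real (card (?hits \<eta>))" by simp
    also have "\<dots> \<le> T * V" unfolding V_def by (intro mult_left_mono bf.card_lattice_hits T0)
    finally show ?thesis .
  qed
  have iF\<Lambda>: "integrable lborel (\<lambda>\<xi>. ?FP \<xi> * \<Lambda> \<xi>)"
  proof (rule Bochner_Integration.integrable_bound)
    show "integrable lborel (\<lambda>\<xi>. cmod (?FP \<xi>) * (T * V))" using iFP by (intro integrable_mult_left integrable_norm)
    show "AE \<xi> in lborel. norm (?FP \<xi> * \<Lambda> \<xi>) \<le> norm (cmod (?FP \<xi>) * (T * V))"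
      using conv
    proof eventually_elim
      case (elim \<xi>)
      have "norm (?FP \<xi> * \<Lambda> \<xi>) \<le> cmod (?FP \<xi>) * (T * V)"
        unfolding norm_mult[of "?FP \<xi>"] using elim \<Theta>_le[of "?w \<xi>"] by (intro mult_left_mono) auto
      also have "\<dots> \<le> norm (cmod (?FP \<xi>) * (T * V))" by (simp only: real_norm_def abs_ge_self)
      finally show ?case .
    qed
  qed measurable
  have ie: "integrable lborel (\<lambda>\<xi>. F \<xi> * ?e (y \<bullet> ?w \<xi>))"
    by (rule Bochner_Integration.integrable_bound[OF Fint]) (auto simp: norm_mult norm_exp_2pi)
  have near: "AE \<eta> in lborel. norm \<eta> < \<delta> \<longrightarrow> symbol N a \<eta> * ?\<Theta> \<eta> = ?e (y \<bullet> \<eta>)"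
  proof -
    have "AE \<eta> in lborel. \<forall>k\<in>UNIV - {0}. norm \<eta> < \<delta> \<longrightarrow> \<theta> (\<eta> + int_vec k) = 0"
      using vanish by (subst AE_ball_countable) auto
    thus ?thesis using one
    proof eventually_elim
      case (elim \<eta>)
      show ?case
      proof
        assume \<eta>: "norm \<eta> < \<delta>"
        \<comment> \<open>Index 0 is inserted before the sum is cut down to it: if it is not a hit,
          its term is 0 anyway.\<close>
        have "?\<Theta> \<eta> = (\<Sum>k\<in>insert 0 (?hits \<eta>). u (\<eta> + int_vec k))"
          using bf.zero bf.finite_lattice_hits by (intro sum.mono_neutral_left) (auto simp: bf.lattice_hits_def)
        also have "\<dots> = (\<Sum>k\<in>{0}. u (\<eta> + int_vec k))"
          using elim(1) \<eta> bf.finite_lattice_hits by (intro sum.mono_neutral_right) (auto simp: u_def)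
        finally have "?\<Theta> \<eta> = \<theta> \<eta> * ?e (y \<bullet> \<eta>)" by (simp add: u_def)
        thus "symbol N a \<eta> * ?\<Theta> \<eta> = ?e (y \<bullet> \<eta>)" using elim(2) \<eta> by (simp add: mult.assoc[symmetric] mult.commute[of "symbol N a \<eta>"])
      qed
    qed
  qed
  have near_w: "AE \<xi> in lborel. norm (?w \<xi>) < \<delta> \<longrightarrow> symbol N a (?w \<xi>) * ?\<Theta> (?w \<xi>) = ?e (y \<bullet> ?w \<xi>)"
    using AE_lborel_affine[OF A near, of 0] by simp
  have C0: "C \<ge> 0"
  proof -
    have "T * V \<ge> 0" using order.trans[OF norm_ge_zero \<Theta>_le] .
    thus ?thesis using K \<delta> by (simp add: C_def)
  qed
  let ?I = "\<lambda>\<xi>. indicat_real {\<xi>. \<delta> \<le> norm (?w \<xi>)} \<xi> *\<^sub>R (norm \<xi> ^ N * cmod (F \<xi>))"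
  have iI: "integrable lborel ?I"
  proof (rule Bochner_Integration.integrable_bound[OF iF[OF order.refl]])
    show "AE \<xi> in lborel. norm (?I \<xi>) \<le> norm (norm \<xi> ^ N * cmod (F \<xi>))"
      by (intro AE_I2) (simp add: indicator_def)
  qed measurable
  have bracket: "AE \<xi> in lborel. cmod (F \<xi> * ?e (y \<bullet> ?w \<xi>) - ?FP \<xi> * \<Lambda> \<xi>) \<le> C * op_norm A ^ N * ?I \<xi>"
    using conv near_w
  proof eventually_elim
    case (elim \<xi>)
    let ?\<eta> = "?w \<xi>"
    have eq: "F \<xi> * ?e (y \<bullet> ?w \<xi>) - ?FP \<xi> * \<Lambda> \<xi> = F \<xi> * (?e (y \<bullet> ?\<eta>) - symbol N a ?\<eta> * ?\<Theta> ?\<eta>)"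
      using elim(1) by (simp add: algebra_simps)
    show ?case
    proof (cases "norm ?\<eta> < \<delta>")
      case True
      thus ?thesis unfolding eq using elim(2) by simp
    next
      case False
      hence \<eta>: "\<delta> \<le> norm ?\<eta>" by simp
      have "cmod (?e (y \<bullet> ?\<eta>) - symbol N a ?\<eta> * ?\<Theta> ?\<eta>) \<le> cmod (?e (y \<bullet> ?\<eta>)) + cmod (symbol N a ?\<eta> * ?\<Theta> ?\<eta>)"
        by (rule norm_triangle_ineq4)
      also have "cmod (?e (y \<bullet> ?\<eta>)) = 1" by (rule norm_exp_2pi)
      also have "cmod (symbol N a ?\<eta> * ?\<Theta> ?\<eta>) \<le> (K * norm ?\<eta> ^ N) * (T * V)"
        unfolding norm_mult using K(1) by (intro mult_mono K(2) \<eta> \<Theta>_le) auto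
      \<comment> \<open>The unimodular term carries no power of the norm. This inequality supplies
        one and is the origin of \<open>1 / \<delta>^N\<close> in the constant.\<close>
      also have "1 \<le> norm ?\<eta> ^ N / \<delta> ^ N"
        using power_mono[OF \<eta>, of N] \<delta> by simp
      finally have "cmod (?e (y \<bullet> ?\<eta>) - symbol N a ?\<eta> * ?\<Theta> ?\<eta>) \<le> C * norm ?\<eta> ^ N"
        by (simp add: C_def algebra_simps)
      also have "\<dots> \<le> C * (op_norm A * norm \<xi>) ^ N" by (intro mult_left_mono power_mono wn C0) auto
      finally have "cmod (F \<xi>) * cmod (?e (y \<bullet> ?\<eta>) - symbol N a ?\<eta> * ?\<Theta> ?\<eta>) \<le> cmod (F \<xi>) * (C * (op_norm A * norm \<xi>) ^ N)"
        by (rule mult_left_mono) simp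
      thus ?thesis unfolding eq norm_mult using \<eta> by (simp add: power_mult_distrib mult_ac)
    qed
  qed
  have "cmod (osc_integral lborel ?w F y - (LINT \<xi>|lborel. ?FP \<xi> * \<Lambda> \<xi>)) = cmod (LINT \<xi>|lborel. F \<xi> * ?e (y \<bullet> ?w \<xi>) - ?FP \<xi> * \<Lambda> \<xi>)"
    unfolding osc_integral_def by (simp only: Bochner_Integration.integral_diff[OF ie iF\<Lambda>])
  also have "\<dots> \<le> (LINT \<xi>|lborel. cmod (F \<xi> * ?e (y \<bullet> ?w \<xi>) - ?FP \<xi> * \<Lambda> \<xi>))" by (rule integral_norm_bound)
  also have "\<dots> \<le> (LINT \<xi>|lborel. C * op_norm A ^ N * ?I \<xi>)"
    by (rule integral_mono_AE'[OF integrable_mult_right[OF iI] bracket]) (use C0 op0 in \<open>simp add: indicator_def\<close>)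
  also have "\<dots> = C * op_norm A ^ N * (LINT \<xi>:{\<xi>. \<delta> \<le> norm (A *v \<xi>)}|lborel. norm \<xi> ^ N * cmod (F \<xi>))"
    unfolding set_lebesgue_integral_def by (rule integral_mult_right_zero)
  finally show ?thesis using limit unfolding sum_eq C_def V_def by blast
qed

theorem theorem16:
  fixes M :: "real ^ 'n ^ 'n::finite"
    and N :: nat
    and a :: "nat ^ 'n \<Rightarrow> complex"
    and \<phi> :: "real ^ 'n \<Rightarrow> complex"
    and \<delta> :: real
  assumes "dilation_matrix M"
    and "a 0 \<noteq> 0"
    and "class_B \<phi>"
    and "strictly_compatible (assoc_distribution N a) \<phi> \<delta>"
  shows "\<exists>C::real. \<forall>(f :: real ^ 'n \<Rightarrow> complex) (F :: real ^ 'n \<Rightarrow> complex) (\<epsilon>::real).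
    continuous_on UNIV f \<and> fourier_is f F \<and> integrable lborel F \<and> 0 < \<epsilon> \<and>
    (\<lambda>\<xi>. cmod (F \<xi>)) \<in> O[at_infinity](\<lambda>\<xi>. norm \<xi> powr (- (real N + real CARD('n) + \<epsilon>)))
    \<longrightarrow>
    (\<forall>(j::int) x.
       convergent (cubic_partial_sum N a M \<phi> f j x) \<and>
       cmod (f x - of_real (\<bar>det M\<bar> powr (- of_int j / 2)) * lim (cubic_partial_sum N a M \<phi> f j x))
         \<le> C * op_norm (mat_powi (transpose M) (- j)) ^ N *
             (LINT \<xi>:{\<xi>. \<delta> \<le> norm (mat_powi (transpose M) (- j) *v \<xi>)}|lborel.
                norm \<xi> ^ N * cmod (F \<xi>))) \<and>
    (\<forall>\<theta>::real. 0 < \<theta> \<and> (\<forall>\<mu>. eigenvalue_of M \<mu> \<longrightarrow> \<theta> < cmod \<mu>) \<longrightarrow>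
       (\<forall>J::int. \<exists>C'::real. \<forall>j\<ge>J.
          C * op_norm (mat_powi (transpose M) (- j)) ^ N *
             (LINT \<xi>:{\<xi>. \<delta> \<le> norm (mat_powi (transpose M) (- j) *v \<xi>)}|lborel.
                norm \<xi> ^ N * cmod (F \<xi>))
          \<le> C' * \<theta> powr (- of_int j * (real N + \<epsilon>))))"
proof -
  have M: "invertible M" by (rule dilation_matrix_invertible[OF assms(1)])
  have detM: "\<bar>det M\<bar> > 0" using M by (simp add: invertible_det_nz)
  obtain \<theta> l r where ab: "\<And>i. l $ i < r $ i" and zero: "\<And>\<xi>. \<xi> \<notin> cbox l r \<Longrightarrow> \<theta> \<xi> = 0"
    and Ck: "Ck_on CARD('n) (cbox l r) \<theta>" and \<phi>: "\<And>x. \<phi> x = (LINT \<xi>|lborel. \<theta> \<xi> * exp (2 * pi * \<i> * of_real (x \<bullet> \<xi>)))"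
    using assms(3) unfolding class_B_def by blast
  have \<phi>_eq: "\<phi> = inv_fourier \<theta>" by (simp add: fun_eq_iff \<phi> inv_fourier_def)
  have cont: "continuous_on (cbox l r) \<theta>" by (rule Ck_on_continuous[OF Ck])
  have \<theta>: "integrable lborel \<theta>"
  proof -
    have "(\<lambda>\<xi>. indicat_real (cbox l r) \<xi> *\<^sub>R \<theta> \<xi>) = \<theta>" using zero by (auto simp: fun_eq_iff indicator_def)
    thus ?thesis using borel_integrable_compact[OF compact_cbox cont] by simp
  qed
  obtain T where T: "\<And>\<xi>. cmod (\<theta> \<xi>) \<le> T"
  proof -
    have "bounded (\<theta> ` cbox l r)" by (intro compact_imp_bounded compact_continuous_image cont compact_cbox)
    then obtain T where "\<And>\<xi>. \<xi> \<in> cbox l r \<Longrightarrow> cmod (\<theta> \<xi>) \<le> T" unfolding bounded_iff by blast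
    hence "cmod (\<theta> \<xi>) \<le> max 0 T" for \<xi> using zero[of \<xi>] by (cases "\<xi> \<in> cbox l r") (auto simp: le_max_iff_disj)
    thus ?thesis using that by blast
  qed
  obtain G H where \<delta>: "0 < \<delta>" and G: "dist_fourier_is (assoc_distribution N a) G" and H: "fourier_is \<phi> H"
    and GH: "AE \<xi> in lborel. norm \<xi> < \<delta> \<longrightarrow> cnj (H \<xi>) * G \<xi> = 1"
    and H0: "\<And>k. k \<noteq> 0 \<Longrightarrow> AE \<xi> in lborel. norm (int_vec k - \<xi>) < \<delta> \<longrightarrow> H \<xi> = 0"
    using assms(4) unfolding strictly_compatible_def by blast
  \<comment> \<open>From here on the compatibility condition speaks of \<open>\<theta>\<close> and
    the symbol instead of distributional transforms.\<close>
  have Hae: "AE \<xi> in lborel. H \<xi> = \<theta> \<xi>" using fourier_is_inv_fourier[OF \<theta>] H by (simp add: \<phi>_eq)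
  have Gae: "AE \<xi> in lborel. G \<xi> = cnj (symbol N a \<xi>)" by (rule assoc_distribution_fourier[OF G])
  have one: "AE \<eta> in lborel. norm \<eta> < \<delta> \<longrightarrow> \<theta> \<eta> * symbol N a \<eta> = 1"
    using GH Hae Gae
  proof eventually_elim
    case (elim \<eta>)
    show ?case
    proof
      assume "norm \<eta> < \<delta>"
      hence "cnj (\<theta> \<eta> * symbol N a \<eta>) = cnj 1" using elim by simp
      thus "\<theta> \<eta> * symbol N a \<eta> = 1" by (simp only: complex_cnj_cancel_iff)
    qed
  qed
  have vanish: "AE \<eta> in lborel. norm \<eta> < \<delta> \<longrightarrow> \<theta> (\<eta> + int_vec k) = 0" if "k \<noteq> 0" for k
  proof -
    have "AE \<xi> in lborel. norm (int_vec k - \<xi>) < \<delta> \<longrightarrow> \<theta> \<xi> = 0"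
      using H0[OF that] Hae by eventually_elim auto
    \<comment> \<open>The affine map is a mere translation, which recentres the condition from the
      lattice point to the origin.\<close>
    moreover have "invertible (mat 1 :: real ^ 'n ^ 'n)"
      unfolding invertible_def by (intro exI[of _ "mat 1"]) simp
    ultimately have "AE \<eta> in lborel. norm (int_vec k - (mat 1 *v \<eta> + int_vec k)) < \<delta> \<longrightarrow> \<theta> (mat 1 *v \<eta> + int_vec k) = 0"
      by (intro AE_lborel_affine)
    thus ?thesis by simp
  qed
  obtain K where K: "K \<ge> 0" "\<And>\<eta>. \<delta> \<le> norm \<eta> \<Longrightarrow> cmod (symbol N a \<eta>) \<le> K * norm \<eta> ^ N"
    using norm_symbol_le[OF \<delta>] by blast
  \<comment> \<open>Made of data of \<open>\<phi>\<close> and the operator together with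
    \<open>\<delta>\<close>, since \<open>C\<close> is chosen before \<open>f\<close>,
    \<open>j\<close> and \<open>x\<close>.\<close>
  define C where "C = 1 / \<delta> ^ N + K * (T * (\<Prod>i\<in>UNIV. r $ i - l $ i + 1))"
  have C0: "C \<ge> 0"
  proof -
    have "T \<ge> 0" using order.trans[OF norm_ge_zero T] .
    moreover have "(\<Prod>i\<in>UNIV. r $ i - l $ i + 1) \<ge> 0" using ab by (intro prod_nonneg) (simp add: less_imp_le add_nonneg_nonneg)
    ultimately show ?thesis using K \<delta> by (simp add: C_def)
  qed
  let ?A = "\<lambda>j. mat_powi (transpose M) (- j)"
  let ?T = "\<lambda>F j. LINT \<xi>:{\<xi>. \<delta> \<le> norm (?A j *v \<xi>)}|lborel. norm \<xi> ^ N * cmod (F \<xi>)"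
  have A_inv: "invertible (?A j)" for j
  proof -
    have "mat_powi M (- j) ** mat_powi M j = mat 1" "mat_powi M j ** mat_powi M (- j) = mat 1"
      using mat_powi_minus_mult[OF M, of j] mat_powi_minus_mult[OF M, of "- j"] by simp_all
    hence "invertible (mat_powi M (- j))" unfolding invertible_def by blast
    thus ?thesis by (simp add: mat_powi_transpose[OF M] invertible_det_nz)
  qed
  have first: "convergent (cubic_partial_sum N a M \<phi> f j x) \<and>
       cmod (f x - of_real (\<bar>det M\<bar> powr (- of_int j / 2)) * lim (cubic_partial_sum N a M \<phi> f j x)) \<le> C * op_norm (?A j) ^ N * ?T F j"
    if f: "continuous_on UNIV f" and fF: "fourier_is f F" and F: "integrable lborel F"
      and iF: "\<And>k. k \<le> N \<Longrightarrow> integrable lborel (\<lambda>\<xi>. norm \<xi> ^ k * cmod (F \<xi>))" for f F j x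
  proof -
    define y where "y = mat_powi M j *v x"
    have [measurable]: "F \<in> borel_measurable borel" using F by auto
    \<comment> \<open>Transposition moves the dilation from the argument of \<open>f\<close> to the
      frequency.\<close>
    have inner: "z \<bullet> (?A j *v \<xi>) = (mat_powi M (- j) *v z) \<bullet> \<xi>" for z \<xi>
      by (simp add: mat_powi_transpose[OF M] transpose_matrix_vector inner_commute[of z] dot_lmul_matrix inner_commute[of \<xi>])
    have fosc: "f (mat_powi M (- j) *v z) = osc_integral lborel ((*v) (?A j)) F z" for z
      by (simp add: inv_fourier_of_fourier_is[OF f F fF] inv_fourier_def osc_integral_def inner)
    have x: "mat_powi M (- j) *v y = x"
      by (simp add: y_def matrix_vector_mul_assoc mat_powi_minus_mult[OF M])
    obtain L where L: "(\<lambda>R. \<Sum>k | \<forall>i. \<bar>k $ i\<bar> \<le> int R. diff_op N a (osc_integral lborel ((*v) (?A j)) F) (- int_vec k) * inv_fourier \<theta> (y + int_vec k)) \<longlonglongrightarrow> L"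
      and Lb: "cmod (osc_integral lborel ((*v) (?A j)) F y - L) \<le> C * op_norm (?A j) ^ N * ?T F j"
      using sampling_error[where A="?A j" and F=F and y=y, OF A_inv \<delta> ab zero Ck \<theta> T one vanish K _ iF] unfolding C_def by auto
    let ?m = "\<lambda>s. complex_of_real (\<bar>det M\<bar> powr s)"
    have "cubic_partial_sum N a M \<phi> f j x = (\<lambda>R. ?m (of_int j / 2) * (\<Sum>k | \<forall>i. \<bar>k $ i\<bar> \<le> int R. diff_op N a (osc_integral lborel ((*v) (?A j)) F) (- int_vec k) * inv_fourier \<theta> (y + int_vec k)))"
      unfolding cubic_partial_sum_def dilate_shift_def fosc \<phi>_eq y_def sum_distrib_left
      by (intro ext sum.cong refl) (simp only: mult_ac)
    hence lim: "cubic_partial_sum N a M \<phi> f j x \<longlonglongrightarrow> ?m (of_int j / 2) * L" using L by (auto intro!: tendsto_intros)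
    have "?m (- of_int j / 2) * (?m (of_int j / 2) * L) = L"
    proof -
      have "\<bar>det M\<bar> powr (- of_int j / 2) * \<bar>det M\<bar> powr (of_int j / 2) = 1"
        using detM by (simp add: powr_add[symmetric])
      thus ?thesis by (metis mult.assoc mult_1 of_real_1 of_real_mult)
    qed
    hence ml: "?m (- of_int j / 2) * lim (cubic_partial_sum N a M \<phi> f j x) = L" by (simp only: limI[OF lim])
    have fx: "f x = osc_integral lborel ((*v) (?A j)) F y" using fosc[of y] by (simp only: x)
    show ?thesis unfolding ml fx by (intro conjI convergentI[OF lim] Lb)
  qed
  have second: "\<exists>C'. \<forall>j\<ge>J. C * op_norm (?A j) ^ N * ?T F j \<le> C' * \<tau> powr (- of_int j * (real N + \<epsilon>))"
    if \<tau>: "0 < \<tau>" "\<And>\<mu>. eigenvalue_of M \<mu> \<Longrightarrow> \<tau> < cmod \<mu>" and \<epsilon>: "0 < \<epsilon>"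
      and F: "F \<in> borel_measurable borel" and iF: "integrable lborel (\<lambda>\<xi>. norm \<xi> ^ N * cmod (F \<xi>))"
      and D: "D \<ge> 0" "\<And>r. r > 0 \<Longrightarrow> (LINT \<xi>:{\<xi>. r \<le> norm \<xi>}|lborel. norm \<xi> ^ N * cmod (F \<xi>)) \<le> D * r powr - \<epsilon>" for \<tau> \<epsilon> F D J
  proof -
    obtain E where E: "E \<ge> 0" "\<And>j. j \<ge> J \<Longrightarrow> op_norm (?A j) \<le> E * \<tau> powr (- of_int j)"
      using op_norm_mat_powi_le[OF M \<tau>] by blast
    have "C * op_norm (?A j) ^ N * ?T F j \<le> (C * D * \<delta> powr - \<epsilon> * E powr (real N + \<epsilon>)) * \<tau> powr (- of_int j * (real N + \<epsilon>))" if "j \<ge> J" for j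
    proof -
      have on: "norm (?A j *v \<xi>) \<le> op_norm (?A j) * norm \<xi>" for \<xi>
        unfolding op_norm_def by (rule onorm[OF matrix_vector_mul_bounded_linear])
      \<comment> \<open>The quotient of \<open>\<delta>\<close> by this norm will be the radius of
        the tail, so the norm must not vanish.\<close>
      have pos: "op_norm (?A j) > 0"
      proof (rule ccontr)
        assume "\<not> op_norm (?A j) > 0"
        hence "op_norm (?A j) * norm \<xi> \<le> 0" for \<xi> :: "real ^ 'n" by (intro mult_nonpos_nonneg) auto
        hence "norm (?A j *v \<xi>) \<le> 0" for \<xi> using on[of \<xi>] order.trans by blast
        hence z: "?A j *v \<xi> = 0" for \<xi> by simp
        have "matrix_inv (?A j) *v (?A j *v \<xi>) = \<xi>" for \<xi>
          by (simp add: matrix_vector_mul_assoc matrix_inv_works[OF A_inv])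
        from this[of "axis undefined 1"] show False by (simp add: z axis_eq_0_iff)
      qed
      let ?n = "op_norm (?A j)"
      have "?T F j \<le> (LINT \<xi>:{\<xi>. \<delta> / ?n \<le> norm \<xi>}|lborel. norm \<xi> ^ N * cmod (F \<xi>))"
        unfolding set_lebesgue_integral_def
      proof (rule integral_mono_AE')
        show "integrable lborel (\<lambda>\<xi>. indicat_real {\<xi>. \<delta> / ?n \<le> norm \<xi>} \<xi> *\<^sub>R (norm \<xi> ^ N * cmod (F \<xi>)))"
        proof (rule Bochner_Integration.integrable_bound[OF iF])
          show "AE \<xi> in lborel. norm (indicat_real {\<xi>. \<delta> / ?n \<le> norm \<xi>} \<xi> *\<^sub>R (norm \<xi> ^ N * cmod (F \<xi>))) \<le> norm (norm \<xi> ^ N * cmod (F \<xi>))"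
            by (intro AE_I2) (simp add: indicator_def)
        qed (use F in measurable)
        have "\<delta> / ?n \<le> norm \<xi>" if "\<delta> \<le> norm (?A j *v \<xi>)" for \<xi>
          using order.trans[OF that on] pos by (simp add: pos_divide_le_eq mult.commute)
        thus "AE \<xi> in lborel. indicat_real {\<xi>. \<delta> \<le> norm (?A j *v \<xi>)} \<xi> *\<^sub>R (norm \<xi> ^ N * cmod (F \<xi>)) \<le> indicat_real {\<xi>. \<delta> / ?n \<le> norm \<xi>} \<xi> *\<^sub>R (norm \<xi> ^ N * cmod (F \<xi>))"
          by (intro AE_I2) (simp add: indicator_def)
      qed simp
      also have "\<dots> \<le> D * (\<delta> / ?n) powr - \<epsilon>" by (rule D(2)) (use \<delta> pos in simp)
      also have "(\<delta> / ?n) powr - \<epsilon> = \<delta> powr - \<epsilon> * ?n powr \<epsilon>"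
        using \<delta> pos by (simp add: powr_divide powr_minus_divide)
      finally have "C * ?n ^ N * ?T F j \<le> C * ?n ^ N * (D * (\<delta> powr - \<epsilon> * ?n powr \<epsilon>))"
        using C0 pos by (intro mult_left_mono) auto
      also have "\<dots> = C * D * \<delta> powr - \<epsilon> * ?n powr (real N + \<epsilon>)"
        using pos by (simp add: powr_add powr_realpow)
      also have "\<dots> \<le> C * D * \<delta> powr - \<epsilon> * (E * \<tau> powr (- of_int j)) powr (real N + \<epsilon>)"
        using C0 D(1) \<epsilon> pos E(2)[OF that] by (intro mult_left_mono powr_mono2) auto
      also have "(E * \<tau> powr (- of_int j)) powr (real N + \<epsilon>) = E powr (real N + \<epsilon>) * \<tau> powr (- of_int j * (real N + \<epsilon>))"
        using E(1) by (simp add: powr_mult powr_powr)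
      finally show ?thesis by (simp only: mult.assoc)
    qed
    thus ?thesis by blast
  qed
  show ?thesis
  proof (intro exI[of _ C] allI impI)
    fix f F :: "real ^ 'n \<Rightarrow> complex" and \<epsilon> :: real
    assume h: "continuous_on UNIV f \<and> fourier_is f F \<and> integrable lborel F \<and> 0 < \<epsilon> \<and>
      (\<lambda>\<xi>. cmod (F \<xi>)) \<in> O[at_infinity](\<lambda>\<xi>. norm \<xi> powr (- (real N + real CARD('n) + \<epsilon>)))"
    hence F: "integrable lborel F" and \<epsilon>: "0 < \<epsilon>"
      and O: "(\<lambda>\<xi>. cmod (F \<xi>)) \<in> O[at_infinity](\<lambda>\<xi>. norm \<xi> powr (- (real N + real CARD('n) + \<epsilon>)))" by auto
    have Fm: "F \<in> borel_measurable borel" using F by auto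
    obtain D where D: "D \<ge> 0" "\<And>r. r > 0 \<Longrightarrow> (LINT \<xi>:{\<xi>. r \<le> norm \<xi>}|lborel. norm \<xi> ^ N * cmod (F \<xi>)) \<le> D * r powr - \<epsilon>"
      using tail_integral_bound[OF F \<epsilon> O] by blast
    note iF = integrable_norm_power_decay[OF F \<epsilon> O]
    show "(\<forall>(j::int) x.
       convergent (cubic_partial_sum N a M \<phi> f j x) \<and>
       cmod (f x - of_real (\<bar>det M\<bar> powr (- of_int j / 2)) * lim (cubic_partial_sum N a M \<phi> f j x))
         \<le> C * op_norm (?A j) ^ N * ?T F j) \<and>
    (\<forall>\<theta>::real. 0 < \<theta> \<and> (\<forall>\<mu>. eigenvalue_of M \<mu> \<longrightarrow> \<theta> < cmod \<mu>) \<longrightarrow>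
       (\<forall>J::int. \<exists>C'::real. \<forall>j\<ge>J. C * op_norm (?A j) ^ N * ?T F j \<le> C' * \<theta> powr (- of_int j * (real N + \<epsilon>))))"
      using first[OF _ _ F iF, of f] h second[OF _ _ \<epsilon> Fm iF[OF order.refl] D] by blast
  qed
qed

end
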